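(* Let $G$ be a Cohen--Macaulay chordal graph, let $F_1,\ldots,F_m$ be the maximal cliques of $G$ which admit a free vertex, and let $w_i$ be a free vertex contained in $F_i$ for each $i$. Then (1) for all $i$, $$\beta_i(J(G))=\sum_{C\in\mathrm{Min}(G)}\binom{|V(G)\setminus(\{w_1,\ldots,w_m\}\cup C)|}{i};$$ (2) $\mathrm{pd}(J(G))=\max\{|V(G)\setminus(\{w_1,\ldots,w_m\}\cup C)| : C\in\mathrm{Min}(G)\}$. In particular, the graded Betti numbers of $J(G)$ do not depend on the characteristic of the field $\Bbbk$.
   Context: Graphs are finite simple graphs; $\Bbbk$ is an arbitrary field. The edge ideal $I(G)\subseteq\Bbbk[V(G)]$ is generated by the products $uv$ with $\{u,v\}\in E(G)$; $G$ is Cohen--Macaulay if $\Bbbk[V(G)]/I(G)$ is Cohen--Macaulay. A clique is a vertex set inducing a complete subgraph; a free vertex is a vertex belonging to exactly one maximal clique. $\mathrm{Min}(G)$ is the set of inclusion-minimal vertex covers of $G$. The cover ideal $J(G)\subseteq\Bbbk[V(G)]$ is generated by the monomials $\prod_{v\in C}v$, $C$ a vertex cover of $G$. $\beta_i$ denotes the $i$-th (total) Betti number over $\Bbbk[V(G)]$ and $\mathrm{pd}$ projective dimension. *)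

theory Defs
  imports
    "HOL-Algebra.QuotRing"
    "HOL-Algebra.Module"
    "HOL-Library.Poly_Mapping"
    "HOL-Library.Extended_Nat"
    "HOL-Library.Ramsey"
begin

section \<open>Graphs\<close>

text \<open>A graph is given by its vertex set \<open>V\<close> and its set \<open>E\<close> of two-element edges.\<close>

definition simple_graph :: "'v set \<Rightarrow> 'v set set \<Rightarrow> bool" where
  "simple_graph V E \<longleftrightarrow> finite V \<and> (\<forall>e\<in>E. e \<subseteq> V \<and> card e = 2)"

text \<open>The list \<open>c\<close> runs once around the cycle. In the conclusion \<open>i \<noteq> j\<close> is automatic,
  since edges have two elements.\<close>

definition chordal :: "'v set set \<Rightarrow> bool" where
  "chordal E \<longleftrightarrow> (\<forall>c. let n = length c in
     distinct c \<and> 4 \<le> n \<and> (\<forall>i<n. {c ! i, c ! (Suc i mod n)} \<in> E) \<longrightarrow>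
     (\<exists>i<n. \<exists>j<n. {c ! i, c ! j} \<in> E \<and> j \<noteq> Suc i mod n \<and> i \<noteq> Suc j mod n))"

definition max_cliques :: "'v set \<Rightarrow> 'v set set \<Rightarrow> 'v set set" where
  "max_cliques V E = {F. F \<subseteq> V \<and> clique F E \<and> (\<forall>F'. F \<subseteq> F' \<and> F' \<subseteq> V \<and> clique F' E \<longrightarrow> F' = F)}"

definition free_vertex :: "'v set \<Rightarrow> 'v set set \<Rightarrow> 'v \<Rightarrow> bool" where
  "free_vertex V E v \<longleftrightarrow> v \<in> V \<and> (\<exists>!F. F \<in> max_cliques V E \<and> v \<in> F)"

definition vertex_covers :: "'v set \<Rightarrow> 'v set set \<Rightarrow> 'v set set" where
  "vertex_covers V E = {C. C \<subseteq> V \<and> (\<forall>e\<in>E. C \<inter> e \<noteq> {})}"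

definition min_vertex_covers :: "'v set \<Rightarrow> 'v set set \<Rightarrow> 'v set set" where
  "min_vertex_covers V E =
     {C \<in> vertex_covers V E. \<forall>C'\<in>vertex_covers V E. C' \<subseteq> C \<longrightarrow> C' = C}"


section \<open>Polynomial rings and monomial ideals\<close>

text \<open>A polynomial is a finitely supported map from exponent vectors to coefficients;
  \<open>mpoly_ring V\<close> is the ring of those polynomials in which only variables from \<open>V\<close> occur.\<close>

type_synonym ('v, 'k) mpoly = "('v \<Rightarrow>\<^sub>0 nat) \<Rightarrow>\<^sub>0 'k"

definition mpoly_ring :: "'v set \<Rightarrow> ('v, 'k::field) mpoly ring" where
  "mpoly_ring V = \<lparr>carrier = {p. \<forall>t\<in>Poly_Mapping.keys p. Poly_Mapping.keys t \<subseteq> V},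
     mult = (*), one = 1, zero = 0, add = (+)\<rparr>"

definition var :: "'v \<Rightarrow> ('v, 'k::field) mpoly" where
  "var v = Poly_Mapping.single (Poly_Mapping.single v 1) 1"

definition monom_deg :: "('v \<Rightarrow>\<^sub>0 nat) \<Rightarrow> nat" where
  "monom_deg t = (\<Sum>v\<in>Poly_Mapping.keys t. Poly_Mapping.lookup t v)"

definition irrelevant_ideal :: "'v set \<Rightarrow> ('v, 'k::field) mpoly set" where
  "irrelevant_ideal V = Idl\<^bsub>mpoly_ring V\<^esub> (var ` V)"

definition edge_ideal :: "'v set \<Rightarrow> 'v set set \<Rightarrow> ('v, 'k::field) mpoly set" where
  "edge_ideal V E = Idl\<^bsub>mpoly_ring V\<^esub> {var u * var v |u v. {u, v} \<in> E}"

definition cover_ideal :: "'v set \<Rightarrow> 'v set set \<Rightarrow> ('v, 'k::field) mpoly set" where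
  "cover_ideal V E = Idl\<^bsub>mpoly_ring V\<^esub> ((\<lambda>C. \<Prod>v\<in>C. var v) ` vertex_covers V E)"


section \<open>Cohen--Macaulay quotients of polynomial rings\<close>

definition krull_dim :: "('a, 'm) ring_scheme \<Rightarrow> enat" where
  "krull_dim R = Sup {enat n |n. \<exists>P. (\<forall>i\<le>n. primeideal (P i) R) \<and> (\<forall>i<n. P i \<subset> P (Suc i))}"

definition regular_sequence :: "('a, 'm) ring_scheme \<Rightarrow> 'a list \<Rightarrow> bool" where
  "regular_sequence R as \<longleftrightarrow>
     set as \<subseteq> carrier R \<and>
     (\<forall>i<length as. \<forall>x\<in>carrier R.
        as ! i \<otimes>\<^bsub>R\<^esub> x \<in> Idl\<^bsub>R\<^esub> (set (take i as)) \<longrightarrow> x \<in> Idl\<^bsub>R\<^esub> (set (take i as))) \<and>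
     Idl\<^bsub>R\<^esub> (set as) \<noteq> carrier R"

definition depth :: "('a, 'm) ring_scheme \<Rightarrow> 'a set \<Rightarrow> enat" where
  "depth R \<mm> = Sup {enat (length as) |as. set as \<subseteq> \<mm> \<and> regular_sequence R as}"

text \<open>Cohen--Macaulayness of \<open>\<bbbk>[V]/I\<close> for a homogeneous ideal \<open>I\<close>, in the usual sense for
  standard graded algebras: the depth with respect to the graded maximal ideal (the image of
  the irrelevant ideal) equals the Krull dimension. Regular sequences need not consist of
  homogeneous elements; restricting to homogeneous ones gives the same depth.\<close>

definition cohen_macaulay_quotient :: "'v set \<Rightarrow> ('v, 'k::field) mpoly set \<Rightarrow> bool" where
  "cohen_macaulay_quotient V I \<longleftrightarrow>
     (let S = mpoly_ring V; \<mm> = (\<lambda>p. I +>\<^bsub>S\<^esub> p) ` irrelevant_ideal V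
      in depth (S Quot I) \<mm> = krull_dim (S Quot I))"


section \<open>Resolutions\<close>

text \<open>The ring-valued fields \<open>mult\<close> and \<open>one\<close> of a module record play no role in the locale
  \<open>Module.module\<close>; they are left unspecified below.\<close>

definition ideal_module :: "('a, 'm) ring_scheme \<Rightarrow> 'a set \<Rightarrow> ('a, 'a) module" where
  "ideal_module R I = \<lparr>carrier = I, mult = undefined, one = undefined,
     zero = \<zero>\<^bsub>R\<^esub>, add = (\<oplus>\<^bsub>R\<^esub>), smult = (\<otimes>\<^bsub>R\<^esub>)\<rparr>"

text \<open>Vectors of length \<open>n\<close> are represented by sequences that vanish from index \<open>n\<close> on.\<close>

definition free_module :: "('a, 'm) ring_scheme \<Rightarrow> nat \<Rightarrow> ('a, nat \<Rightarrow> 'a) module" where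
  "free_module R n = \<lparr>carrier = {x. (\<forall>i<n. x i \<in> carrier R) \<and> (\<forall>i\<ge>n. x i = \<zero>\<^bsub>R\<^esub>)},
     mult = undefined, one = undefined,
     zero = (\<lambda>i. \<zero>\<^bsub>R\<^esub>), add = (\<lambda>x y i. x i \<oplus>\<^bsub>R\<^esub> y i), smult = (\<lambda>a x i. a \<otimes>\<^bsub>R\<^esub> x i)\<rparr>"

definition unit_vector :: "('a, 'm) ring_scheme \<Rightarrow> nat \<Rightarrow> nat \<Rightarrow> 'a" where
  "unit_vector R c = (\<lambda>i. if i = c then \<one>\<^bsub>R\<^esub> else \<zero>\<^bsub>R\<^esub>)"

definition module_hom ::
    "('a, 'm) ring_scheme \<Rightarrow> ('a, 'b) module \<Rightarrow> ('a, 'c) module \<Rightarrow> ('b \<Rightarrow> 'c) set" where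
  "module_hom R M N = {h \<in> carrier M \<rightarrow> carrier N.
     (\<forall>x\<in>carrier M. \<forall>y\<in>carrier M. h (x \<oplus>\<^bsub>M\<^esub> y) = h x \<oplus>\<^bsub>N\<^esub> h y) \<and>
     (\<forall>a\<in>carrier R. \<forall>x\<in>carrier M. h (a \<odot>\<^bsub>M\<^esub> x) = a \<odot>\<^bsub>N\<^esub> h x)}"

text \<open>Exactness of \<open>\<dots> \<rightarrow> F 2 \<rightarrow> F 1 \<rightarrow> F 0 \<rightarrow> M \<rightarrow> 0\<close> with maps \<open>d i : F (i + 1) \<rightarrow> F i\<close> and
  augmentation \<open>\<epsilon> : F 0 \<rightarrow> M\<close>.\<close>

definition resolution ::
    "('a, 'm) ring_scheme \<Rightarrow> ('a, 'b) module \<Rightarrow> (nat \<Rightarrow> ('a, 'c) module) \<Rightarrow>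
     (nat \<Rightarrow> 'c \<Rightarrow> 'c) \<Rightarrow> ('c \<Rightarrow> 'b) \<Rightarrow> bool" where
  "resolution R M F d \<epsilon> \<longleftrightarrow>
     Module.module R M \<and> (\<forall>i. Module.module R (F i)) \<and>
     \<epsilon> \<in> module_hom R (F 0) M \<and>
     (\<forall>i. d i \<in> module_hom R (F (Suc i)) (F i)) \<and>
     \<epsilon> ` carrier (F 0) = carrier M \<and>
     d 0 ` carrier (F (Suc 0)) = {x \<in> carrier (F 0). \<epsilon> x = \<zero>\<^bsub>M\<^esub>} \<and>
     (\<forall>i. d (Suc i) ` carrier (F (Suc (Suc i))) =
            {x \<in> carrier (F (Suc i)). d i x = \<zero>\<^bsub>F i\<^esub>})"

text \<open>The lifting property is stated for modules in the same type as \<open>P\<close>. This is the full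
  lifting property whenever that type is infinite and at least as large as the ring, because it
  then contains a copy of the free module on the underlying set of \<open>P\<close>.\<close>

definition projective_module :: "('a, 'm) ring_scheme \<Rightarrow> ('a, 'b) module \<Rightarrow> bool" where
  "projective_module R P \<longleftrightarrow> Module.module R P \<and>
     (\<forall>(M :: ('a, 'b) module) (N :: ('a, 'b) module). \<forall>g\<in>module_hom R M N. \<forall>f\<in>module_hom R P N.
        Module.module R M \<and> Module.module R N \<and> g ` carrier M = carrier N \<longrightarrow>
        (\<exists>h\<in>module_hom R P M. \<forall>x\<in>carrier P. g (h x) = f x))"

text \<open>The resolving modules live in \<open>nat \<Rightarrow> 'a\<close>, which contains all free modules of finite rank
  and their submodules. For a finitely generated module over a Noetherian ring this does not
  change the projective dimension: if a projective resolution of length \<open>n\<close> exists at all, then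
  truncating a resolution by free modules of finite rank gives one of length \<open>n\<close>.
  (The zero module gets dimension 0.)\<close>

definition proj_dim :: "('a, 'm) ring_scheme \<Rightarrow> ('a, 'b) module \<Rightarrow> enat" where
  "proj_dim R M = Inf {enat n |n. \<exists>(F :: nat \<Rightarrow> ('a, nat \<Rightarrow> 'a) module) d \<epsilon>.
     resolution R M F d \<epsilon> \<and> (\<forall>i. projective_module R (F i)) \<and>
     (\<forall>i>n. carrier (F i) = {\<zero>\<^bsub>F i\<^esub>})}"

text \<open>Minimal graded free resolutions of a homogeneous ideal \<open>I\<close> of \<open>S = \<bbbk>[V]\<close>: the \<open>i\<close>-th
  module is the direct sum of the \<open>S(-s i l)\<close> for \<open>l < r i\<close>, i.e.\ \<open>S\<close>-free of rank \<open>r i\<close> with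
  the \<open>l\<close>-th basis vector in degree \<open>s i l\<close>. The two degree conditions say that \<open>\<epsilon>\<close> and the
  \<open>d i\<close> are homogeneous of degree 0.\<close>

definition min_graded_free_resolution ::
    "'v set \<Rightarrow> ('v, 'k::field) mpoly set \<Rightarrow> (nat \<Rightarrow> nat) \<Rightarrow> (nat \<Rightarrow> nat \<Rightarrow> int) \<Rightarrow>
     (nat \<Rightarrow> (nat \<Rightarrow> ('v, 'k) mpoly) \<Rightarrow> (nat \<Rightarrow> ('v, 'k) mpoly)) \<Rightarrow>
     ((nat \<Rightarrow> ('v, 'k) mpoly) \<Rightarrow> ('v, 'k) mpoly) \<Rightarrow> bool" where
  "min_graded_free_resolution V I r s d \<epsilon> \<longleftrightarrow>
     (let S = mpoly_ring V in
       resolution S (ideal_module S I) (\<lambda>i. free_module S (r i)) d \<epsilon> \<and>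
       (\<forall>c<r 0. \<forall>t\<in>Poly_Mapping.keys (\<epsilon> (unit_vector S c)). int (monom_deg t) = s 0 c) \<and>
       (\<forall>i. \<forall>c<r (Suc i). \<forall>l<r i. \<forall>t\<in>Poly_Mapping.keys (d i (unit_vector S c) l).
          int (monom_deg t) + s i l = s (Suc i) c) \<and>
       (\<forall>i. \<forall>x\<in>carrier (free_module S (r (Suc i))). \<forall>l<r i. d i x l \<in> irrelevant_ideal V))"

text \<open>Minimal graded free resolutions exist and are unique up to isomorphism, so the following
  numbers are well defined for homogeneous ideals.\<close>

definition betti :: "'v set \<Rightarrow> ('v, 'k::field) mpoly set \<Rightarrow> nat \<Rightarrow> nat" where
  "betti V I i = (THE b. \<exists>r s d \<epsilon>. min_graded_free_resolution V I r s d \<epsilon> \<and> b = r i)"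

definition graded_betti :: "'v set \<Rightarrow> ('v, 'k::field) mpoly set \<Rightarrow> nat \<Rightarrow> int \<Rightarrow> nat" where
  "graded_betti V I i j = (THE b. \<exists>r s d \<epsilon>. min_graded_free_resolution V I r s d \<epsilon> \<and>
     b = card {l. l < r i \<and> s i l = j})"

end

theory Submission
  imports Defs
begin

text \<open>Cohen--Macaulayness is only needed to make all minimal vertex covers equicardinal. For a
  minimal cover \<open>C\<close> the squarefree monomial of \<open>V - C\<close> is annihilated modulo the edge ideal by the
  prime generated by \<open>C\<close>. Any \<open>N > card (V - C)\<close> elements are algebraically dependent modulo that
  prime, while a regular sequence is quasi-regular and so admits no relation that kills a nonzero
  element. Hence the depth is at most every \<open>card (V - C)\<close>, and the Krull dimension is at least that.

  For a well-covered chordal graph the cliques \<open>F j\<close> partition \<open>V\<close>, so the complements of the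
  minimal covers are the independent transversals \<open>f\<close> of the \<open>F j\<close>. As all neighbours of \<open>w j\<close> lie in
  \<open>F j\<close>, replacing \<open>f j\<close> by \<open>w j\<close> preserves independence. Joining \<open>w j\<close> to the other points of
  \<open>F j\<close> turns every \<open>F j\<close> into a star, and the transversals span a cubical subcomplex of the product
  of these stars, in which \<open>f\<close> is the outermost vertex of \<open>r choose i\<close> cubes of dimension \<open>i\<close>, where
  \<open>r\<close> is the number of \<open>j\<close> with \<open>f j \<noteq> w j\<close>. Contracting the stars one after the other shows that
  this complex supports a resolution of the cover ideal. The entries of its differentials are
  signed variables, so it is minimal and linear, and the Betti numbers count cubes.\<close>

text \<open>Why a relation cannot kill \<open>f\<close>: quasi-regularity makes the associated
  graded ring of a regular sequence a polynomial ring, and there the nonzero initial form of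
  \<open>f\<close> times a nonzero polynomial with coefficients in the field stays nonzero.
  Dependence is a matter of counting: below a large exponent bound there are more monomials in the
  given elements than exponents left modulo the prime. The cubes originate in the relations
  \<open>var (f j) * cov f = var (w j) * cov (f(j := w j))\<close>. Division by
  \<open>var (f j)\<close> thus inverts a step of the boundary, and nothing but signs enters,
  whatever the field. Betti numbers refer to all minimal resolutions and the projective dimension to
  all projective ones, so both need the comparison theorem. Passing to constant coefficients then
  leaves matrices over the field.\<close>

abbreviation supp :: "('a \<Rightarrow>\<^sub>0 'b::zero) \<Rightarrow> 'a set" where "supp \<equiv> Poly_Mapping.keys"
abbreviation coef :: "('a \<Rightarrow>\<^sub>0 'b::zero) \<Rightarrow> 'a \<Rightarrow> 'b" where "coef \<equiv> Poly_Mapping.lookup"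
abbreviation mono :: "'a \<Rightarrow> 'b::zero \<Rightarrow> 'a \<Rightarrow>\<^sub>0 'b" where "mono \<equiv> Poly_Mapping.single"

section \<open>Polynomials\<close>

text \<open>With a monomial on the left the convolution collapses to one inner sum. The
  \<open>when\<close> form lets the next two lemmas either evaluate that sum or see that it is
  empty.\<close>

lemma coef_mono_mult:
  fixes p :: "('v, 'k::field) mpoly"
  shows "coef (mono s c * p) u = c * (\<Sum>q. coef p q when u = s + q)"
proof -
  have "coef (mono s c) l * r = (c * r when l = s)" for l and r :: 'k
    by (auto simp: lookup_single when_def)
  then have "coef (mono s c * p) u = (\<Sum>l. c * (\<Sum>q. coef p q when u = l + q) when l = s)"
    unfolding lookup_mult by (rule arg_cong[OF ext])
  then show ?thesis by (simp only: Sum_any_when_equal)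
qed

lemma coef_mono_mult_add:
  fixes p :: "('v, 'k::field) mpoly"
  shows "coef (mono s c * p) (s + t) = c * coef p t"
  unfolding coef_mono_mult by (simp only: add_left_cancel Sum_any_when_equal')

lemma coef_mono_mult_eq_0:
  fixes p :: "('v, 'k::field) mpoly"
  assumes "\<And>t. u \<noteq> s + t"
  shows "coef (mono s c * p) u = 0"
proof -
  have "(coef p q when u = s + q) = 0" for q using assms by (simp add: when_def)
  then show ?thesis unfolding coef_mono_mult by simp
qed

lemma poly_eq_sum_mono:
  fixes p :: "'a \<Rightarrow>\<^sub>0 'b::comm_monoid_add"
  assumes "finite T" "supp p \<subseteq> T"
  shows "p = (\<Sum>t\<in>T. mono t (coef p t))"
proof (rule poly_mapping_eqI)
  fix t
  have "coef (\<Sum>t\<in>T. mono t (coef p t)) t = (\<Sum>s\<in>T. if s = t then coef p s else 0)"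
    unfolding lookup_sum by (rule sum.cong) (auto simp: lookup_single when_def)
  also have "\<dots> = coef p t" using assms by (auto simp: in_keys_iff)
  finally show "coef p t = coef (\<Sum>t\<in>T. mono t (coef p t)) t" by simp
qed

lemma coef_mult:
  fixes p q :: "('v, 'k::field) mpoly"
  shows "coef (p * q) u = (\<Sum>t\<in>supp p. coef (mono t (coef p t) * q) u)"
proof -
  have "p * q = (\<Sum>t\<in>supp p. mono t (coef p t)) * q"
    using poly_eq_sum_mono[of "supp p" p] by simp
  then show ?thesis by (simp add: sum_distrib_right lookup_sum)
qed

lemma supp_mult:
  fixes p q :: "('v, 'k::field) mpoly"
  assumes "u \<in> supp (p * q)"
  obtains s t where "s \<in> supp p" "t \<in> supp q" "u = s + t"
  using keys_mult[of p q] assms by blast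

text \<open>Exponents cannot cancel, so only constant terms meet. Taking constant coefficients is a
  ring map to the field, which turns homomorphisms of free modules into matrices over the
  field.\<close>

lemma coef_mult_const:
  fixes p :: "('v, 'k::field) mpoly"
  shows "coef (p * q) 0 = coef p 0 * coef q 0"
proof -
  have *: "coef (mono t (coef p t) * q) 0 = (if t = 0 then coef p 0 * coef q 0 else 0)" for t
  proof (cases "t = 0")
    case True
    then show ?thesis using coef_mono_mult_add[of 0 "coef p 0" q 0] by simp
  next
    case False
    have "0 \<noteq> t + s" for s
      using False by (metis add_eq_0_iff_both_eq_0 lookup_add lookup_zero poly_mapping_eqI)
    then show ?thesis using False by (simp add: coef_mono_mult_eq_0)
  qed
  show ?thesis
    by (cases "coef p 0 = 0") (simp_all add: coef_mult[of p q 0] * sum.delta' flip: in_keys_iff)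
qed

lemma coef_var_mult:
  fixes p :: "('v, 'k::field) mpoly"
  shows "coef (var v * p) t = (if coef t v = 0 then 0 else coef p (t - mono v 1))"
proof (cases "coef t v = 0")
  case True
  then have "t \<noteq> mono v 1 + s" for s by (auto simp: lookup_add)
  then show ?thesis using True by (simp add: var_def coef_mono_mult_eq_0)
next
  case False
  then have "t = mono v 1 + (t - mono v 1)"
    by (intro poly_mapping_eqI) (auto simp: lookup_add lookup_minus lookup_single when_def)
  then show ?thesis using False coef_mono_mult_add[of "mono v 1" 1 p "t - mono v 1"]
    by (simp add: var_def)
qed

section \<open>Polynomials in the variables of \<open>V\<close>, and ideals of their ring\<close>

definition polys :: "'v set \<Rightarrow> ('v, 'k::field) mpoly set" where
  "polys V = {p. \<forall>t\<in>supp p. supp t \<subseteq> V}"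

lemma mpoly_ring_simps [simp]:
  "carrier (mpoly_ring V) = polys V" "x \<otimes>\<^bsub>mpoly_ring V\<^esub> y = x * y" "\<one>\<^bsub>mpoly_ring V\<^esub> = 1"
  "\<zero>\<^bsub>mpoly_ring V\<^esub> = 0" "x \<oplus>\<^bsub>mpoly_ring V\<^esub> y = x + y"
  by (auto simp: mpoly_ring_def polys_def)

lemma supp_exponent_add: "supp (s + t) = supp s \<union> supp (t :: 'v \<Rightarrow>\<^sub>0 nat)"
  by (auto simp: in_keys_iff lookup_add)

lemma polys_0 [simp]: "0 \<in> polys V" by (simp add: polys_def)
lemma polys_1 [simp]: "1 \<in> polys V" by (simp add: polys_def)
lemma polys_add [simp]: "p \<in> polys V \<Longrightarrow> q \<in> polys V \<Longrightarrow> p + q \<in> polys V"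
  using keys_add[of p q] by (auto simp: polys_def)
lemma polys_uminus [simp]: "p \<in> polys V \<Longrightarrow> - p \<in> polys V"
  by (simp add: polys_def)
lemma polys_diff [simp]: "p \<in> polys V \<Longrightarrow> q \<in> polys V \<Longrightarrow> p - q \<in> polys V"
  using polys_add[of p V "- q"] by simp
lemma polys_mult [simp]: "p \<in> polys V \<Longrightarrow> q \<in> polys V \<Longrightarrow> p * q \<in> polys V"
  unfolding polys_def by (fastforce elim!: supp_mult simp: supp_exponent_add)
lemma polys_mono [simp]: "supp t \<subseteq> V \<Longrightarrow> mono t c \<in> polys V"
  by (simp add: polys_def)
lemma polys_const [simp]: "mono 0 c \<in> polys V"
  by (simp add: polys_def)
lemma polys_var [simp]: "v \<in> V \<Longrightarrow> var v \<in> polys V"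
  by (simp add: var_def)
lemma polys_sum [simp]: "(\<And>i. i \<in> A \<Longrightarrow> f i \<in> polys V) \<Longrightarrow> sum f A \<in> polys V"
  by (induction A rule: infinite_finite_induct) auto
lemma polys_prod [simp]: "(\<And>i. i \<in> A \<Longrightarrow> f i \<in> polys V) \<Longrightarrow> prod f A \<in> polys V"
  by (induction A rule: infinite_finite_induct) auto
lemma polys_power [simp]: "p \<in> polys V \<Longrightarrow> p ^ n \<in> polys V"
  by (induction n) auto

lemma cring_mpoly_ring: "cring (mpoly_ring V :: ('v, 'k::field) mpoly ring)"
proof (intro cringI abelian_groupI comm_monoidI; (simp add: algebra_simps)?)
  fix x :: "('v, 'k::field) mpoly" assume "x \<in> polys V"
  then show "\<exists>y\<in>polys V. x + y = 0" by (intro bexI[of _ "- x"]) auto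
qed

lemma ring_mpoly_ring: "ring (mpoly_ring V)"
  using cring_mpoly_ring by (rule cring.axioms)

lemma a_inv_mpoly_ring: "p \<in> polys V \<Longrightarrow> \<ominus>\<^bsub>mpoly_ring V\<^esub> p = - p"
proof -
  interpret cring "mpoly_ring V" by (rule cring_mpoly_ring)
  assume "p \<in> polys V"
  then show ?thesis by (intro minus_equality) auto
qed

lemma ideal_mpoly_ringI:
  assumes "I \<subseteq> polys V" "0 \<in> I" "\<And>p q. p \<in> I \<Longrightarrow> q \<in> I \<Longrightarrow> p + q \<in> I"
    "\<And>p q. p \<in> I \<Longrightarrow> q \<in> polys V \<Longrightarrow> q * p \<in> I"
  shows "ideal I (mpoly_ring V)"
proof -
  interpret cring "mpoly_ring V" by (rule cring_mpoly_ring)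
  have uminus: "- p \<in> I" if "p \<in> I" for p
    using assms(4)[OF that, of "- 1"] by simp
  show ?thesis
  proof (intro idealI ring_mpoly_ring subgroup.intro)
    fix p assume "p \<in> I"
    then show "inv\<^bsub>add_monoid (mpoly_ring V)\<^esub> p \<in> I"
      using assms(1) a_inv_mpoly_ring[of p V] uminus by (auto simp: a_inv_def)
  qed (use assms in \<open>auto simp: mult.commute\<close>)
qed

context
  fixes I :: "('v, 'k::field) mpoly set" and V
  assumes I: "ideal I (mpoly_ring V)"
begin

interpretation ideal I "mpoly_ring V" by (rule I)

lemma ideal_subset: "p \<in> I \<Longrightarrow> p \<in> polys V"
  using Icarr by auto
lemma ideal_0: "0 \<in> I"
  using additive_subgroup.zero_closed[OF additive_subgroup_axioms] by simp
lemma ideal_add: "p \<in> I \<Longrightarrow> q \<in> I \<Longrightarrow> p + q \<in> I"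
  using additive_subgroup.a_closed[OF additive_subgroup_axioms, of p q] by simp
lemma ideal_mult: "p \<in> I \<Longrightarrow> q \<in> polys V \<Longrightarrow> q * p \<in> I"
  using I_l_closed[of p q] by simp
lemma ideal_uminus: "p \<in> I \<Longrightarrow> - p \<in> I"
  using ideal_mult[of p "- 1"] by simp
lemma ideal_diff: "p \<in> I \<Longrightarrow> q \<in> I \<Longrightarrow> p - q \<in> I"
  using ideal_add[of p "- q"] ideal_uminus by simp
lemma ideal_sum: "(\<And>i. i \<in> A \<Longrightarrow> f i \<in> I) \<Longrightarrow> sum f A \<in> I"
  by (induction A rule: infinite_finite_induct) (auto intro: ideal_0 ideal_add)

end

lemma ideal_genideal: "T \<subseteq> polys V \<Longrightarrow> ideal (Idl\<^bsub>mpoly_ring V\<^esub> T) (mpoly_ring V)"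
  using ring.genideal_ideal[OF ring_mpoly_ring] by simp

lemma genideal_incl: "T \<subseteq> polys V \<Longrightarrow> T \<subseteq> Idl\<^bsub>mpoly_ring V\<^esub> T"
  using ring.genideal_self[OF ring_mpoly_ring] by simp

lemma genideal_least: "ideal I (mpoly_ring V) \<Longrightarrow> T \<subseteq> I \<Longrightarrow> Idl\<^bsub>mpoly_ring V\<^esub> T \<subseteq> I"
  by (rule ring.genideal_minimal[OF ring_mpoly_ring])

lemma ideal_irrelevant: "ideal (irrelevant_ideal V) (mpoly_ring V)"
  unfolding irrelevant_ideal_def by (rule ideal_genideal) auto

lemma var_irrelevant: "v \<in> V \<Longrightarrow> var v \<in> irrelevant_ideal V"
  unfolding irrelevant_ideal_def by (rule set_mp[OF genideal_incl]) auto

text \<open>The polynomials without constant term form an ideal that contains the variables.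
  Minimality of a resolution, and a regular sequence lying in the maximal ideal, are exploited
  through this consequence.\<close>

lemma irrelevant_coef_0: "p \<in> irrelevant_ideal V \<Longrightarrow> coef p 0 = 0"
proof -
  have "ideal {p \<in> polys V. coef p 0 = 0} (mpoly_ring V)"
    by (rule ideal_mpoly_ringI) (auto simp: lookup_add coef_mult_const)
  then have "irrelevant_ideal V \<subseteq> {p \<in> polys V. coef p 0 = 0}"
    unfolding irrelevant_ideal_def
    by (rule genideal_least) (auto simp: coef_var_mult[of _ 1, simplified])
  then show "p \<in> irrelevant_ideal V \<Longrightarrow> coef p 0 = 0" by auto
qed

section \<open>Well-covered chordal graphs\<close>

definition indep :: "'v set set \<Rightarrow> 'v set \<Rightarrow> bool" where
  "indep E X \<longleftrightarrow> (\<forall>a\<in>X. \<forall>b\<in>X. {a, b} \<notin> E)"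

definition max_indep :: "'v set \<Rightarrow> 'v set set \<Rightarrow> 'v set \<Rightarrow> bool" where
  "max_indep V E X \<longleftrightarrow> X \<subseteq> V \<and> indep E X \<and> (\<forall>v\<in>V - X. \<exists>x\<in>X. {v, x} \<in> E)"

text \<open>Relative to a vertex set \<open>U\<close>, so that inductions can pass to induced
  subgraphs while keeping the edge set \<open>E\<close>.\<close>

definition simplicial :: "'v set set \<Rightarrow> 'v set \<Rightarrow> 'v \<Rightarrow> bool" where
  "simplicial E U s \<longleftrightarrow> s \<in> U \<and> clique {u \<in> U. {u, s} \<in> E} E"

lemma edge_sym: "{a, b} \<in> E \<Longrightarrow> {b, a} \<in> E"
  by (simp add: insert_commute)

locale simple_graph_loc =
  fixes V :: "'v set" and E :: "'v set set"
  assumes simple: "simple_graph V E"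
begin

lemma finite_V: "finite V" using simple by (simp add: simple_graph_def)

lemma edge_neq: "{a, b} \<in> E \<Longrightarrow> a \<noteq> b"
  using simple by (auto simp: simple_graph_def)

lemma no_loop [simp]: "{a} \<notin> E"
  using edge_neq[of a a] by auto

lemma edge_in_V: "{a, b} \<in> E \<Longrightarrow> a \<in> V \<and> b \<in> V"
  using simple by (auto simp: simple_graph_def)

lemma edgeE: assumes "e \<in> E" obtains a b where "e = {a, b}" "a \<noteq> b"
proof -
  have "card e = 2" using assms simple by (auto simp: simple_graph_def)
  then show thesis using that by (auto simp: card_2_iff)
qed

lemma indep_extend:
  assumes "indep E X" "X \<subseteq> V"
  obtains Y where "max_indep V E Y" "X \<subseteq> Y"
proof -
  define \<Y> where "\<Y> = {Y. X \<subseteq> Y \<and> Y \<subseteq> V \<and> indep E Y}"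
  have "finite \<Y>" unfolding \<Y>_def using finite_V by (auto intro: finite_subset[of _ "Pow V"])
  moreover have "X \<in> \<Y>" using assms by (simp add: \<Y>_def)
  ultimately obtain Y where Y: "Y \<in> \<Y>" "\<And>Z. Z \<in> \<Y> \<Longrightarrow> Y \<subseteq> Z \<Longrightarrow> Z = Y"
    using finite_has_maximal2[of \<Y> X] by metis
  have "\<exists>x\<in>Y. {v, x} \<in> E" if "v \<in> V - Y" for v
  proof (rule ccontr)
    assume no: "\<not> (\<exists>x\<in>Y. {v, x} \<in> E)"
    have "{v, v} \<notin> E" using edge_neq by blast
    then have "insert v Y \<in> \<Y>" using Y(1) that no
      by (auto simp: \<Y>_def indep_def insert_commute)
    then show False using Y(2)[of "insert v Y"] that by auto
  qed
  then show thesis using Y(1) by (intro that[of Y]) (auto simp: max_indep_def \<Y>_def)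
qed

lemma min_vertex_cover_iff:
  "C \<in> min_vertex_covers V E \<longleftrightarrow> C \<subseteq> V \<and> max_indep V E (V - C)"
proof
  assume C: "C \<in> min_vertex_covers V E"
  then have CV: "C \<subseteq> V" and cov: "\<forall>e\<in>E. C \<inter> e \<noteq> {}"
    by (auto simp: min_vertex_covers_def vertex_covers_def)
  have "indep E (V - C)" using cov by (fastforce simp: indep_def)
  moreover have "\<exists>x\<in>V - C. {v, x} \<in> E" if v: "v \<in> C" for v
  proof (rule ccontr)
    assume no: "\<not> (\<exists>x\<in>V - C. {v, x} \<in> E)"
    have "C - {v} \<in> vertex_covers V E"
      unfolding vertex_covers_def
    proof (intro CollectI conjI ballI)
      fix e assume e: "e \<in> E"
      then obtain a b where ab: "e = {a, b}" "a \<noteq> b" using edgeE by blast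
      then have "a \<in> V" "b \<in> V" using e edge_in_V by auto
      then show "(C - {v}) \<inter> e \<noteq> {}" using cov no e ab by (fastforce simp: insert_commute)
    qed (use CV in auto)
    then show False using C v by (auto simp: min_vertex_covers_def)
  qed
  ultimately show "C \<subseteq> V \<and> max_indep V E (V - C)"
    using CV by (auto simp: max_indep_def)
next
  assume C: "C \<subseteq> V \<and> max_indep V E (V - C)"
  have "C \<inter> e \<noteq> {}" if e: "e \<in> E" for e
  proof -
    obtain a b where "e = {a, b}" using e by (rule edgeE)
    then show ?thesis using e C edge_in_V[of a b] by (auto simp: max_indep_def indep_def)
  qed
  moreover have "C' = C" if C': "C' \<in> vertex_covers V E" "C' \<subseteq> C" for C'
  proof (rule ccontr)
    assume "C' \<noteq> C"
    then obtain v where v: "v \<in> C" "v \<notin> C'" using C'(2) by auto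
    then obtain x where "x \<in> V - C" "{v, x} \<in> E" using C by (auto simp: max_indep_def)
    then show False using C' v by (auto simp: vertex_covers_def)
  qed
  ultimately show "C \<in> min_vertex_covers V E"
    using C by (auto simp: min_vertex_covers_def vertex_covers_def)
qed

lemma clique_extend:
  assumes "clique X E" "X \<subseteq> V"
  obtains Y where "Y \<in> max_cliques V E" "X \<subseteq> Y"
proof -
  define \<Y> where "\<Y> = {Y. X \<subseteq> Y \<and> Y \<subseteq> V \<and> clique Y E}"
  have "finite \<Y>" unfolding \<Y>_def using finite_V by (auto intro: finite_subset[of _ "Pow V"])
  moreover have "X \<in> \<Y>" using assms by (simp add: \<Y>_def)
  ultimately obtain Y where Y: "Y \<in> \<Y>" "\<And>Z. Z \<in> \<Y> \<Longrightarrow> Y \<subseteq> Z \<Longrightarrow> Z = Y"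
    using finite_has_maximal2[of \<Y> X] by metis
  then show thesis by (intro that[of Y]) (auto simp: max_cliques_def \<Y>_def)
qed

text \<open>An edge at \<open>w\<close> extends to a maximal clique, and a free vertex has only
  one.\<close>

lemma free_vertex_nbr:
  assumes "free_vertex V E w" "F \<in> max_cliques V E" "w \<in> F" "{w, u} \<in> E"
  shows "u \<in> F"
proof -
  have "clique {w, u} E" using assms(4) by (auto simp: clique_def insert_commute)
  then obtain Y where Y: "Y \<in> max_cliques V E" "{w, u} \<subseteq> Y"
    using edge_in_V[OF assms(4)] by (auto elim: clique_extend)
  then show ?thesis using assms by (auto simp: free_vertex_def)
qed

text \<open>Every clique through \<open>q\<close> lies in the closed neighbourhood of
  \<open>q\<close>. If this neighbourhood is itself a clique, it is the largest one through
  \<open>q\<close>.\<close>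

lemma free_vertexI:
  assumes "q \<in> V" "clique (insert q {u \<in> V. {u, q} \<in> E}) E"
  shows "insert q {u \<in> V. {u, q} \<in> E} \<in> max_cliques V E" (is "?Q \<in> _") and "free_vertex V E q"
proof -
  have sub: "F \<subseteq> ?Q" if "F \<subseteq> V" "clique F E" "q \<in> F" for F
    using that by (auto simp: clique_def)
  then show mc: "?Q \<in> max_cliques V E"
    using assms unfolding max_cliques_def by blast
  have "F = ?Q" if F: "F \<in> max_cliques V E" "q \<in> F" for F
    using sub[of F] F mc unfolding max_cliques_def by blast
  then show "free_vertex V E q" using mc assms(1) unfolding free_vertex_def by blast
qed

end

section \<open>Chordal graphs: simplicial vertices and clique covers\<close>

locale chordal_graph = simple_graph_loc +
  assumes chordal: "chordal E"
begin

text \<open>Modulo 4 the only pairs of distinct non-consecutive indices are 0, 2 and 1, 3.\<close>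

lemma four_cycle:
  assumes "distinct [a, b, c, d]" "{a, b} \<in> E" "{b, c} \<in> E" "{c, d} \<in> E" "{d, a} \<in> E"
  shows "{a, c} \<in> E \<or> {b, d} \<in> E"
proof -
  define l where "l = [a, b, c, d]"
  have l: "length l = 4" "l ! 0 = a" "l ! 1 = b" "l ! 2 = c" "l ! 3 = d"
    by (simp_all add: l_def)
  have lt4: "i = 0 \<or> i = 1 \<or> i = 2 \<or> i = 3" if "i < 4" for i :: nat using that by auto
  have "\<forall>i<4. {l ! i, l ! (Suc i mod 4)} \<in> E"
    using assms(2-5) l by (auto dest!: lt4 simp: numeral_3_eq_3[symmetric] numeral_2_eq_2[symmetric])
  moreover have "distinct l" using assms(1) by (simp add: l_def)
  ultimately obtain i j where ij: "i < 4" "j < 4" "{l ! i, l ! j} \<in> E" "j \<noteq> Suc i mod 4" "i \<noteq> Suc j mod 4"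
    using chordal l(1) unfolding chordal_def Let_def by (metis order_refl)
  moreover have "i \<noteq> j" using ij(3) edge_neq by blast
  ultimately show ?thesis using lt4[of i] lt4[of j] l by (auto simp: insert_commute)
qed

text \<open>A vertex \<open>x \<in> A\<close> that is exchanged for its neighbours in \<open>A\<close> dominates
  everything in \<open>Q\<close> that these neighbours did, since four-cycles have chords.\<close>

lemma indep_dominating_clique:
  assumes Q: "clique Q E" "finite Q" and nb: "\<And>q. q \<in> Q \<Longrightarrow> \<exists>x\<in>V - Q. {q, x} \<in> E"
  shows "\<exists>A\<subseteq>V - Q. indep E A \<and> (\<forall>q\<in>Q. \<exists>a\<in>A. {q, a} \<in> E)"
proof -
  have "\<exists>A\<subseteq>V - Q. indep E A \<and> (\<forall>q\<in>Q'. \<exists>a\<in>A. {q, a} \<in> E)" if "finite Q'" "Q' \<subseteq> Q" for Q'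
    using that
  proof (induction Q' rule: finite_induct)
    case empty
    show ?case by (rule exI[of _ "{}"]) (simp add: indep_def)
  next
    case (insert q Q')
    then obtain A where A: "A \<subseteq> V - Q" "indep E A" "\<forall>q\<in>Q'. \<exists>a\<in>A. {q, a} \<in> E" by auto
    show ?case
    proof (cases "\<exists>a\<in>A. {q, a} \<in> E")
      case True
      then show ?thesis using A by auto
    next
      case False
      obtain x where x: "x \<in> V - Q" "{q, x} \<in> E" using nb insert.prems by auto
      define A' where "A' = insert x {a \<in> A. {x, a} \<notin> E}"
      have "A' \<subseteq> V - Q" using A(1) x(1) by (auto simp: A'_def)
      moreover have "indep E A'"
        using A(2) edge_neq[of x x] by (auto simp: A'_def indep_def insert_commute)
      moreover have "\<exists>a\<in>A'. {q', a} \<in> E" if q': "q' \<in> Q'" for q'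
      proof -
        obtain a where a: "a \<in> A" "{q', a} \<in> E" using A(3) q' by auto
        show ?thesis
        proof (cases "{x, a} \<in> E")
          case True
          have "q \<noteq> q'" using insert.hyps q' by auto
          then have "{q', q} \<in> E" using Q(1) q' insert.prems by (auto simp: clique_def)
          moreover have "distinct [q, x, a, q']"
            using x a A(1) True False \<open>q \<noteq> q'\<close> insert.prems q' edge_neq by auto
          \<comment> \<open>The four-cycle is \<open>q\<close>, \<open>x\<close>, \<open>a\<close>,
            \<open>q'\<close>. Its chord \<open>{q, a}\<close> is excluded by the case assumption,
            so \<open>x\<close> takes over the role of \<open>a\<close> for
            \<open>q'\<close>.\<close>
          ultimately have "{q, a} \<in> E \<or> {x, q'} \<in> E"
            using x a True by (intro four_cycle) (auto simp: insert_commute)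
          then show ?thesis using False a(1) by (auto simp: A'_def insert_commute)
        qed (use a in \<open>auto simp: A'_def\<close>)
      qed
      ultimately show ?thesis using x(2) by (intro exI[of _ A']) (auto simp: A'_def)
    qed
  qed
  then show ?thesis using Q(2) by auto
qed

text \<open>The first hypothesis says that \<open>K\<close> is connected. If \<open>x\<close> and
  \<open>y\<close> were not adjacent, a shortest path between them through \<open>K\<close>, closed
  up via \<open>v\<close>, would be a cycle of length at least 4. A shortest path has no chords, and
  \<open>v\<close> has no neighbour in \<open>K\<close>.\<close>

lemma separator_edge:
  assumes K: "\<And>a b. a \<in> K \<Longrightarrow> b \<in> K \<Longrightarrow> (a, b) \<in> {(a, b). a \<in> K \<and> b \<in> K \<and> {a, b} \<in> E}\<^sup>*"
    and v: "v \<notin> K" "\<And>k. k \<in> K \<Longrightarrow> {v, k} \<notin> E"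
    and xy: "x \<noteq> y" "{v, x} \<in> E" "{v, y} \<in> E"
    and nb: "a \<in> K" "{x, a} \<in> E" "b \<in> K" "{b, y} \<in> E"
  shows "{x, y} \<in> E"
proof -
  define walk where "walk = (\<lambda>f n. f 0 = x \<and> f n = y \<and> (\<forall>i<n. {f i, f (Suc i)} \<in> E) \<and>
    (\<forall>i. 0 < i \<and> i < n \<longrightarrow> f i \<in> K))"
  have "\<exists>f n. f 0 = x \<and> f n = b \<and> (\<forall>i<n. {f i, f (Suc i)} \<in> E) \<and> (\<forall>i. 0 < i \<and> i \<le> n \<longrightarrow> f i \<in> K)"
    using K[OF nb(1) nb(3)]
  proof (induction rule: rtrancl_induct)
    case base
    show ?case
      by (rule exI[of _ "\<lambda>i. if i = 0 then x else a"], rule exI[of _ 1]) (use nb in auto)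
  next
    case (step c d)
    then obtain f n where f: "f 0 = x" "f n = c" "\<forall>i<n. {f i, f (Suc i)} \<in> E"
      "\<forall>i. 0 < i \<and> i \<le> n \<longrightarrow> f i \<in> K" by auto
    show ?case
      by (rule exI[of _ "f(Suc n := d)"], rule exI[of _ "Suc n"])
        (use f step.hyps in \<open>auto simp: less_Suc_eq le_Suc_eq\<close>)
  qed
  then obtain f n where f: "f 0 = x" "f n = b" "\<forall>i<n. {f i, f (Suc i)} \<in> E"
    "\<forall>i. 0 < i \<and> i \<le> n \<longrightarrow> f i \<in> K" by auto
  have "walk (f(Suc n := y)) (Suc n)"
    unfolding walk_def using f nb(4) by (auto simp: less_Suc_eq)
  then have ex: "\<exists>n f. walk f n" by blast
  define n where "n = (LEAST n. \<exists>f. walk f n)"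
  obtain f where f: "walk f n" using LeastI_ex[OF ex] by (auto simp: n_def)
  have least: "\<not> walk g k" if "k < n" for g k
    using not_less_Least[of k "\<lambda>n. \<exists>f. walk f n"] that by (auto simp: n_def)
  have f0: "f 0 = x" and fn: "f n = y" and fe: "\<And>i. i < n \<Longrightarrow> {f i, f (Suc i)} \<in> E"
    and fK: "\<And>i. 0 < i \<Longrightarrow> i < n \<Longrightarrow> f i \<in> K" using f by (auto simp: walk_def)
  \<comment> \<open>Following the chord skips the \<open>d\<close> vertices strictly between
    \<open>i\<close> and \<open>j\<close>, which contradicts the minimality of
    \<open>n\<close>.\<close>
  have no_chord: "{f i, f j} \<notin> E" if ij: "Suc i < j" "j \<le> n" for i j
  proof
    assume e: "{f i, f j} \<in> E"
    define d where "d = j - Suc i"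
    have d: "d > 0" "j = Suc i + d" using ij by (auto simp: d_def)
    have "walk (\<lambda>l. if l \<le> i then f l else f (l + d)) (n - d)"
      unfolding walk_def
    proof (intro conjI allI impI)
      fix l assume "l < n - d"
      then show "{if l \<le> i then f l else f (l + d), if Suc l \<le> i then f (Suc l) else f (Suc l + d)} \<in> E"
        using fe[of l] fe[of "l + d"] e d ij by (cases "l = i") auto
    qed (use f0 fn fK d ij in auto)
    then show False using least[of "n - d"] d ij by auto
  qed
  have inj: "f i \<noteq> f j" if ij: "i < j" "j \<le> n" for i j
  proof
    assume e: "f i = f j"
    define d where "d = j - i"
    have d: "d > 0" "j = i + d" using ij by (auto simp: d_def)
    have "walk (\<lambda>l. if l \<le> i then f l else f (l + d)) (n - d)"
      unfolding walk_def
    proof (intro conjI allI impI)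
      fix l assume "l < n - d"
      then show "{if l \<le> i then f l else f (l + d), if Suc l \<le> i then f (Suc l) else f (Suc l + d)} \<in> E"
        using fe[of l] fe[of "l + d"] e d ij by (cases "l = i") auto
    next
      \<comment> \<open>When \<open>j = n\<close>, the shortened walk stops at index
        \<open>i\<close>, and its last vertex is \<open>f i = f j = y\<close>.\<close>
      show "(if n - d \<le> i then f (n - d) else f (n - d + d)) = y"
        using e d ij fn by (cases "n = j") auto
    qed (use f0 fn fK d ij in auto)
    then show False using least[of "n - d"] d ij by auto
  qed
  show ?thesis
  proof (rule ccontr)
    assume nxy: "{x, y} \<notin> E"
    have n2: "n \<ge> 2"
    proof (rule ccontr)
      assume "\<not> n \<ge> 2"
      then have "n = 0 \<or> n = 1" by auto
      then show False using f0 fn fe[of 0] nxy xy(1) by auto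
    qed
    \<comment> \<open>Putting \<open>v\<close> in front shifts the path by one, and
      \<open>n \<ge> 2\<close> gives the cycle its length \<open>n + 2 \<ge> 4\<close>.\<close>
    define c where "c = v # map f [0..<Suc n]"
    have len: "length c = n + 2" by (simp add: c_def)
    have c0: "c ! 0 = v" by (simp add: c_def)
    have cS: "c ! Suc i = f i" if "i \<le> n" for i
      unfolding c_def nth_Cons_Suc using that by (subst nth_map) (auto simp del: upt_Suc)
    have vf: "v \<noteq> f i" if "i \<le> n" for i
      using that fK[of i] f0 fn v(1) xy edge_neq[of v] by (cases "i = 0 \<or> i = n") auto
    have "distinct c"
    proof -
      have "inj_on f {0..<Suc n}"
        using inj by (intro linorder_inj_onI) auto
      moreover have "v \<notin> f ` {0..<Suc n}" using vf by (metis atLeastLessThan_iff imageE less_Suc_eq_le)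
      ultimately show ?thesis by (simp add: c_def distinct_map del: upt_Suc)
    qed
    moreover have "{c ! i, c ! (Suc i mod length c)} \<in> E" if "i < length c" for i
    proof (cases i)
      case 0
      then show ?thesis using n2 len c0 cS[of 0] f0 xy(2) by simp
    next
      case (Suc k)
      show ?thesis
      proof (cases "k = n")
        case True
        then show ?thesis using Suc len c0 cS[of n] fn xy(3) by (simp add: insert_commute)
      next
        case False
        then show ?thesis using Suc that len cS[of k] cS[of "Suc k"] fe[of k] by simp
      qed
    qed
    ultimately obtain i j where ij: "i < n + 2" "j < n + 2" "{c ! i, c ! j} \<in> E"
      "j \<noteq> Suc i mod (n + 2)" "i \<noteq> Suc j mod (n + 2)"
      using chordal n2 unfolding chordal_def Let_def len[symmetric]
      by (metis (no_types, lifting) add_le_mono len numeral_Bit0 order_refl)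
    \<comment> \<open>The chord is symmetric in its indices, so one order suffices. A chord from
      \<open>v\<close> must end at an interior vertex of the path, hence in \<open>K\<close>,
      because the two ends of the path are cyclic neighbours of \<open>v\<close>.\<close>
    have main: False if ch: "i < j" "j < n + 2" "{c ! i, c ! j} \<in> E"
      "j \<noteq> Suc i mod (n + 2)" "i \<noteq> Suc j mod (n + 2)" for i j
    proof -
      obtain l where l: "j = Suc l" "l \<le> n" using ch(1,2) by (cases j) auto
      show False
      proof (cases i)
        case 0
        then have "l \<noteq> 0" "l \<noteq> n" using ch l by auto
        then show False using v(2)[of "f l"] fK[of l] ch 0 l c0 cS[of l] by auto
      next
        case (Suc k)
        then have "Suc k < l" using ch l by (cases "l = Suc k") auto
        then show False using no_chord[of k l] ch Suc l cS[of k] cS[of l] by auto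
      qed
    qed
    have "i \<noteq> j" using ij(3) edge_neq by blast
    then consider "i < j" | "j < i" by linarith
    then show False
    proof cases
      case 1
      then show False using main[OF _ ij(2,3,4,5)] by blast
    next
      case 2
      then show False using main[OF _ ij(1) edge_sym[OF ij(3)] ij(5,4)] by blast
    qed
  qed
qed

text \<open>Dirac's theorem, strengthened for induction by a prescribed vertex \<open>v\<close> to
  be avoided. The component \<open>K\<close> of \<open>z\<close> among the non-neighbours of
  \<open>v\<close> has as boundary \<open>B\<close> a set of neighbours of \<open>v\<close>, which
  is a clique by \<open>separator_edge\<close>. The smaller set \<open>H = K \<union> B\<close>
  contains all neighbours in \<open>U\<close> of points of \<open>K\<close>, so a simplicial vertex
  of \<open>H\<close> in \<open>K\<close> is simplicial in \<open>U\<close>.\<close>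

lemma dirac:
  assumes "finite U" "v \<in> U" "z \<in> U" "z \<noteq> v" "{v, z} \<notin> E"
  shows "\<exists>s\<in>U. s \<noteq> v \<and> {v, s} \<notin> E \<and> simplicial E U s"
  using assms
proof (induction "card U" arbitrary: U v z rule: less_induct)
  case less
  define R where "R = {u \<in> U. u \<noteq> v \<and> {v, u} \<notin> E}"
  define r where "r = (\<lambda>S. {(a, b). a \<in> S \<and> b \<in> S \<and> {a, b} \<in> E})"
  define K where "K = {k. (z, k) \<in> (r R)\<^sup>*}"
  define B where "B = {b \<in> U - K. \<exists>k\<in>K. {b, k} \<in> E}"
  have zR: "z \<in> R" using less.prems by (auto simp: R_def)
  have zK: "z \<in> K" by (simp add: K_def)
  have KR: "K \<subseteq> R"
  proof
    fix k assume "k \<in> K"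
    then have "(z, k) \<in> (r R)\<^sup>*" by (simp add: K_def)
    then show "k \<in> R" using zR by (induction rule: rtrancl_induct) (auto simp: r_def)
  qed
  have K_closed: "b \<in> K" if "a \<in> K" "b \<in> R" "{a, b} \<in> E" for a b
    using that KR by (auto simp: K_def r_def intro: rtrancl_into_rtrancl)
  \<comment> \<open>A path from \<open>z\<close> inside \<open>R\<close> never leaves
    \<open>K\<close>, so \<open>K\<close> is connected by its own edges, as
    \<open>separator_edge\<close> demands.\<close>
  have reachK: "(z, k) \<in> (r K)\<^sup>*" if "(z, k) \<in> (r R)\<^sup>*" for k
    using that
  proof (induction rule: rtrancl_induct)
    case (step a b)
    then have "a \<in> K" "b \<in> K" by (auto simp: K_def)
    then show ?case using step by (auto simp: r_def intro: rtrancl_into_rtrancl)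
  qed auto
  have "sym (r K)" by (auto simp: r_def sym_def insert_commute)
  then have conn: "(a, b) \<in> (r K)\<^sup>*" if "a \<in> K" "b \<in> K" for a b
    using that reachK[of a] reachK[of b] sym_rtrancl[of "r K"]
    by (auto simp: K_def dest: symD intro: rtrancl_trans)
  have Bv: "{v, b} \<in> E" if b: "b \<in> B" for b
  proof (rule ccontr)
    assume no: "{v, b} \<notin> E"
    obtain k where k: "k \<in> K" "{b, k} \<in> E" using b by (auto simp: B_def)
    have "b \<noteq> v" using k KR by (auto simp: R_def)
    then have "b \<in> R" using no b by (auto simp: R_def B_def)
    then show False using K_closed[of k b] k b by (auto simp: B_def insert_commute)
  qed
  have B: "clique B E"
    unfolding clique_def
  proof (intro ballI impI)
    fix x y assume xy: "x \<in> B" "y \<in> B" "x \<noteq> y"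
    then obtain a b where ab: "a \<in> K" "{x, a} \<in> E" "b \<in> K" "{b, y} \<in> E"
      by (auto simp: B_def insert_commute)
    show "{x, y} \<in> E"
    proof (rule separator_edge)
      show "(a, b) \<in> {(a, b). a \<in> K \<and> b \<in> K \<and> {a, b} \<in> E}\<^sup>*" if "a \<in> K" "b \<in> K" for a b
        using conn[OF that] by (simp add: r_def)
      show "v \<notin> K" "\<And>k. k \<in> K \<Longrightarrow> {v, k} \<notin> E" using KR by (auto simp: R_def)
    qed (use ab xy Bv in auto)
  qed
  define H where "H = K \<union> B"
  have KU: "K \<subseteq> U" using KR by (auto simp: R_def)
  have "H \<subseteq> U" using KU by (auto simp: H_def B_def)
  moreover have "v \<notin> H" using KR Bv[of v] by (auto simp: H_def R_def)
  ultimately have "H \<subset> U" using less.prems(2) by auto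
  then have cardH: "card H < card U" and finH: "finite H"
    using less.prems(1) by (auto intro: psubset_card_mono finite_subset[of H U])
  \<comment> \<open>The induction hypothesis must be kept from returning a point of
    \<open>B\<close>. A vertex of \<open>B\<close> with a non-neighbour in \<open>H\<close> does
    this, since \<open>B\<close> is a clique. If there is none, \<open>B\<close> is joined to all of
    \<open>H\<close>, and any non-adjacent pair of \<open>H\<close> serves as well.\<close>
  have "\<exists>s\<in>K. simplicial E H s"
  proof (cases "\<exists>b\<in>B. \<exists>h\<in>H. h \<noteq> b \<and> {b, h} \<notin> E")
    case True
    then obtain b h where bh: "b \<in> B" "h \<in> H" "h \<noteq> b" "{b, h} \<notin> E" by auto
    then obtain s where s: "s \<in> H" "s \<noteq> b" "{b, s} \<notin> E" "simplicial E H s"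
      using less.hyps[OF cardH finH, of b h] by (auto simp: H_def)
    then have "s \<notin> B" using B bh(1) by (auto simp: clique_def)
    then show ?thesis using s by (auto simp: H_def)
  next
    case no: False
    show ?thesis
    proof (cases "clique H E")
      case True
      then show ?thesis using zK by (intro bexI[of _ z]) (auto simp: simplicial_def clique_def H_def)
    next
      case False
      then obtain h h' where h: "h \<in> H" "h' \<in> H" "h' \<noteq> h" "{h, h'} \<notin> E" by (auto simp: clique_def)
      then obtain s where s: "s \<in> H" "s \<noteq> h" "{h, s} \<notin> E" "simplicial E H s"
        using less.hyps[OF cardH finH, of h h'] by auto
      then have "s \<notin> B" using no h(1) edge_sym by metis
      then show ?thesis using s by (auto simp: H_def)
    qed
  qed
  then obtain s where s: "s \<in> K" "simplicial E H s" by auto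
  have "{u \<in> U. {u, s} \<in> E} \<subseteq> {u \<in> H. {u, s} \<in> E}"
    using s(1) by (auto simp: H_def B_def)
  then have "simplicial E U s" using s KU by (auto simp: simplicial_def clique_def)
  then show ?case using s(1) KR by (auto simp: R_def)
qed

lemma exists_simplicial:
  assumes "finite U" "U \<noteq> {}"
  shows "\<exists>s. simplicial E U s"
proof (cases "clique U E")
  case True
  then show ?thesis using assms by (auto simp: simplicial_def clique_def)
next
  case False
  then show ?thesis using dirac[OF assms(1)] by (force simp: clique_def)
qed

text \<open>Closed neighbourhoods of successive simplicial vertices are peeled off. The cover then
  uses exactly as many cliques as the independent set \<open>I\<close> has points, which
  \<open>F_cover\<close> plays off against well-coveredness.\<close>

lemma clique_cover:
  assumes "finite U"
  shows "\<exists>I P. I \<subseteq> U \<and> indep E I \<and> U = (\<Union>s\<in>I. P s) \<and> (\<forall>s\<in>I. clique (P s) E)"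
  using assms
proof (induction "card U" arbitrary: U rule: less_induct)
  case less
  show ?case
  proof (cases "U = {}")
    case True
    then show ?thesis by (intro exI[of _ "{}"]) (auto simp: indep_def)
  next
    case False
    then obtain s where s: "simplicial E U s" using exists_simplicial less.prems by blast
    define N where "N = insert s {u \<in> U. {u, s} \<in> E}"
    have N: "s \<in> N" "N \<subseteq> U" "clique N E"
      using s by (auto simp: N_def simplicial_def clique_def insert_commute)
    have "card (U - N) < card U" using N less.prems by (intro psubset_card_mono) auto
    then obtain I P where IP: "I \<subseteq> U - N" "indep E I" "U - N = (\<Union>s\<in>I. P s)" "\<forall>s\<in>I. clique (P s) E"
      using less.hyps[of "U - N"] less.prems by (metis finite_Diff)
    have "indep E (insert s I)"
      using IP(1,2) edge_neq[of s s] by (auto simp: indep_def N_def insert_commute)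
    moreover have "s \<notin> I" using IP(1) N by auto
    then have P: "(\<Union>t\<in>insert s I. (P(s := N)) t) = N \<union> (\<Union>t\<in>I. P t)" by auto
    have "U = (\<Union>t\<in>insert s I. (P(s := N)) t)" unfolding P using IP(3) N by blast
    ultimately show ?thesis using N IP \<open>s \<notin> I\<close>
      by (intro exI[of _ "insert s I"] exI[of _ "P(s := N)"]) auto
  qed
qed

end

section \<open>Well-covered chordal graphs: the cliques with a free vertex partition
  \<open>V\<close>\<close>

locale well_covered_chordal = chordal_graph +
  fixes m :: nat and F :: "nat \<Rightarrow> 'v set" and w :: "nat \<Rightarrow> 'v"
  assumes unmixed: "\<And>C C'. C \<in> min_vertex_covers V E \<Longrightarrow> C' \<in> min_vertex_covers V E \<Longrightarrow> card C = card C'"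
    and F: "bij_betw F {1..m} {F' \<in> max_cliques V E. \<exists>v\<in>F'. free_vertex V E v}"
    and w: "\<And>i. i \<in> {1..m} \<Longrightarrow> w i \<in> F i \<and> free_vertex V E (w i)"
begin

text \<open>Well-coveredness read off on complements: all maximal independent sets have the same
  size, and any independent set extends to one.\<close>

lemma max_indep_card_le:
  assumes "max_indep V E X" "indep E Y" "Y \<subseteq> V"
  shows "card Y \<le> card X"
proof -
  obtain Z where Z: "max_indep V E Z" "Y \<subseteq> Z" using indep_extend assms(2,3) by metis
  have V: "X \<subseteq> V" "Z \<subseteq> V" using assms Z by (auto simp: max_indep_def)
  then have "V - (V - X) = X" "V - (V - Z) = Z" by auto
  then have "card (V - X) = card (V - Z)"
    using unmixed[of "V - X" "V - Z"] assms(1) Z(1) by (simp add: min_vertex_cover_iff)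
  then have "card X = card Z" using V finite_V
    by (metis card_Diff_subset card_mono diff_diff_cancel finite_subset)
  then show ?thesis using Z V finite_V by (metis card_mono finite_subset)
qed

lemma F_max_clique: "j \<in> {1..m} \<Longrightarrow> F j \<in> max_cliques V E"
  using F by (auto simp: bij_betw_def)

lemma F_subset: "j \<in> {1..m} \<Longrightarrow> F j \<subseteq> V"
  using F_max_clique by (auto simp: max_cliques_def)

lemma F_edge: "j \<in> {1..m} \<Longrightarrow> a \<in> F j \<Longrightarrow> b \<in> F j \<Longrightarrow> a \<noteq> b \<Longrightarrow> {a, b} \<in> E"
  using F_max_clique by (auto simp: max_cliques_def clique_def)

lemma w_in_F: "j \<in> {1..m} \<Longrightarrow> w j \<in> F j"
  using w by blast

lemma w_nbr: "j \<in> {1..m} \<Longrightarrow> {w j, u} \<in> E \<Longrightarrow> u \<in> F j"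
  using free_vertex_nbr[of "w j" "F j" u] w F_max_clique by auto

lemma w_unique: "i \<in> {1..m} \<Longrightarrow> j \<in> {1..m} \<Longrightarrow> w i \<in> F j \<Longrightarrow> i = j"
proof -
  assume ij: "i \<in> {1..m}" "j \<in> {1..m}" "w i \<in> F j"
  then have "F i = F j" using w[of i] F_max_clique unfolding free_vertex_def by blast
  then show "i = j" using F ij unfolding bij_betw_def inj_on_def by blast
qed

text \<open>If \<open>v\<close> lay in two of the cliques, a maximal independent set through
  \<open>v\<close> could trade \<open>v\<close> for the two non-adjacent free vertices
  \<open>w i\<close> and \<open>w j\<close> and would grow.\<close>

lemma F_disjoint:
  assumes "i \<in> {1..m}" "j \<in> {1..m}" "v \<in> F i" "v \<in> F j"
  shows "i = j"
proof (rule ccontr)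
  assume ij: "i \<noteq> j"
  have "{v, v} \<notin> E" using edge_neq by blast
  then obtain X where X: "max_indep V E X" "v \<in> X"
    using indep_extend[of "{v}"] F_subset assms by (auto simp: indep_def)
  have wv: "w i \<noteq> v" "w j \<noteq> v" using w_unique assms ij by blast+
  have ww: "w i \<noteq> w j" using w_unique[of i j] w_in_F assms ij by auto
  have wwE: "{w i, w j} \<notin> E" using w_nbr[of i "w j"] w_unique[of j i] assms ij by auto
  have meet: "x = v" if "k \<in> {i, j}" "x \<in> X" "x \<in> F k" for k x
    using that assms X F_edge[of k x v] by (auto simp: max_indep_def indep_def)
  have no: "{w k, x} \<notin> E" if "k \<in> {i, j}" "x \<in> X - {v}" for k x
    using meet[of k x] w_nbr[of k x] that assms by auto
  have wX: "w k \<notin> X" if "k \<in> {i, j}" for k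
    using meet[of k "w k"] that w_in_F assms wv by auto
  have "indep E (insert (w i) (insert (w j) (X - {v})))"
    using X(1) no wwE by (auto simp: indep_def max_indep_def insert_commute)
  moreover have "insert (w i) (insert (w j) (X - {v})) \<subseteq> V"
    using w_in_F F_subset assms X(1) unfolding max_indep_def by blast
  ultimately have "card (insert (w i) (insert (w j) (X - {v}))) \<le> card X"
    by (rule max_indep_card_le[OF X(1)])
  moreover have fin: "finite X" using X(1) finite_V finite_subset unfolding max_indep_def by blast
  ultimately show False using wX ww card.remove[OF fin X(2)] by simp
qed

text \<open>In a clique cover indexed by an independent set \<open>I\<close>, the clique
  \<open>P s\<close> through \<open>v\<close> has a vertex \<open>q\<close> without neighbours
  outside \<open>P s\<close>, so \<open>q\<close> is free and \<open>P s\<close> is one of the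
  \<open>F j\<close>. Otherwise an independent set outside \<open>P s\<close> would dominate
  \<open>P s\<close>; a maximal independent set above it would miss \<open>P s\<close> and meet each
  other clique at most once, and so be smaller than \<open>I\<close>.\<close>

lemma F_cover:
  assumes "v \<in> V"
  shows "\<exists>j\<in>{1..m}. v \<in> F j"
proof -
  obtain I P where I: "I \<subseteq> V" "indep E I" "V = (\<Union>s\<in>I. P s)" and P: "\<forall>s\<in>I. clique (P s) E"
    using clique_cover[OF finite_V] by auto
  have finI: "finite I" using I finite_V finite_subset by auto
  obtain s where s: "s \<in> I" "v \<in> P s" using assms I by auto
  have PV: "P s \<subseteq> V" using s I by auto
  have "\<exists>q\<in>P s. \<forall>x\<in>V - P s. {q, x} \<notin> E"
  proof (rule ccontr)
    assume "\<not> ?thesis"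
    then have nb: "\<exists>x\<in>V - P s. {q, x} \<in> E" if "q \<in> P s" for q using that by blast
    have "finite (P s)" using PV finite_V finite_subset by blast
    then obtain A where A: "A \<subseteq> V - P s" "indep E A" "\<forall>q\<in>P s. \<exists>a\<in>A. {q, a} \<in> E"
      using indep_dominating_clique[OF _ _ nb] P s(1) by metis
    obtain M where M: "max_indep V E M" "A \<subseteq> M" using indep_extend[OF A(2)] A(1) by auto
    have disj: "M \<inter> P s = {}"
      using M A(3) by (fastforce simp: max_indep_def indep_def)
    define g where "g = (\<lambda>x. SOME t. t \<in> I - {s} \<and> x \<in> P t)"
    have g: "g x \<in> I - {s} \<and> x \<in> P (g x)" if "x \<in> M" for x
    proof -
      have "x \<in> V" using that M by (auto simp: max_indep_def)
      then obtain t where "t \<in> I" "x \<in> P t" using I(3) by blast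
      then have "t \<in> I - {s} \<and> x \<in> P t" using that disj by auto
      then show ?thesis unfolding g_def by (rule someI)
    qed
    have "inj_on g M"
    proof (rule inj_onI, rule ccontr)
      fix x y assume "x \<in> M" "y \<in> M" "g x = g y" "x \<noteq> y"
      then have "{x, y} \<in> E" using g[of x] g[of y] P by (auto simp: clique_def)
      then show False using M \<open>x \<in> M\<close> \<open>y \<in> M\<close> by (auto simp: max_indep_def indep_def)
    qed
    then have "card M \<le> card (I - {s})"
      using g finI by (intro card_inj_on_le[of g]) auto
    also have "\<dots> < card I" using finI s(1) by (rule card_Diff1_less)
    finally show False using max_indep_card_le[OF M(1) I(2) I(1)] by simp
  qed
  then obtain q where q: "q \<in> P s" "\<forall>x\<in>V - P s. {q, x} \<notin> E" by auto
  then have eq: "insert q {u \<in> V. {u, q} \<in> E} = P s"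
    using P s(1) PV by (auto simp: clique_def insert_commute)
  have "P s \<in> max_cliques V E" "free_vertex V E q"
    using free_vertexI[of q] eq q(1) PV P s(1) by auto
  then have "P s \<in> F ` {1..m}" using F q(1) by (auto simp: bij_betw_def)
  then show ?thesis using s by auto
qed

lemma indep_transversal:
  assumes "f \<in> {1..m} \<rightarrow>\<^sub>E V" "\<And>j. j \<in> {1..m} \<Longrightarrow> f j \<in> F j" "indep E (f ` {1..m})"
  shows "V - f ` {1..m} \<in> min_vertex_covers V E"
proof -
  have sub: "f ` {1..m} \<subseteq> V" using assms(1) by auto
  have "\<exists>x\<in>f ` {1..m}. {v, x} \<in> E" if v: "v \<in> V - f ` {1..m}" for v
  proof -
    obtain j where j: "j \<in> {1..m}" "v \<in> F j" using F_cover v by blast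
    then have "{v, f j} \<in> E" using v by (intro F_edge[of j] assms(2)) auto
    then show ?thesis using j by auto
  qed
  then have "max_indep V E (f ` {1..m})" using sub assms(3) by (auto simp: max_indep_def)
  moreover have "V - (V - f ` {1..m}) = f ` {1..m}" using sub by auto
  ultimately show ?thesis by (simp add: min_vertex_cover_iff)
qed

text \<open>Maximality forces the independent set to meet each \<open>F j\<close>: it contains
  \<open>w j\<close> or a neighbour of \<open>w j\<close>, and all these neighbours lie in
  \<open>F j\<close>.\<close>

lemma transversal_exists:
  assumes "C \<in> min_vertex_covers V E"
  obtains f where "f \<in> {1..m} \<rightarrow>\<^sub>E V" "\<And>j. j \<in> {1..m} \<Longrightarrow> f j \<in> F j" "indep E (f ` {1..m})"
    "C = V - f ` {1..m}"
proof -
  define X where "X = V - C"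
  have X: "max_indep V E X" "C \<subseteq> V" using assms by (auto simp: X_def min_vertex_cover_iff)
  have ex: "\<exists>x. x \<in> X \<and> x \<in> F j" if j: "j \<in> {1..m}" for j
  proof (cases "w j \<in> X")
    case True
    then show ?thesis using w_in_F j by auto
  next
    case False
    moreover have "w j \<in> V" using w_in_F F_subset j by auto
    ultimately obtain x where "x \<in> X" "{w j, x} \<in> E" using X(1) unfolding max_indep_def by blast
    then show ?thesis using w_nbr j by auto
  qed
  define f where "f = (\<lambda>j\<in>{1..m}. SOME x. x \<in> X \<and> x \<in> F j)"
  have f: "f j \<in> X \<and> f j \<in> F j" if "j \<in> {1..m}" for j
    using someI_ex[OF ex[OF that]] that by (simp add: f_def)
  have "X \<subseteq> f ` {1..m}"
  proof
    fix x assume x: "x \<in> X"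
    then obtain j where j: "j \<in> {1..m}" "x \<in> F j" using F_cover X unfolding max_indep_def by blast
    then have "x = f j" using F_edge[of j x "f j"] f[of j] X x by (auto simp: max_indep_def indep_def)
    then show "x \<in> f ` {1..m}" using j by auto
  qed
  then have X_eq: "X = f ` {1..m}" using f by auto
  show thesis
  proof (rule that[of f])
    show "f \<in> {1..m} \<rightarrow>\<^sub>E V" using f X(1) by (auto simp: max_indep_def f_def)
    show "indep E (f ` {1..m})" using X(1) X_eq by (metis max_indep_def)
    show "C = V - f ` {1..m}" using X(2) X_eq X_def by blast
  qed (use f in auto)
qed

end

section \<open>Modules over polynomial rings\<close>

lemma free_module_simps [simp]:
  "\<zero>\<^bsub>free_module (mpoly_ring V) n\<^esub> = (\<lambda>i. 0)"
  "x \<oplus>\<^bsub>free_module (mpoly_ring V) n\<^esub> y = (\<lambda>i. x i + y i)"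
  "a \<odot>\<^bsub>free_module (mpoly_ring V) n\<^esub> x = (\<lambda>i. a * x i)"
  by (simp_all add: free_module_def)

text \<open>The entries from \<open>n\<close> on are 0, which is also a polynomial over
  \<open>V\<close>. This uniform description avoids bounds on \<open>i\<close> in later closure
  arguments.\<close>

lemma free_module_carrier:
  "x \<in> carrier (free_module (mpoly_ring V) n) \<longleftrightarrow> (\<forall>i. x i \<in> polys V) \<and> (\<forall>i\<ge>n. x i = 0)"
proof -
  have "x i \<in> polys V" if "\<forall>i<n. x i \<in> polys V" "\<forall>i\<ge>n. x i = 0" for i
    using that by (cases "i < n") simp_all
  then show ?thesis by (auto simp: free_module_def)
qed

lemma ideal_module_simps [simp]:
  "carrier (ideal_module (mpoly_ring V) I) = I"
  "\<zero>\<^bsub>ideal_module (mpoly_ring V) I\<^esub> = 0"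
  "x \<oplus>\<^bsub>ideal_module (mpoly_ring V) I\<^esub> y = x + y"
  "a \<odot>\<^bsub>ideal_module (mpoly_ring V) I\<^esub> x = a * x"
  by (simp_all add: ideal_module_def)

lemma module_free_module: "Module.module (mpoly_ring V) (free_module (mpoly_ring V) n)"
proof (rule moduleI[OF cring_mpoly_ring])
  show "abelian_group (free_module (mpoly_ring V) n)"
  proof (rule abelian_groupI)
    fix x assume x: "x \<in> carrier (free_module (mpoly_ring V) n)"
    show "\<exists>y\<in>carrier (free_module (mpoly_ring V) n).
        y \<oplus>\<^bsub>free_module (mpoly_ring V) n\<^esub> x = \<zero>\<^bsub>free_module (mpoly_ring V) n\<^esub>"
      by (rule bexI[of _ "\<lambda>i. - x i"]) (use x in \<open>simp_all add: free_module_carrier\<close>)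
  qed (simp_all add: free_module_carrier algebra_simps)
qed (simp_all add: free_module_carrier algebra_simps)

lemma module_ideal_module:
  assumes "ideal I (mpoly_ring V)"
  shows "Module.module (mpoly_ring V) (ideal_module (mpoly_ring V) I)"
proof (rule moduleI[OF cring_mpoly_ring])
  show "abelian_group (ideal_module (mpoly_ring V) I)"
  proof (rule abelian_groupI)
    fix x assume x: "x \<in> carrier (ideal_module (mpoly_ring V) I)"
    show "\<exists>y\<in>carrier (ideal_module (mpoly_ring V) I).
        y \<oplus>\<^bsub>ideal_module (mpoly_ring V) I\<^esub> x = \<zero>\<^bsub>ideal_module (mpoly_ring V) I\<^esub>"
      by (rule bexI[of _ "- x"]) (use x ideal_uminus[OF assms] in simp_all)
  qed (simp_all add: ideal_add[OF assms] ideal_0[OF assms] algebra_simps)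
qed (simp_all add: ideal_mult[OF assms] algebra_simps)

lemma unit_vector_carrier: "c < n \<Longrightarrow> unit_vector (mpoly_ring V) c \<in> carrier (free_module (mpoly_ring V) n)"
  by (simp add: free_module_carrier unit_vector_def)

context
  fixes R :: "('a, 'm) ring_scheme" and M :: "('a, 'b) module" and N :: "('a, 'c) module" and h
  assumes h: "h \<in> module_hom R M N"
begin

lemma hom_closed: "x \<in> carrier M \<Longrightarrow> h x \<in> carrier N"
  using h by (auto simp: module_hom_def)

lemma hom_add: "x \<in> carrier M \<Longrightarrow> y \<in> carrier M \<Longrightarrow> h (x \<oplus>\<^bsub>M\<^esub> y) = h x \<oplus>\<^bsub>N\<^esub> h y"
  using h by (simp add: module_hom_def)

lemma hom_smult: "a \<in> carrier R \<Longrightarrow> x \<in> carrier M \<Longrightarrow> h (a \<odot>\<^bsub>M\<^esub> x) = a \<odot>\<^bsub>N\<^esub> h x"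
  using h by (simp add: module_hom_def)

lemma hom_zero:
  assumes "Module.module R M" "Module.module R N"
  shows "h \<zero>\<^bsub>M\<^esub> = \<zero>\<^bsub>N\<^esub>"
proof -
  interpret M: Module.module R M by fact
  interpret N: Module.module R N by fact
  have "h (\<zero>\<^bsub>R\<^esub> \<odot>\<^bsub>M\<^esub> \<zero>\<^bsub>M\<^esub>) = \<zero>\<^bsub>R\<^esub> \<odot>\<^bsub>N\<^esub> h \<zero>\<^bsub>M\<^esub>" by (rule hom_smult) simp_all
  then show ?thesis using hom_closed[of "\<zero>\<^bsub>M\<^esub>"] by simp
qed

text \<open>Projectivity is about surjections. Shrinking the codomain to the image makes any
  homomorphism surjective.\<close>

lemma submodule_image:
  assumes "Module.module R M" "Module.module R N"
  shows "Module.module R (N\<lparr>carrier := h ` carrier M\<rparr>)"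
proof -
  interpret M: Module.module R M by fact
  interpret N: Module.module R N by fact
  have "submodule (h ` carrier M) R N"
  proof (rule N.submoduleI)
    show "h ` carrier M \<subseteq> carrier N" using hom_closed by blast
    show "\<zero>\<^bsub>N\<^esub> \<in> h ` carrier M" using hom_zero[OF assms] M.zero_closed by (metis imageI)
    fix a assume "a \<in> h ` carrier M"
    then obtain x where x: "x \<in> carrier M" "a = h x" by blast
    have "h (\<ominus>\<^bsub>R\<^esub> \<one>\<^bsub>R\<^esub> \<odot>\<^bsub>M\<^esub> x) = \<ominus>\<^bsub>N\<^esub> a"
      using hom_smult[of "\<ominus>\<^bsub>R\<^esub> \<one>\<^bsub>R\<^esub>" x] x hom_closed[of x] by (simp add: N.smult_l_minus)
    moreover have "\<ominus>\<^bsub>R\<^esub> \<one>\<^bsub>R\<^esub> \<odot>\<^bsub>M\<^esub> x \<in> carrier M" using x by simp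
    ultimately show "\<ominus>\<^bsub>N\<^esub> a \<in> h ` carrier M" by (metis imageI)
  next
    fix a b assume "a \<in> h ` carrier M" "b \<in> h ` carrier M"
    then obtain x y where "x \<in> carrier M" "a = h x" "y \<in> carrier M" "b = h y" by blast
    then have "a \<oplus>\<^bsub>N\<^esub> b = h (x \<oplus>\<^bsub>M\<^esub> y)" "x \<oplus>\<^bsub>M\<^esub> y \<in> carrier M" by (simp_all add: hom_add)
    then show "a \<oplus>\<^bsub>N\<^esub> b \<in> h ` carrier M" by (metis imageI)
  next
    fix a b assume a: "a \<in> carrier R" and "b \<in> h ` carrier M"
    then obtain x where "x \<in> carrier M" "b = h x" by blast
    then have "a \<odot>\<^bsub>N\<^esub> b = h (a \<odot>\<^bsub>M\<^esub> x)" "a \<odot>\<^bsub>M\<^esub> x \<in> carrier M" using a by (simp_all add: hom_smult)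
    then show "a \<odot>\<^bsub>N\<^esub> b \<in> h ` carrier M" by (metis imageI)
  qed
  then show ?thesis using submodule.submodule_is_module assms(2) by metis
qed

end

lemma hom_comp:
  assumes "g \<in> module_hom R M N" "h \<in> module_hom R N P"
  shows "(\<lambda>x. h (g x)) \<in> module_hom R M P"
  using hom_closed[OF assms(1)] hom_closed[OF assms(2)] hom_add[OF assms(1)] hom_add[OF assms(2)]
    hom_smult[OF assms(1)] hom_smult[OF assms(2)]
  by (auto simp: module_hom_def)

lemma module_homI:
  assumes "\<And>x. x \<in> carrier M \<Longrightarrow> h x \<in> carrier N"
    "\<And>x y. x \<in> carrier M \<Longrightarrow> y \<in> carrier M \<Longrightarrow> h (x \<oplus>\<^bsub>M\<^esub> y) = h x \<oplus>\<^bsub>N\<^esub> h y"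
    "\<And>a x. a \<in> carrier R \<Longrightarrow> x \<in> carrier M \<Longrightarrow> h (a \<odot>\<^bsub>M\<^esub> x) = a \<odot>\<^bsub>N\<^esub> h x"
  shows "h \<in> module_hom R M N"
  using assms by (auto simp: module_hom_def)

section \<open>Linear combinations and the universal property of free modules\<close>

primrec lincomb :: "('a, 'b) module \<Rightarrow> (nat \<Rightarrow> 'b) \<Rightarrow> (nat \<Rightarrow> 'a) \<Rightarrow> nat \<Rightarrow> 'b" where
  "lincomb N y x 0 = \<zero>\<^bsub>N\<^esub>"
| "lincomb N y x (Suc n) = lincomb N y x n \<oplus>\<^bsub>N\<^esub> x n \<odot>\<^bsub>N\<^esub> y n"

lemma lincomb_closed:
  assumes "Module.module R N" "\<And>c. c < n \<Longrightarrow> y c \<in> carrier N" "\<And>c. x c \<in> carrier R"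
  shows "lincomb N y x n \<in> carrier N"
proof -
  interpret Module.module R N by fact
  show ?thesis using assms(2,3) by (induction n) simp_all
qed

lemma lincomb_cong: "(\<And>c. c < n \<Longrightarrow> y c = y' c) \<Longrightarrow> lincomb N y x n = lincomb N y' x n"
  by (induction n) simp_all

text \<open>The existence half of the universal property: the basis may be sent anywhere.\<close>

lemma lincomb_hom:
  fixes N :: "(('v, 'k::field) mpoly, 'c) module"
  assumes N: "Module.module (mpoly_ring V) N" and y: "\<And>c. c < n \<Longrightarrow> y c \<in> carrier N"
  shows "(\<lambda>x. lincomb N y x n) \<in> module_hom (mpoly_ring V) (free_module (mpoly_ring V) n) N"
proof -
  interpret N: Module.module "mpoly_ring V" N by fact
  have cl: "lincomb N y x k \<in> carrier N" if "k \<le> n" "\<And>c. x c \<in> polys V" for x k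
    using that y by (intro lincomb_closed[OF N]) simp_all
  show ?thesis
  proof (rule module_homI)
    fix x :: "nat \<Rightarrow> ('v, 'k) mpoly" assume x: "x \<in> carrier (free_module (mpoly_ring V) n)"
    then have xp: "x c \<in> polys V" for c by (simp add: free_module_carrier)
    then show "lincomb N y x n \<in> carrier N" using cl by blast
    {
      fix x' :: "nat \<Rightarrow> ('v, 'k) mpoly" assume "x' \<in> carrier (free_module (mpoly_ring V) n)"
      then have x'p: "x' c \<in> polys V" for c by (simp add: free_module_carrier)
      have "k \<le> n \<Longrightarrow> lincomb N y (\<lambda>i. x i + x' i) k = lincomb N y x k \<oplus>\<^bsub>N\<^esub> lincomb N y x' k" for k
      proof (induction k)
        case (Suc k)
        have "(x k + x' k) \<odot>\<^bsub>N\<^esub> y k = x k \<odot>\<^bsub>N\<^esub> y k \<oplus>\<^bsub>N\<^esub> x' k \<odot>\<^bsub>N\<^esub> y k"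
          using N.smult_l_distr[of "x k" "x' k" "y k"] xp x'p y Suc.prems by simp
        moreover have "lincomb N y x k \<in> carrier N" "lincomb N y x' k \<in> carrier N" "y k \<in> carrier N"
          "x k \<odot>\<^bsub>N\<^esub> y k \<in> carrier N" "x' k \<odot>\<^bsub>N\<^esub> y k \<in> carrier N"
          using cl[of k] xp x'p y[of k] Suc.prems N.smult_closed[of _ "y k"] by simp_all
        ultimately show ?case using Suc by (simp add: N.M.a_ac)
      qed simp
      then show "lincomb N y (x \<oplus>\<^bsub>free_module (mpoly_ring V) n\<^esub> x') n = lincomb N y x n \<oplus>\<^bsub>N\<^esub> lincomb N y x' n"
        by simp
    }
    {
      fix a :: "('v, 'k) mpoly" assume "a \<in> carrier (mpoly_ring V)"
      then have a: "a \<in> polys V" by simp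
      have "k \<le> n \<Longrightarrow> lincomb N y (\<lambda>i. a * x i) k = a \<odot>\<^bsub>N\<^esub> lincomb N y x k" for k
      proof (induction k)
        case 0
        then show ?case using N.smult_r_null[of a] a by simp
      next
        case (Suc k)
        have "lincomb N y x k \<in> carrier N" "x k \<odot>\<^bsub>N\<^esub> y k \<in> carrier N"
          using cl[of k] xp y[of k] Suc.prems N.smult_closed[of _ "y k"] by simp_all
        moreover have "(a * x k) \<odot>\<^bsub>N\<^esub> y k = a \<odot>\<^bsub>N\<^esub> (x k \<odot>\<^bsub>N\<^esub> y k)"
          using N.smult_assoc1[of a "x k" "y k"] a xp y[of k] Suc.prems by simp
        ultimately show ?case using Suc N.smult_r_distr a by simp
      qed
      then show "lincomb N y (a \<odot>\<^bsub>free_module (mpoly_ring V) n\<^esub> x) n = a \<odot>\<^bsub>N\<^esub> lincomb N y x n"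
        by simp
    }
  qed
qed

lemma hom_lincomb:
  assumes M: "Module.module R M" and N: "Module.module R N" and h: "h \<in> module_hom R M N"
    and y: "\<And>c. c < n \<Longrightarrow> y c \<in> carrier M" and x: "\<And>c. x c \<in> carrier R"
  shows "h (lincomb M y x n) = lincomb N (\<lambda>c. h (y c)) x n"
  using y
proof (induction n)
  case 0
  then show ?case using hom_zero[OF h M N] by simp
next
  case (Suc n)
  interpret M: Module.module R M by fact
  have "lincomb M y x n \<in> carrier M" using Suc.prems x by (intro lincomb_closed[OF M]) simp_all
  then show ?case using Suc x by (simp add: hom_add[OF h] hom_smult[OF h])
qed

lemma lincomb_free: "lincomb (free_module (mpoly_ring V) n) y x k = (\<lambda>i. \<Sum>c<k. x c * y c i)"
  by (induction k) simp_all

lemma lincomb_unit: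
  assumes "x \<in> carrier (free_module (mpoly_ring V) n)"
  shows "lincomb (free_module (mpoly_ring V) n) (unit_vector (mpoly_ring V)) x n = x"
proof
  fix i
  have "(\<Sum>c<n. x c * unit_vector (mpoly_ring V) c i) = (\<Sum>c<n. if c = i then x c else 0)"
    by (rule sum.cong) (simp_all add: unit_vector_def)
  also have "\<dots> = x i" using assms by (simp add: free_module_carrier)
  finally show "lincomb (free_module (mpoly_ring V) n) (unit_vector (mpoly_ring V)) x n i = x i"
    unfolding lincomb_free .
qed

text \<open>The uniqueness half of the universal property: a homomorphism is determined on the
  basis.\<close>

lemma hom_free_eq:
  assumes N: "Module.module (mpoly_ring V) N"
    and h: "h \<in> module_hom (mpoly_ring V) (free_module (mpoly_ring V) n) N"
    and x: "x \<in> carrier (free_module (mpoly_ring V) n)"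
  shows "h x = lincomb N (\<lambda>c. h (unit_vector (mpoly_ring V) c)) x n"
proof -
  have "h (lincomb (free_module (mpoly_ring V) n) (unit_vector (mpoly_ring V)) x n) =
      lincomb N (\<lambda>c. h (unit_vector (mpoly_ring V) c)) x n"
    using x by (intro hom_lincomb[OF module_free_module N h] unit_vector_carrier)
      (simp_all add: free_module_carrier)
  then show ?thesis by (simp add: lincomb_unit[OF x])
qed

lemma hom_free_free:
  assumes "h \<in> module_hom (mpoly_ring V) (free_module (mpoly_ring V) a) (free_module (mpoly_ring V) b)"
    "x \<in> carrier (free_module (mpoly_ring V) a)"
  shows "h x l = (\<Sum>c<a. x c * h (unit_vector (mpoly_ring V) c) l)"
  by (simp add: hom_free_eq[OF module_free_module assms] lincomb_free)

text \<open>The values on the basis are kept in the conclusion, since graded lifting has to control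
  their degrees.\<close>

lemma free_lift_basis:
  fixes A :: "(('v, 'k::field) mpoly, 'c) module" and B :: "(('v, 'k) mpoly, 'd) module"
  assumes A: "Module.module (mpoly_ring V) A" and B: "Module.module (mpoly_ring V) B"
    and g: "g \<in> module_hom (mpoly_ring V) A B"
    and f: "f \<in> module_hom (mpoly_ring V) (free_module (mpoly_ring V) n) B"
    and y: "\<And>c. c < n \<Longrightarrow> y c \<in> carrier A \<and> g (y c) = f (unit_vector (mpoly_ring V) c)"
  shows "\<exists>h\<in>module_hom (mpoly_ring V) (free_module (mpoly_ring V) n) A.
    (\<forall>x\<in>carrier (free_module (mpoly_ring V) n). g (h x) = f x) \<and>
    (\<forall>c<n. h (unit_vector (mpoly_ring V) c) = y c)"
proof (intro bexI conjI ballI allI impI)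
  let ?h = "\<lambda>x. lincomb A y x n"
  show "?h \<in> module_hom (mpoly_ring V) (free_module (mpoly_ring V) n) A"
    using y by (intro lincomb_hom[OF A]) blast
  fix x :: "nat \<Rightarrow> ('v, 'k) mpoly" assume x: "x \<in> carrier (free_module (mpoly_ring V) n)"
  have "g (lincomb A y x n) = lincomb B (\<lambda>c. g (y c)) x n"
    using x y by (intro hom_lincomb[OF A B g]) (simp_all add: free_module_carrier)
  also have "\<dots> = lincomb B (\<lambda>c. f (unit_vector (mpoly_ring V) c)) x n"
    using y by (intro lincomb_cong) blast
  also have "\<dots> = f x" by (rule hom_free_eq[OF B f x, symmetric])
  finally show "g (?h x) = f x" .
next
  fix c assume c: "c < n"
  interpret A: Module.module "mpoly_ring V" A by fact
  have yA: "y k \<in> carrier A" if "k < n" for k using y that by blast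
  have "k \<le> n \<Longrightarrow> lincomb A y (unit_vector (mpoly_ring V) c) k = (if c < k then y c else \<zero>\<^bsub>A\<^esub>)" for k
  proof (induction k)
    case (Suc k)
    have "unit_vector (mpoly_ring V) c k \<odot>\<^bsub>A\<^esub> y k = (if k = c then y c else \<zero>\<^bsub>A\<^esub>)"
      using yA[of k] Suc.prems A.smult_one[of "y k"] A.smult_l_null[of "y k"]
      by (cases "k = c") (simp_all add: unit_vector_def)
    then show ?case using Suc yA[OF c] by (cases "c = k") (simp_all add: less_Suc_eq)
  qed simp
  then show "lincomb A y (unit_vector (mpoly_ring V) c) n = y c" using c by simp
qed

lemma free_lift:
  assumes A: "Module.module (mpoly_ring V) A" and B: "Module.module (mpoly_ring V) B"
    and g: "g \<in> module_hom (mpoly_ring V) A B"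
    and f: "f \<in> module_hom (mpoly_ring V) (free_module (mpoly_ring V) n) B"
    and im: "\<And>x. x \<in> carrier (free_module (mpoly_ring V) n) \<Longrightarrow> f x \<in> g ` carrier A"
  shows "\<exists>h\<in>module_hom (mpoly_ring V) (free_module (mpoly_ring V) n) A.
    \<forall>x\<in>carrier (free_module (mpoly_ring V) n). g (h x) = f x"
proof -
  have "\<exists>y. y \<in> carrier A \<and> g y = f (unit_vector (mpoly_ring V) c)" if "c < n" for c
    using im[OF unit_vector_carrier[OF that]] by (metis imageE)
  then obtain y where "\<And>c. c < n \<Longrightarrow> y c \<in> carrier A \<and> g (y c) = f (unit_vector (mpoly_ring V) c)"
    by metis
  from free_lift_basis[OF A B g f this] show ?thesis by blast
qed

lemma projective_free_module: "projective_module (mpoly_ring V) (free_module (mpoly_ring V) n)"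
  unfolding projective_module_def
proof (intro conjI allI ballI impI module_free_module)
  fix M N :: "(('a, 'b) mpoly, nat \<Rightarrow> ('a, 'b) mpoly) module" and g f
  assume g: "g \<in> module_hom (mpoly_ring V) M N"
    and f: "f \<in> module_hom (mpoly_ring V) (free_module (mpoly_ring V) n) N"
    and MN: "Module.module (mpoly_ring V) M \<and> Module.module (mpoly_ring V) N \<and> g ` carrier M = carrier N"
  show "\<exists>h\<in>module_hom (mpoly_ring V) (free_module (mpoly_ring V) n) M.
      \<forall>x\<in>carrier (free_module (mpoly_ring V) n). g (h x) = f x"
    using MN hom_closed[OF f] by (intro free_lift[OF _ _ g f]) simp_all
qed

lemma projective_lift:
  fixes A B P :: "('a, 'b) module"
  assumes P: "projective_module R P" and A: "Module.module R A" and B: "Module.module R B"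
    and g: "g \<in> module_hom R A B" and f: "f \<in> module_hom R P B"
    and im: "\<And>x. x \<in> carrier P \<Longrightarrow> f x \<in> g ` carrier A"
  shows "\<exists>h\<in>module_hom R P A. \<forall>x\<in>carrier P. g (h x) = f x"
proof -
  let ?N = "B\<lparr>carrier := g ` carrier A\<rparr>"
  have N: "Module.module R ?N" by (rule submodule_image[OF g A B])
  have g': "g \<in> module_hom R A ?N"
    using hom_add[OF g] hom_smult[OF g] by (intro module_homI) simp_all
  have f': "f \<in> module_hom R P ?N"
    using hom_add[OF f] hom_smult[OF f] im by (intro module_homI) simp_all
  have "\<forall>(M :: ('a, 'b) module) (N :: ('a, 'b) module). \<forall>g\<in>module_hom R M N. \<forall>f\<in>module_hom R P N.
        Module.module R M \<and> Module.module R N \<and> g ` carrier M = carrier N \<longrightarrow>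
        (\<exists>h\<in>module_hom R P M. \<forall>x\<in>carrier P. g (h x) = f x)"
    using P by (simp add: projective_module_def)
  from this[rule_format, OF g' f'] show ?thesis using A N by simp
qed

text \<open>Projectivity only speaks about modules whose elements are vectors, so the ideal is first
  copied into the vectors of length one.\<close>

lemma projective_lift_ideal:
  fixes I :: "('v, 'k::field) mpoly set" and A P :: "(('v, 'k) mpoly, nat \<Rightarrow> ('v, 'k) mpoly) module"
  assumes P: "projective_module (mpoly_ring V) P" and A: "Module.module (mpoly_ring V) A"
    and I: "ideal I (mpoly_ring V)"
    and g: "g \<in> module_hom (mpoly_ring V) A (ideal_module (mpoly_ring V) I)"
    and f: "f \<in> module_hom (mpoly_ring V) P (ideal_module (mpoly_ring V) I)"
    and im: "\<And>x. x \<in> carrier P \<Longrightarrow> f x \<in> g ` carrier A"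
  shows "\<exists>h\<in>module_hom (mpoly_ring V) P A. \<forall>x\<in>carrier P. g (h x) = f x"
proof -
  define \<iota> :: "('v, 'k) mpoly \<Rightarrow> nat \<Rightarrow> ('v, 'k) mpoly" where "\<iota> = (\<lambda>p i. if i = 0 then p else 0)"
  have "\<iota> p 0 = p" for p by (simp add: \<iota>_def)
  then have \<iota>_inj: "\<iota> p = \<iota> q \<Longrightarrow> p = q" for p q by metis
  have \<iota>: "\<iota> \<in> module_hom (mpoly_ring V) (ideal_module (mpoly_ring V) I) (free_module (mpoly_ring V) 1)"
    using ideal_subset[OF I] by (intro module_homI) (auto simp: \<iota>_def free_module_carrier fun_eq_iff)
  have "\<exists>h\<in>module_hom (mpoly_ring V) P A. \<forall>x\<in>carrier P. \<iota> (g (h x)) = \<iota> (f x)"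
  proof (rule projective_lift[OF P A module_free_module])
    show "(\<lambda>x. \<iota> (g x)) \<in> module_hom (mpoly_ring V) A (free_module (mpoly_ring V) 1)"
      by (rule hom_comp[OF g \<iota>])
    show "(\<lambda>x. \<iota> (f x)) \<in> module_hom (mpoly_ring V) P (free_module (mpoly_ring V) 1)"
      by (rule hom_comp[OF f \<iota>])
    fix x assume "x \<in> carrier P"
    from im[OF this] obtain a where "a \<in> carrier A" "f x = g a" by blast
    then show "\<iota> (f x) \<in> (\<lambda>x. \<iota> (g x)) ` carrier A" by simp
  qed
  then obtain h where h: "h \<in> module_hom (mpoly_ring V) P A" "\<forall>x\<in>carrier P. \<iota> (g (h x)) = \<iota> (f x)"
    by (rule bexE)
  have "\<forall>x\<in>carrier P. g (h x) = f x"
    by (intro ballI \<iota>_inj) (rule h(2)[rule_format])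
  then show ?thesis using h(1) by (rule bexI)
qed

section \<open>Comparison of resolutions\<close>

context
  fixes R :: "('a, 'm) ring_scheme" and M :: "('a, 'b) module" and F :: "nat \<Rightarrow> ('a, 'c) module" and d \<epsilon>
  assumes res: "resolution R M F d \<epsilon>"
begin

lemma resolution_modules: "Module.module R M" "Module.module R (F i)"
  using res by (simp_all add: resolution_def)

lemma resolution_homs: "\<epsilon> \<in> module_hom R (F 0) M" "d i \<in> module_hom R (F (Suc i)) (F i)"
  using res by (simp_all add: resolution_def)

lemma resolution_surj: "\<epsilon> ` carrier (F 0) = carrier M"
  using res by (simp add: resolution_def)

lemma resolution_exact:
  "d 0 ` carrier (F (Suc 0)) = {x \<in> carrier (F 0). \<epsilon> x = \<zero>\<^bsub>M\<^esub>}"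
  "d (Suc i) ` carrier (F (Suc (Suc i))) = {x \<in> carrier (F (Suc i)). d i x = \<zero>\<^bsub>F i\<^esub>}"
  using res by (simp_all add: resolution_def)

lemma resolution_complex:
  "x \<in> carrier (F (Suc 0)) \<Longrightarrow> \<epsilon> (d 0 x) = \<zero>\<^bsub>M\<^esub>"
  "x \<in> carrier (F (Suc (Suc i))) \<Longrightarrow> d i (d (Suc i) x) = \<zero>\<^bsub>F i\<^esub>"
  using resolution_exact by blast+

end

text \<open>The induction of the comparison theorem, separated from the way in which single maps are
  lifted. Free, projective and graded lifting all provide \<open>base\<close> and
  \<open>step\<close>; the predicate \<open>H\<close> carries homogeneity along and is trivial
  otherwise.\<close>

lemma chain_map_exists:
  assumes F: "resolution R M F d \<epsilon>" and G: "resolution R M G d' \<epsilon>'"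
    and base: "\<exists>h\<in>module_hom R (F 0) (G 0). H 0 h \<and> (\<forall>x\<in>carrier (F 0). \<epsilon>' (h x) = \<epsilon> x)"
    and step: "\<And>i \<phi>. \<phi> \<in> module_hom R (F i) (G i) \<Longrightarrow> H i \<phi> \<Longrightarrow>
        (\<And>x. x \<in> carrier (F (Suc i)) \<Longrightarrow> \<phi> (d i x) \<in> d' i ` carrier (G (Suc i))) \<Longrightarrow>
        \<exists>h\<in>module_hom R (F (Suc i)) (G (Suc i)). H (Suc i) h \<and>
          (\<forall>x\<in>carrier (F (Suc i)). d' i (h x) = \<phi> (d i x))"
  shows "\<exists>\<phi>. (\<forall>i. \<phi> i \<in> module_hom R (F i) (G i) \<and> H i (\<phi> i)) \<and>
    (\<forall>x\<in>carrier (F 0). \<epsilon>' (\<phi> 0 x) = \<epsilon> x) \<and>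
    (\<forall>i. \<forall>x\<in>carrier (F (Suc i)). d' i (\<phi> (Suc i) x) = \<phi> i (d i x))"
proof -
  \<comment> \<open>The invariant records that \<open>h\<close> after \<open>d i\<close> lands in
    the image of \<open>d' i\<close>, which is what the next lift requires.\<close>
  define P where "P = (\<lambda>i h. h \<in> module_hom R (F i) (G i) \<and> H i h \<and>
    (\<forall>x\<in>carrier (F (Suc i)). h (d i x) \<in> d' i ` carrier (G (Suc i))) \<and>
    (i = 0 \<longrightarrow> (\<forall>x\<in>carrier (F 0). \<epsilon>' (h x) = \<epsilon> x)))"
  have 1: "\<exists>h. P 0 h"
  proof -
    obtain h where h: "h \<in> module_hom R (F 0) (G 0)" "H 0 h" "\<forall>x\<in>carrier (F 0). \<epsilon>' (h x) = \<epsilon> x"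
      using base by blast
    have "h (d 0 x) \<in> d' 0 ` carrier (G (Suc 0))" if x: "x \<in> carrier (F (Suc 0))" for x
    proof -
      have dx: "d 0 x \<in> carrier (F 0)" by (rule hom_closed[OF resolution_homs(2)[OF F] x])
      then have "\<epsilon>' (h (d 0 x)) = \<zero>\<^bsub>M\<^esub>" using h(3) resolution_complex(1)[OF F x] by simp
      then show ?thesis using resolution_exact(1)[OF G] hom_closed[OF h(1) dx] by simp
    qed
    then show ?thesis using h unfolding P_def by blast
  qed
  have 2: "\<exists>h'. P (Suc i) h' \<and> (\<forall>x\<in>carrier (F (Suc i)). d' i (h' x) = h (d i x))" if h: "P i h" for h i
  proof -
    have h': "h \<in> module_hom R (F i) (G i)" "H i h"
      "\<And>x. x \<in> carrier (F (Suc i)) \<Longrightarrow> h (d i x) \<in> d' i ` carrier (G (Suc i))"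
      using h by (simp_all add: P_def)
    obtain k where k: "k \<in> module_hom R (F (Suc i)) (G (Suc i))" "H (Suc i) k"
      "\<forall>x\<in>carrier (F (Suc i)). d' i (k x) = h (d i x)"
      using step[OF h'] by blast
    have "k (d (Suc i) x) \<in> d' (Suc i) ` carrier (G (Suc (Suc i)))"
      if x: "x \<in> carrier (F (Suc (Suc i)))" for x
    proof -
      have dx: "d (Suc i) x \<in> carrier (F (Suc i))" by (rule hom_closed[OF resolution_homs(2)[OF F] x])
      then have "d' i (k (d (Suc i) x)) = h \<zero>\<^bsub>F i\<^esub>" using k(3) resolution_complex(2)[OF F x] by simp
      also have "\<dots> = \<zero>\<^bsub>G i\<^esub>" by (rule hom_zero[OF h'(1) resolution_modules(2)[OF F] resolution_modules(2)[OF G]])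
      finally show ?thesis using resolution_exact(2)[OF G] hom_closed[OF k(1) dx] by simp
    qed
    then have "P (Suc i) k" using k(1,2) by (simp add: P_def)
    then show ?thesis using k(3) by blast
  qed
  obtain \<phi> where \<phi>: "\<And>i. P i (\<phi> i)"
    "\<And>i. \<forall>x\<in>carrier (F (Suc i)). d' i (\<phi> (Suc i) x) = \<phi> i (d i x)"
    using dependent_nat_choice[of P "\<lambda>i h h'. \<forall>x\<in>carrier (F (Suc i)). d' i (h' x) = h (d i x)", OF 1 2] by blast
  have "\<phi> i \<in> module_hom R (F i) (G i) \<and> H i (\<phi> i)" for i using \<phi>(1)[of i] by (simp add: P_def)
  moreover have "\<forall>x\<in>carrier (F 0). \<epsilon>' (\<phi> 0 x) = \<epsilon> x" using \<phi>(1)[of 0] by (simp add: P_def)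
  ultimately show ?thesis using \<phi>(2) by blast
qed

lemma free_hom_diff:
  assumes f: "f \<in> module_hom (mpoly_ring V) M (free_module (mpoly_ring V) n)"
    and g: "g \<in> module_hom (mpoly_ring V) M (free_module (mpoly_ring V) n)"
  shows "(\<lambda>x i. f x i - g x i) \<in> module_hom (mpoly_ring V) M (free_module (mpoly_ring V) n)"
  using hom_closed[OF f] hom_closed[OF g] hom_add[OF f] hom_add[OF g] hom_smult[OF f] hom_smult[OF g]
  by (intro module_homI) (simp_all add: free_module_carrier algebra_simps)

lemma hom_id: "(\<lambda>x. x) \<in> module_hom R M M"
  by (rule module_homI) simp_all

lemma free_hom_diff_apply:
  assumes M: "Module.module (mpoly_ring V) M"
    and f: "f \<in> module_hom (mpoly_ring V) (free_module (mpoly_ring V) n) M"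
    and xy: "x \<in> carrier (free_module (mpoly_ring V) n)" "y \<in> carrier (free_module (mpoly_ring V) n)"
    and eq: "f x = f y"
  shows "f (\<lambda>i. x i - y i) = \<zero>\<^bsub>M\<^esub>"
proof -
  interpret M: Module.module "mpoly_ring V" M by fact
  have y': "(\<lambda>i. - y i) \<in> carrier (free_module (mpoly_ring V) n)" using xy(2) by (simp add: free_module_carrier)
  have "f (x \<oplus>\<^bsub>free_module (mpoly_ring V) n\<^esub> (\<lambda>i. - y i)) = f x \<oplus>\<^bsub>M\<^esub> f (\<lambda>i. - y i)"
    by (rule hom_add[OF f xy(1) y'])
  also have "\<dots> = f y \<oplus>\<^bsub>M\<^esub> f (\<lambda>i. - y i)" by (simp add: eq)
  also have "\<dots> = f (y \<oplus>\<^bsub>free_module (mpoly_ring V) n\<^esub> (\<lambda>i. - y i))"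
    by (rule hom_add[OF f xy(2) y', symmetric])
  also have "\<dots> = \<zero>\<^bsub>M\<^esub>" using hom_zero[OF f module_free_module M] by simp
  finally show ?thesis by simp
qed

text \<open>A chain endomorphism \<open>\<theta>\<close> over the identity is homotopic to the identity, so for a minimal
  resolution it is the identity modulo the irrelevant ideal.\<close>

lemma minimal_endomorphism:
  fixes r :: "nat \<Rightarrow> nat" and V :: "'v set" and M :: "(('v, 'k::field) mpoly, 'b) module"
  defines "F \<equiv> \<lambda>i. free_module (mpoly_ring V) (r i)"
  assumes F: "resolution (mpoly_ring V) M F d \<epsilon>"
    and min: "\<And>i x l. x \<in> carrier (F (Suc i)) \<Longrightarrow> coef (d i x l) 0 = 0"
    and \<theta>: "\<And>i. \<theta> i \<in> module_hom (mpoly_ring V) (F i) (F i)"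
    and \<theta>\<epsilon>: "\<And>x. x \<in> carrier (F 0) \<Longrightarrow> \<epsilon> (\<theta> 0 x) = \<epsilon> x"
    and \<theta>d: "\<And>i x. x \<in> carrier (F (Suc i)) \<Longrightarrow> d i (\<theta> (Suc i) x) = \<theta> i (d i x)"
    and x: "x \<in> carrier (F i)"
  shows "coef (\<theta> i x l) 0 = coef (x l) 0"
proof -
  let ?S = "mpoly_ring V"
  note mods = resolution_modules[OF F] and homs = resolution_homs[OF F]
  note exact = resolution_exact[OF F]
  have carr: "y \<in> carrier (F j) \<longleftrightarrow> (\<forall>i. y i \<in> polys V) \<and> (\<forall>i\<ge>r j. y i = 0)" for y j
    by (simp add: F_def free_module_carrier)
  have Fz: "\<zero>\<^bsub>F j\<^esub> = (\<lambda>i. 0)" for j by (simp add: F_def)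
  have diff_closed: "(\<lambda>i. x i - y i) \<in> carrier (F j)" if "x \<in> carrier (F j)" "y \<in> carrier (F j)" for x y j
    using that by (simp add: carr)
  have diff_hom: "(\<lambda>x i. f x i - g x i) \<in> module_hom ?S N (F j)"
    if "f \<in> module_hom ?S N (F j)" "g \<in> module_hom ?S N (F j)"
    for f g j and N :: "(('v, 'k) mpoly, nat \<Rightarrow> ('v, 'k) mpoly) module"
    using free_hom_diff that unfolding F_def by blast
  have lift: "\<exists>h\<in>module_hom ?S (F j) (F (Suc j)). \<forall>x\<in>carrier (F j). d j (h x) = f x"
    if f: "f \<in> module_hom ?S (F j) (F j)" and im: "\<And>x. x \<in> carrier (F j) \<Longrightarrow> f x \<in> d j ` carrier (F (Suc j))" for f j
    using free_lift[OF mods(2) mods(2) homs(2)[of j], of f "r j"] f im unfolding F_def by blast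
  \<comment> \<open>\<open>Q\<close> is the homotopy relation
    \<open>d h' + h d = 1 - \<theta>\<close>. On boundaries the summand \<open>h d\<close> vanishes,
    so there \<open>d h = 1 - \<theta>\<close>; \<open>P\<close> keeps just this part, as it
    suffices for the next lift. In degree 0 it holds everywhere.\<close>
  define P where "P = (\<lambda>j h. h \<in> module_hom ?S (F j) (F (Suc j)) \<and>
    (\<forall>x\<in>d j ` carrier (F (Suc j)). d j (h x) = (\<lambda>i. x i - \<theta> j x i)) \<and>
    (j = 0 \<longrightarrow> (\<forall>x\<in>carrier (F 0). d 0 (h x) = (\<lambda>i. x i - \<theta> 0 x i))))"
  define Q where "Q = (\<lambda>j h h'. \<forall>x\<in>carrier (F (Suc j)).
    d (Suc j) (h' x) = (\<lambda>i. (x i - \<theta> (Suc j) x i) - h (d j x) i))"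
  have id_\<theta>: "(\<lambda>x i. x i - \<theta> j x i) \<in> module_hom ?S (F j) (F j)" for j
    using diff_hom[OF hom_id \<theta>] .
  have 1: "\<exists>h. P 0 h"
  proof -
    have "(\<lambda>i. x i - \<theta> 0 x i) \<in> d 0 ` carrier (F (Suc 0))" if x: "x \<in> carrier (F 0)" for x
    proof -
      have \<theta>x: "\<theta> 0 x \<in> carrier (F 0)" by (rule hom_closed[OF \<theta> x])
      have "\<epsilon> (\<lambda>i. x i - \<theta> 0 x i) = \<zero>\<^bsub>M\<^esub>"
        using free_hom_diff_apply[OF mods(1), of \<epsilon> "r 0" x "\<theta> 0 x"] homs(1) x \<theta>x \<theta>\<epsilon>[OF x]
        unfolding F_def by simp
      then show ?thesis using diff_closed[OF x \<theta>x] exact(1) by simp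
    qed
    from lift[OF id_\<theta> this] obtain h where h: "h \<in> module_hom ?S (F 0) (F (Suc 0))"
      "\<forall>x\<in>carrier (F 0). d 0 (h x) = (\<lambda>i. x i - \<theta> 0 x i)" by blast
    moreover have "d 0 ` carrier (F (Suc 0)) \<subseteq> carrier (F 0)" using hom_closed[OF homs(2)] by blast
    ultimately show ?thesis unfolding P_def by blast
  qed
  have 2: "\<exists>h'. P (Suc j) h' \<and> Q j h h'" if Ph: "P j h" for h j
  proof -
    have h: "h \<in> module_hom ?S (F j) (F (Suc j))" using Ph unfolding P_def by (rule conjunct1)
    have hd: "d j (h x) = (\<lambda>i. x i - \<theta> j x i)" if "x \<in> d j ` carrier (F (Suc j))" for x
      using Ph that unfolding P_def by blast
    \<comment> \<open>This defect is a cycle by the invariant on boundaries, so exactness allows it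
      to be lifted through \<open>d (Suc j)\<close>.\<close>
    let ?f = "\<lambda>x i. (x i - \<theta> (Suc j) x i) - h (d j x) i"
    have f: "?f \<in> module_hom ?S (F (Suc j)) (F (Suc j))"
      by (rule diff_hom[OF id_\<theta> hom_comp[OF homs(2) h]])
    have "?f x \<in> d (Suc j) ` carrier (F (Suc (Suc j)))" if x: "x \<in> carrier (F (Suc j))" for x
    proof -
      have dx: "d j x \<in> carrier (F j)" by (rule hom_closed[OF homs(2) x])
      have c1: "(\<lambda>i. x i - \<theta> (Suc j) x i) \<in> carrier (F (Suc j))" by (rule hom_closed[OF id_\<theta> x])
      have c2: "h (d j x) \<in> carrier (F (Suc j))" by (rule hom_closed[OF h dx])
      have \<theta>x: "\<theta> (Suc j) x \<in> carrier (F (Suc j))" by (rule hom_closed[OF \<theta> x])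
      have dfree: "d j y l = (\<Sum>c<r (Suc j). y c * d j (unit_vector ?S c) l)" if "y \<in> carrier (F (Suc j))" for y l
        using hom_free_free[of "d j" V "r (Suc j)" "r j" y l] homs(2)[of j] that by (simp add: F_def)
      have "d j (\<lambda>i. x i - \<theta> (Suc j) x i) = (\<lambda>i. d j x i - d j (\<theta> (Suc j) x) i)"
        by (rule ext) (simp add: dfree[OF c1] dfree[OF x] dfree[OF \<theta>x] left_diff_distrib sum_subtractf)
      also have "\<dots> = (\<lambda>i. d j x i - \<theta> j (d j x) i)" by (simp add: \<theta>d[OF x])
      also have "\<dots> = d j (h (d j x))" using hd x by simp
      finally have "d j (?f x) = (\<lambda>i. 0)"
        using free_hom_diff_apply[OF mods(2)[of j], of "d j" "r (Suc j)"
            "\<lambda>i. x i - \<theta> (Suc j) x i" "h (d j x)"] homs(2)[of j] c1 c2 Fz[of j]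
        unfolding F_def by simp
      then show ?thesis using diff_closed[OF c1 c2] exact(2)[of j] Fz[of j] by simp
    qed
    from lift[OF f this] obtain h' where h': "h' \<in> module_hom ?S (F (Suc j)) (F (Suc (Suc j)))"
      "\<forall>x\<in>carrier (F (Suc j)). d (Suc j) (h' x) = ?f x" by blast
    have hd': "d (Suc j) (h' x) = (\<lambda>i. x i - \<theta> (Suc j) x i)" if x: "x \<in> d (Suc j) ` carrier (F (Suc (Suc j)))" for x
    proof -
      have xc: "x \<in> carrier (F (Suc j))" "d j x = \<zero>\<^bsub>F j\<^esub>" using x exact(2)[of j] by simp_all
      then have "h (d j x) = (\<lambda>i. 0)" using hom_zero[OF h mods(2) mods(2)] Fz by simp
      then show ?thesis using h'(2) xc(1) by simp
    qed
    have "P (Suc j) h'"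
      unfolding P_def by (intro conjI ballI impI; (fact h'(1) | erule hd' | simp))
    moreover have "Q j h h'" using h'(2) unfolding Q_def .
    ultimately show ?thesis by (intro exI conjI)
  qed
  obtain h where hP: "\<And>j. P j (h j)" and hQ: "\<And>j. Q j (h j) (h (Suc j))"
    using dependent_nat_choice[of P Q, OF 1 2] by blast
  have hh: "h j \<in> module_hom ?S (F j) (F (Suc j))" for j using hP[of j] by (simp add: P_def)
  \<comment> \<open>Both summands of the homotopy lack constant terms: in \<open>d h\<close> the
    differential comes last, and in \<open>h d\<close> the entries of \<open>d x\<close> occur as
    coefficients.\<close>
  have "coef (x l - \<theta> i x l) 0 = 0"
  proof (cases i)
    case 0
    have "d 0 (h 0 x) = (\<lambda>i. x i - \<theta> 0 x i)" using hP[of 0] x 0 by (simp add: P_def)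
    then have "x l - \<theta> i x l = d 0 (h 0 x) l" using 0 by simp
    moreover have "h 0 x \<in> carrier (F (Suc 0))" using hom_closed[OF hh] x 0 by blast
    ultimately show ?thesis using min by simp
  next
    case (Suc j)
    have dx: "d j x \<in> carrier (F j)" using hom_closed[OF homs(2)] x Suc by blast
    have "d (Suc j) (h (Suc j) x) = (\<lambda>i. (x i - \<theta> (Suc j) x i) - h j (d j x) i)"
      using hQ[of j] x Suc by (simp add: Q_def)
    then have "x l - \<theta> i x l = d (Suc j) (h (Suc j) x) l + h j (d j x) l" using Suc by simp
    moreover have "coef (d (Suc j) (h (Suc j) x) l) 0 = 0"
      using hom_closed[OF hh] x Suc by (intro min) blast
    moreover have "h j (d j x) l = (\<Sum>c<r j. d j x c * h j (unit_vector ?S c) l)"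
      using hom_free_free[of "h j" V "r j" "r (Suc j)" "d j x" l] hh[of j] dx by (simp add: F_def)
    then have "coef (h j (d j x) l) 0 = 0"
      using min[of x j] x Suc by (simp add: lookup_sum coef_mult_const)
    ultimately show ?thesis by (simp add: lookup_add)
  qed
  then show ?thesis by (simp add: lookup_minus)
qed

text \<open>Comparison maps in both directions compose to an endomorphism that preserves constant
  coefficients. In degree \<open>N\<close> it factors through the zero module \<open>P N\<close>, so
  \<open>F N\<close> has no basis vector.\<close>

lemma minimal_resolution_length:
  fixes r :: "nat \<Rightarrow> nat" and V :: "'v set" and I :: "('v, 'k::field) mpoly set"
    and P :: "nat \<Rightarrow> (('v, 'k) mpoly, nat \<Rightarrow> ('v, 'k) mpoly) module"
  defines "F \<equiv> \<lambda>i. free_module (mpoly_ring V) (r i)"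
  assumes I: "ideal I (mpoly_ring V)"
    and F: "resolution (mpoly_ring V) (ideal_module (mpoly_ring V) I) F d \<epsilon>"
    and min: "\<And>i x l. x \<in> carrier (F (Suc i)) \<Longrightarrow> coef (d i x l) 0 = 0"
    and P: "resolution (mpoly_ring V) (ideal_module (mpoly_ring V) I) P d' \<epsilon>'"
    and proj: "\<And>i. projective_module (mpoly_ring V) (P i)"
    and zero: "carrier (P N) = {\<zero>\<^bsub>P N\<^esub>}"
  shows "r N = 0"
proof -
  let ?S = "mpoly_ring V" let ?M = "ideal_module (mpoly_ring V) I"
  note F_mods = resolution_modules[OF F] and F_homs = resolution_homs[OF F]
  note P_mods = resolution_modules[OF P] and P_homs = resolution_homs[OF P]
  have "\<exists>\<psi>. (\<forall>i. \<psi> i \<in> module_hom ?S (F i) (P i) \<and> True) \<and>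
      (\<forall>x\<in>carrier (F 0). \<epsilon>' (\<psi> 0 x) = \<epsilon> x) \<and>
      (\<forall>i. \<forall>x\<in>carrier (F (Suc i)). d' i (\<psi> (Suc i) x) = \<psi> i (d i x))"
  proof (rule chain_map_exists[OF F P, where H = "\<lambda>_ _. True"])
    have "\<epsilon> x \<in> \<epsilon>' ` carrier (P 0)" if "x \<in> carrier (F 0)" for x
      using hom_closed[OF F_homs(1) that] resolution_surj[OF P] by simp
    then show "\<exists>h\<in>module_hom ?S (F 0) (P 0). True \<and> (\<forall>x\<in>carrier (F 0). \<epsilon>' (h x) = \<epsilon> x)"
      using free_lift[OF P_mods(2) P_mods(1) P_homs(1), of \<epsilon> "r 0"] F_homs(1) unfolding F_def by simp
    fix i \<phi> assume \<phi>: "\<phi> \<in> module_hom ?S (F i) (P i)"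
      and im: "\<And>x. x \<in> carrier (F (Suc i)) \<Longrightarrow> \<phi> (d i x) \<in> d' i ` carrier (P (Suc i))"
    have "(\<lambda>x. \<phi> (d i x)) \<in> module_hom ?S (F (Suc i)) (P i)" by (rule hom_comp[OF F_homs(2) \<phi>])
    then show "\<exists>h\<in>module_hom ?S (F (Suc i)) (P (Suc i)). True \<and>
        (\<forall>x\<in>carrier (F (Suc i)). d' i (h x) = \<phi> (d i x))"
      using free_lift[OF P_mods(2) P_mods(2) P_homs(2)[of i], of "\<lambda>x. \<phi> (d i x)" "r (Suc i)"] im
      unfolding F_def by simp
  qed
  then obtain \<psi> where \<psi>: "\<And>i. \<psi> i \<in> module_hom ?S (F i) (P i)"
    "\<And>x. x \<in> carrier (F 0) \<Longrightarrow> \<epsilon>' (\<psi> 0 x) = \<epsilon> x"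
    "\<And>i x. x \<in> carrier (F (Suc i)) \<Longrightarrow> d' i (\<psi> (Suc i) x) = \<psi> i (d i x)" by blast
  have "\<exists>\<phi>. (\<forall>i. \<phi> i \<in> module_hom ?S (P i) (F i) \<and> True) \<and>
      (\<forall>x\<in>carrier (P 0). \<epsilon> (\<phi> 0 x) = \<epsilon>' x) \<and>
      (\<forall>i. \<forall>x\<in>carrier (P (Suc i)). d i (\<phi> (Suc i) x) = \<phi> i (d' i x))"
  proof (rule chain_map_exists[OF P F, where H = "\<lambda>_ _. True"])
    have "\<epsilon>' x \<in> \<epsilon> ` carrier (F 0)" if "x \<in> carrier (P 0)" for x
      using hom_closed[OF P_homs(1) that] resolution_surj[OF F] by simp
    from projective_lift_ideal[OF proj F_mods(2) I F_homs(1) P_homs(1) this]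
    show "\<exists>h\<in>module_hom ?S (P 0) (F 0). True \<and> (\<forall>x\<in>carrier (P 0). \<epsilon> (h x) = \<epsilon>' x)" by simp
    fix i \<phi> assume \<phi>: "\<phi> \<in> module_hom ?S (P i) (F i)"
      and im: "\<And>x. x \<in> carrier (P (Suc i)) \<Longrightarrow> \<phi> (d' i x) \<in> d i ` carrier (F (Suc i))"
    from projective_lift[OF proj F_mods(2) F_mods(2) F_homs(2) hom_comp[OF P_homs(2) \<phi>] im]
    show "\<exists>h\<in>module_hom ?S (P (Suc i)) (F (Suc i)). True \<and>
        (\<forall>x\<in>carrier (P (Suc i)). d i (h x) = \<phi> (d' i x))" by simp
  qed
  then obtain \<phi> where \<phi>: "\<And>i. \<phi> i \<in> module_hom ?S (P i) (F i)"
    "\<And>x. x \<in> carrier (P 0) \<Longrightarrow> \<epsilon> (\<phi> 0 x) = \<epsilon>' x"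
    "\<And>i x. x \<in> carrier (P (Suc i)) \<Longrightarrow> d i (\<phi> (Suc i) x) = \<phi> i (d' i x)" by blast
  have Fj: "free_module ?S (r j) = F j" for j by (simp add: F_def)
  show ?thesis
  proof (rule ccontr)
    assume "r N \<noteq> 0"
    then have e: "unit_vector ?S 0 \<in> carrier (F N)" by (simp add: F_def unit_vector_carrier)
    have "\<phi> i (\<psi> i x) \<in> carrier (F i)" if "x \<in> carrier (F i)" for i x
      using hom_closed[OF \<phi>(1) hom_closed[OF \<psi>(1) that]] .
    have "coef (\<phi> N (\<psi> N (unit_vector ?S 0)) 0) 0 = coef (unit_vector ?S 0 0) 0"
    proof (rule minimal_endomorphism[where \<theta> = "\<lambda>i x. \<phi> i (\<psi> i x)" and r = r and \<epsilon> = \<epsilon> and d = d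
          and M = ?M and V = V, folded F_def, unfolded Fj])
      show "(\<lambda>x. \<phi> i (\<psi> i x)) \<in> module_hom ?S (F i) (F i)" for i by (rule hom_comp[OF \<psi>(1) \<phi>(1)])
      show "\<epsilon> (\<phi> 0 (\<psi> 0 x)) = \<epsilon> x" if "x \<in> carrier (F 0)" for x
        using \<phi>(2)[OF hom_closed[OF \<psi>(1) that]] \<psi>(2)[OF that] by simp
      show "d i (\<phi> (Suc i) (\<psi> (Suc i) x)) = \<phi> i (\<psi> i (d i x))" if "x \<in> carrier (F (Suc i))" for i x
        using \<phi>(3)[OF hom_closed[OF \<psi>(1) that]] \<psi>(3)[OF that] by simp
    qed (use F min e in auto)
    moreover have "\<psi> N (unit_vector ?S 0) = \<zero>\<^bsub>P N\<^esub>" using hom_closed[OF \<psi>(1) e] zero by blast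
    then have "\<phi> N (\<psi> N (unit_vector ?S 0)) = (\<lambda>i. 0)"
      using hom_zero[OF \<phi>(1) P_mods(2) F_mods(2), of N] by (simp add: F_def)
    ultimately show False by (simp add: unit_vector_def)
  qed
qed


section \<open>Uniqueness of the graded Betti numbers\<close>

text \<open>Gaussian elimination, one column \<open>t\<close> at a time: with a pivot row
  \<open>b\<close> for \<open>t\<close>, all other rows are cleared in that column.\<close>

lemma linear_dependence:
  fixes M :: "'a \<Rightarrow> 't \<Rightarrow> 'k::field"
  assumes "finite T" "finite A" "card T < card A"
  shows "\<exists>c. (\<exists>a\<in>A. c a \<noteq> 0) \<and> (\<forall>t\<in>T. (\<Sum>a\<in>A. c a * M a t) = 0)"
  using assms
proof (induction T arbitrary: A M rule: finite_induct)
  case empty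
  then obtain a where "a \<in> A" by fastforce
  then show ?case by (intro exI[of _ "\<lambda>_. 1"]) auto
next
  case (insert t T)
  show ?case
  proof (cases "\<forall>a\<in>A. M a t = 0")
    case True
    have "card T < card A" using insert.prems(2) insert.hyps by simp
    from insert.IH[OF insert.prems(1) this, of M]
    obtain c where "\<exists>a\<in>A. c a \<noteq> 0" "\<forall>s\<in>T. (\<Sum>a\<in>A. c a * M a s) = 0" by blast
    then show ?thesis using True by (intro exI[of _ c]) simp
  next
    case False
    then obtain b where b: "b \<in> A" "M b t \<noteq> 0" by blast
    have "card T < card (A - {b})" using insert.prems insert.hyps b(1) by simp
    then obtain c where c: "\<exists>a\<in>A - {b}. c a \<noteq> 0"
      "\<forall>s\<in>T. (\<Sum>a\<in>A - {b}. c a * (M a s - M a t / M b t * M b s)) = 0"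
      using insert.IH[of "A - {b}" "\<lambda>a s. M a s - M a t / M b t * M b s"] insert.prems(1) by blast
    \<comment> \<open>The multiple of row \<open>b\<close> that the elimination subtracted in total;
      giving \<open>b\<close> the coefficient \<open>- k\<close> expresses the same dependency in
      the original rows.\<close>
    define k where "k = (\<Sum>a\<in>A - {b}. c a * (M a t / M b t))"
    define c' where "c' = c(b := - k)"
    have eq: "(\<Sum>a\<in>A. c' a * M a s) = (\<Sum>a\<in>A - {b}. c a * (M a s - M a t / M b t * M b s))" for s
    proof -
      have "(\<Sum>a\<in>A. c' a * M a s) = - k * M b s + (\<Sum>a\<in>A - {b}. c' a * M a s)"
        using insert.prems(1) b(1) by (simp add: sum.remove c'_def)
      also have "(\<Sum>a\<in>A - {b}. c' a * M a s) = (\<Sum>a\<in>A - {b}. c a * M a s)"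
        by (rule sum.cong) (simp_all add: c'_def)
      also have "- k * M b s + \<dots> = (\<Sum>a\<in>A - {b}. c a * M a s - c a * (M a t / M b t) * M b s)"
        by (simp add: k_def sum_subtractf sum_distrib_right)
      also have "\<dots> = (\<Sum>a\<in>A - {b}. c a * (M a s - M a t / M b t * M b s))"
        by (rule sum.cong) (simp_all add: right_diff_distrib mult.assoc)
      finally show ?thesis .
    qed
    have "\<forall>s\<in>insert t T. (\<Sum>a\<in>A. c' a * M a s) = 0"
      using c(2) b(2) unfolding eq by simp
    moreover have "\<exists>a\<in>A. c' a \<noteq> 0" using c(1) by (auto simp: c'_def)
    ultimately show ?thesis by blast
  qed
qed

text \<open>A dependency among the rows of \<open>M\<close> would survive multiplication by
  \<open>N\<close>, that is, in the identity matrix.\<close>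

lemma card_le_of_left_inverse:
  fixes M :: "'a \<Rightarrow> 'b \<Rightarrow> 'k::field" and N :: "'b \<Rightarrow> 'a \<Rightarrow> 'k"
  assumes "finite A" "finite B"
    and inv: "\<And>a a'. a \<in> A \<Longrightarrow> a' \<in> A \<Longrightarrow> (\<Sum>b\<in>B. M a b * N b a') = (if a = a' then 1 else 0)"
  shows "card A \<le> card B"
proof (rule ccontr)
  assume "\<not> card A \<le> card B"
  then obtain c where c: "\<exists>a\<in>A. c a \<noteq> 0" "\<forall>b\<in>B. (\<Sum>a\<in>A. c a * M a b) = 0"
    using linear_dependence[OF assms(2,1), of M] by auto
  have "c a' = 0" if a': "a' \<in> A" for a'
  proof -
    have "c a' = (\<Sum>a\<in>A. if a = a' then c a else 0)" using a' assms(1) by simp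
    also have "\<dots> = (\<Sum>a\<in>A. c a * (\<Sum>b\<in>B. M a b * N b a'))"
      using a' by (intro sum.cong) (simp_all add: inv)
    also have "\<dots> = (\<Sum>b\<in>B. (\<Sum>a\<in>A. c a * M a b) * N b a')"
      unfolding sum_distrib_left sum_distrib_right by (subst sum.swap) (simp add: mult.assoc)
    also have "\<dots> = 0" using c(2) by simp
    finally show ?thesis .
  qed
  then show False using c(1) by blast
qed

section \<open>Degrees, homogeneous polynomials and homogeneous parts\<close>

lemma monom_deg_superset: "finite A \<Longrightarrow> supp t \<subseteq> A \<Longrightarrow> monom_deg t = (\<Sum>v\<in>A. coef t v)"
  unfolding monom_deg_def by (intro sum.mono_neutral_left) (simp_all add: in_keys_iff)

lemma monom_deg_add: "monom_deg (s + t) = monom_deg s + monom_deg t"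
proof -
  let ?A = "supp s \<union> supp t"
  have "monom_deg (s + t) = (\<Sum>v\<in>?A. coef (s + t) v)"
    by (rule monom_deg_superset) (simp_all add: supp_exponent_add)
  also have "\<dots> = (\<Sum>v\<in>?A. coef s v) + (\<Sum>v\<in>?A. coef t v)"
    by (simp add: lookup_add sum.distrib)
  also have "\<dots> = monom_deg s + monom_deg t"
    by (simp add: monom_deg_superset[of ?A])
  finally show ?thesis .
qed

text \<open>Degrees are integers because they arise as differences of shifts; in a negative degree
  only 0 is homogeneous.\<close>

definition homogeneous :: "int \<Rightarrow> ('v, 'k::field) mpoly \<Rightarrow> bool" where
  "homogeneous j p \<longleftrightarrow> (\<forall>t\<in>supp p. int (monom_deg t) = j)"

definition hom_part :: "int \<Rightarrow> ('v, 'k::field) mpoly \<Rightarrow> ('v, 'k) mpoly" where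
  "hom_part j p = Poly_Mapping.mapp (\<lambda>t c. if int (monom_deg t) = j then c else 0) p"

lemma coef_hom_part: "coef (hom_part j p) t = (if int (monom_deg t) = j then coef p t else 0)"
  by (simp add: hom_part_def lookup_mapp when_def in_keys_iff)

lemma supp_hom_part: "supp (hom_part j p) = {t \<in> supp p. int (monom_deg t) = j}"
  by (auto simp: in_keys_iff coef_hom_part split: if_splits)

lemma homogeneous_hom_part: "homogeneous j (hom_part j p)"
  by (simp add: homogeneous_def supp_hom_part)

lemma polys_hom_part: "p \<in> polys V \<Longrightarrow> hom_part j p \<in> polys V"
  by (auto simp: polys_def supp_hom_part)

lemma hom_part_homogeneous: "homogeneous j p \<Longrightarrow> hom_part j p = p"
  by (intro poly_mapping_eqI) (auto simp: coef_hom_part homogeneous_def in_keys_iff)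

lemma hom_part_0 [simp]: "hom_part j 0 = 0"
  by (intro poly_mapping_eqI) (simp add: coef_hom_part)

lemma hom_part_add: "hom_part j (p + q) = hom_part j p + hom_part j q"
  by (intro poly_mapping_eqI) (simp add: coef_hom_part lookup_add)

lemma hom_part_sum: "hom_part j (sum f A) = (\<Sum>i\<in>A. hom_part j (f i))"
  by (induction A rule: infinite_finite_induct) (simp_all add: hom_part_add)

lemma homogeneous_0 [simp]: "homogeneous j 0"
  by (simp add: homogeneous_def)

lemma homogeneous_add: "homogeneous j p \<Longrightarrow> homogeneous j q \<Longrightarrow> homogeneous j (p + q)"
  using keys_add[of p q] unfolding homogeneous_def by blast

lemma homogeneous_uminus: "homogeneous j p \<Longrightarrow> homogeneous j (- p)"
  by (simp add: homogeneous_def)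

lemma homogeneous_sum: "(\<And>i. i \<in> A \<Longrightarrow> homogeneous j (f i)) \<Longrightarrow> homogeneous j (sum f A)"
  by (induction A rule: infinite_finite_induct) (simp_all add: homogeneous_add)

lemma homogeneous_coef_0:
  assumes "homogeneous j p" "j \<noteq> 0"
  shows "coef p 0 = 0"
proof (rule ccontr)
  assume "coef p 0 \<noteq> 0"
  then have "0 \<in> supp p" by (simp add: in_keys_iff)
  then have "int (monom_deg (0 :: 'a \<Rightarrow>\<^sub>0 nat)) = j" using assms(1) unfolding homogeneous_def by blast
  then show False using assms(2) by (simp add: monom_deg_def)
qed

lemma homogeneous_mult:
  assumes "homogeneous i p" "homogeneous j q"
  shows "homogeneous (i + j) (p * q)"
  unfolding homogeneous_def
proof
  fix u assume "u \<in> supp (p * q)"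
  then obtain s t where "s \<in> supp p" "t \<in> supp q" "u = s + t" by (rule supp_mult)
  then show "int (monom_deg u) = i + j" using assms by (simp add: homogeneous_def monom_deg_add)
qed

text \<open>Degrees add, so only the part of \<open>p\<close> in degree \<open>j - e\<close> reaches
  degree \<open>j\<close>.\<close>

lemma hom_part_mult:
  assumes q: "homogeneous e q"
  shows "hom_part j (p * q) = hom_part (j - e) p * q"
proof (rule poly_mapping_eqI)
  fix u
  have vanish: "coef (mono t c * q) u = 0" if "int (monom_deg u) \<noteq> int (monom_deg t) + e" for t c
  proof (rule ccontr)
    assume "coef (mono t c * q) u \<noteq> 0"
    then have "u \<in> supp (mono t c * q)" by (simp add: in_keys_iff)
    then obtain a b where ab: "a \<in> supp (mono t c)" "b \<in> supp q" "u = a + b" by (rule supp_mult)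
    then have "a = t" by (simp split: if_splits)
    then show False using ab that q by (simp add: homogeneous_def monom_deg_add)
  qed
  have "coef (hom_part (j - e) p * q) u =
      (\<Sum>t\<in>{t \<in> supp p. int (monom_deg t) = j - e}. coef (mono t (coef p t) * q) u)"
    unfolding coef_mult[of "hom_part (j - e) p"] supp_hom_part by (rule sum.cong) (simp_all add: coef_hom_part)
  also have "\<dots> = (\<Sum>t\<in>supp p. if int (monom_deg u) = j then coef (mono t (coef p t) * q) u else 0)"
  proof (cases "int (monom_deg u) = j")
    case True
    then show ?thesis by (intro sum.mono_neutral_cong_left) (auto intro!: vanish)
  next
    case False
    then show ?thesis by (intro sum.neutral[THEN trans]) (auto intro!: vanish)
  qed
  also have "\<dots> = coef (hom_part j (p * q)) u"
    by (simp add: coef_hom_part coef_mult[of p])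
  finally show "coef (hom_part j (p * q)) u = coef (hom_part (j - e) p * q) u" by simp
qed

text \<open>Taking parts relative to the shifts commutes with a homogeneous matrix. The part of a
  preimage is hence a preimage of the part.\<close>

lemma hom_part_sum_mult:
  assumes "\<And>c. c < a \<Longrightarrow> homogeneous (s c - k) (q c)"
  shows "hom_part (j - k) (\<Sum>c<a. x c * q c) = (\<Sum>c<a. hom_part (j - s c) (x c) * q c)"
  unfolding hom_part_sum
proof (rule sum.cong)
  fix c assume "c \<in> {..<a}"
  then have "hom_part (j - k) (x c * q c) = hom_part (j - k - (s c - k)) (x c) * q c"
    using assms by (intro hom_part_mult) simp
  then show "hom_part (j - k) (x c * q c) = hom_part (j - s c) (x c) * q c" by simp
qed simp

text \<open>Replacing arbitrary preimages of the basis vectors by their homogeneous parts makes the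
  lift homogeneous.\<close>

lemma graded_lift:
  fixes V :: "'v set" and f :: "(nat \<Rightarrow> ('v, 'k::field) mpoly) \<Rightarrow> nat \<Rightarrow> ('v, 'k) mpoly"
  defines "Fr \<equiv> free_module (mpoly_ring V)" and "e \<equiv> unit_vector (mpoly_ring V)"
  assumes g: "g \<in> module_hom (mpoly_ring V) (Fr a) (Fr b)"
    and gh: "\<And>c l. c < a \<Longrightarrow> homogeneous (sA c - sB l) (g (e c) l)"
    and f: "f \<in> module_hom (mpoly_ring V) (Fr n) (Fr b)"
    and fh: "\<And>c l. c < n \<Longrightarrow> homogeneous (sF c - sB l) (f (e c) l)"
    and im: "\<And>x. x \<in> carrier (Fr n) \<Longrightarrow> f x \<in> g ` carrier (Fr a)"
  shows "\<exists>h\<in>module_hom (mpoly_ring V) (Fr n) (Fr a).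
    (\<forall>c<n. \<forall>l. homogeneous (sF c - sA l) (h (e c) l)) \<and> (\<forall>x\<in>carrier (Fr n). g (h x) = f x)"
proof -
  have "\<exists>y. y \<in> carrier (Fr a) \<and> f (e c) = g y" if "c < n" for c
    using im[of "e c"] unit_vector_carrier[OF that] unfolding Fr_def e_def by blast
  then obtain y where y: "\<And>c. c < n \<Longrightarrow> y c \<in> carrier (Fr a) \<and> f (e c) = g (y c)" by metis
  define z where "z = (\<lambda>c l. hom_part (sF c - sA l) (y c l))"
  have z: "z c \<in> carrier (Fr a) \<and> g (z c) = f (e c)" if c: "c < n" for c
  proof
    have yc: "y c \<in> carrier (Fr a)" using y[OF c] by simp
    then show zc: "z c \<in> carrier (Fr a)"
      by (simp add: Fr_def free_module_carrier z_def polys_hom_part)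
    show "g (z c) = f (e c)"
    proof
      fix l
      have "g (z c) l = (\<Sum>k<a. z c k * g (e k) l)"
        using hom_free_free[of g V a b "z c" l] g zc by (simp add: Fr_def e_def)
      also have "\<dots> = hom_part (sF c - sB l) (\<Sum>k<a. y c k * g (e k) l)"
        unfolding z_def by (rule hom_part_sum_mult[symmetric]) (rule gh)
      also have "(\<Sum>k<a. y c k * g (e k) l) = g (y c) l"
        using hom_free_free[of g V a b "y c" l] g yc by (simp add: Fr_def e_def)
      also have "hom_part (sF c - sB l) (g (y c) l) = f (e c) l"
        using y[OF c] fh[OF c] by (simp add: hom_part_homogeneous)
      finally show "g (z c) l = f (e c) l" .
    qed
  qed
  have "\<exists>h\<in>module_hom (mpoly_ring V) (Fr n) (Fr a). (\<forall>x\<in>carrier (Fr n). g (h x) = f x) \<and> (\<forall>c<n. h (e c) = z c)"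
    using free_lift_basis[OF module_free_module module_free_module, of g V a b f n z] g f z
    unfolding Fr_def e_def by blast
  then obtain h where h: "h \<in> module_hom (mpoly_ring V) (Fr n) (Fr a)"
    "\<forall>x\<in>carrier (Fr n). g (h x) = f x" "\<forall>c<n. h (e c) = z c" by blast
  have "\<forall>c<n. \<forall>l. homogeneous (sF c - sA l) (h (e c) l)"
    using h(3) by (simp add: z_def homogeneous_hom_part)
  then show ?thesis using h(1,2) by blast
qed

text \<open>The ideal sits in the vectors of length one with shift 0, which reduces the augmentation
  to \<open>graded_lift\<close>.\<close>

lemma graded_lift_ideal:
  fixes V :: "'v set" and I :: "('v, 'k::field) mpoly set"
  defines "Fr \<equiv> free_module (mpoly_ring V)" and "e \<equiv> unit_vector (mpoly_ring V)"
  assumes I: "ideal I (mpoly_ring V)"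
    and g: "g \<in> module_hom (mpoly_ring V) (Fr a) (ideal_module (mpoly_ring V) I)"
    and gh: "\<And>c. c < a \<Longrightarrow> homogeneous (sA c) (g (e c))"
    and f: "f \<in> module_hom (mpoly_ring V) (Fr n) (ideal_module (mpoly_ring V) I)"
    and fh: "\<And>c. c < n \<Longrightarrow> homogeneous (sF c) (f (e c))"
    and im: "\<And>x. x \<in> carrier (Fr n) \<Longrightarrow> f x \<in> g ` carrier (Fr a)"
  shows "\<exists>h\<in>module_hom (mpoly_ring V) (Fr n) (Fr a).
    (\<forall>c<n. \<forall>l. homogeneous (sF c - sA l) (h (e c) l)) \<and> (\<forall>x\<in>carrier (Fr n). g (h x) = f x)"
proof -
  define \<iota> :: "('v, 'k) mpoly \<Rightarrow> nat \<Rightarrow> ('v, 'k) mpoly" where "\<iota> = (\<lambda>p i. if i = 0 then p else 0)"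
  have "\<iota> p 0 = p" for p by (simp add: \<iota>_def)
  then have \<iota>_inj: "\<iota> p = \<iota> q \<Longrightarrow> p = q" for p q by metis
  have \<iota>: "\<iota> \<in> module_hom (mpoly_ring V) (ideal_module (mpoly_ring V) I) (Fr 1)"
    using ideal_subset[OF I] unfolding Fr_def
    by (intro module_homI) (auto simp: \<iota>_def free_module_carrier fun_eq_iff)
  have "\<exists>h\<in>module_hom (mpoly_ring V) (Fr n) (Fr a).
    (\<forall>c<n. \<forall>l. homogeneous (sF c - sA l) (h (e c) l)) \<and> (\<forall>x\<in>carrier (Fr n). \<iota> (g (h x)) = \<iota> (f x))"
    unfolding Fr_def e_def
  proof (rule graded_lift[where sB = "\<lambda>_. 0"])
    show "(\<lambda>x. \<iota> (g x)) \<in> module_hom (mpoly_ring V) (free_module (mpoly_ring V) a) (free_module (mpoly_ring V) 1)"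
      using hom_comp[OF g \<iota>] by (simp add: Fr_def)
    show "(\<lambda>x. \<iota> (f x)) \<in> module_hom (mpoly_ring V) (free_module (mpoly_ring V) n) (free_module (mpoly_ring V) 1)"
      using hom_comp[OF f \<iota>] by (simp add: Fr_def)
    show "homogeneous (sA c - 0) (\<iota> (g (unit_vector (mpoly_ring V) c)) l)" if "c < a" for c l
      using gh[OF that] by (simp add: \<iota>_def e_def)
    show "homogeneous (sF c - 0) (\<iota> (f (unit_vector (mpoly_ring V) c)) l)" if "c < n" for c l
      using fh[OF that] by (simp add: \<iota>_def e_def)
    show "\<iota> (f x) \<in> (\<lambda>x. \<iota> (g x)) ` carrier (free_module (mpoly_ring V) a)"
      if "x \<in> carrier (free_module (mpoly_ring V) n)" for x
    proof -
      from im[of x] that obtain u where "u \<in> carrier (Fr a)" "f x = g u" unfolding Fr_def by blast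
      then show ?thesis by (simp add: Fr_def)
    qed
  qed
  then obtain h where h: "h \<in> module_hom (mpoly_ring V) (Fr n) (Fr a)"
    "\<forall>c<n. \<forall>l. homogeneous (sF c - sA l) (h (e c) l)" "\<forall>x\<in>carrier (Fr n). \<iota> (g (h x)) = \<iota> (f x)" by blast
  have "\<forall>x\<in>carrier (Fr n). g (h x) = f x"
    by (intro ballI \<iota>_inj) (rule h(3)[rule_format])
  then show ?thesis using h(1,2) by blast
qed

section \<open>Properties of a minimal graded free resolution\<close>

context
  fixes V :: "'v set" and I :: "('v, 'k::field) mpoly set" and r s d \<epsilon>
  assumes mgfr: "min_graded_free_resolution V I r s d \<epsilon>"
begin

lemma mgfr_resolution:
  "resolution (mpoly_ring V) (ideal_module (mpoly_ring V) I) (\<lambda>i. free_module (mpoly_ring V) (r i)) d \<epsilon>"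
  using mgfr by (simp add: min_graded_free_resolution_def Let_def)

lemma mgfr_homogeneous_aug: "c < r 0 \<Longrightarrow> homogeneous (s 0 c) (\<epsilon> (unit_vector (mpoly_ring V) c))"
  using mgfr by (simp add: min_graded_free_resolution_def Let_def homogeneous_def)

lemma mgfr_zero:
  "x \<in> carrier (free_module (mpoly_ring V) (r (Suc i))) \<Longrightarrow> r i \<le> l \<Longrightarrow> d i x l = 0"
  using hom_closed[OF resolution_homs(2)[OF mgfr_resolution], of x i] by (simp add: free_module_carrier)

lemma mgfr_homogeneous:
  assumes "c < r (Suc i)"
  shows "homogeneous (s (Suc i) c - s i l) (d i (unit_vector (mpoly_ring V) c) l)"
proof (cases "l < r i")
  case True
  have "\<forall>i. \<forall>c<r (Suc i). \<forall>l<r i. \<forall>t\<in>supp (d i (unit_vector (mpoly_ring V) c) l).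
      int (monom_deg t) + s i l = s (Suc i) c"
    using mgfr by (simp add: min_graded_free_resolution_def Let_def)
  then have "int (monom_deg t) + s i l = s (Suc i) c"
    if "t \<in> supp (d i (unit_vector (mpoly_ring V) c) l)" for t
    using that assms True by blast
  then show ?thesis unfolding homogeneous_def by (metis add_diff_cancel_right')
next
  case False
  then show ?thesis using mgfr_zero[OF unit_vector_carrier[OF assms]] by simp
qed

lemma mgfr_minimal:
  assumes "x \<in> carrier (free_module (mpoly_ring V) (r (Suc i)))"
  shows "coef (d i x l) 0 = 0"
proof (cases "l < r i")
  case True
  have "\<forall>i. \<forall>x\<in>carrier (free_module (mpoly_ring V) (r (Suc i))). \<forall>l<r i. d i x l \<in> irrelevant_ideal V"
    using mgfr by (simp add: min_graded_free_resolution_def Let_def)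
  then show ?thesis using assms True irrelevant_coef_0 by blast
next
  case False
  then show ?thesis using mgfr_zero[OF assms] by simp
qed

end

text \<open>The predicate \<open>H\<close> of \<open>chain_map_exists\<close> is homogeneity of
  degree 0 with respect to the two families of shifts. It passes to the composite with
  \<open>d i\<close>, so that graded lifting applies again.\<close>

lemma graded_comparison:
  assumes I: "ideal I (mpoly_ring V)"
    and F: "min_graded_free_resolution V I r s d \<epsilon>" and G: "min_graded_free_resolution V I r' s' d' \<epsilon>'"
  shows "\<exists>\<phi>. (\<forall>i. \<phi> i \<in> module_hom (mpoly_ring V) (free_module (mpoly_ring V) (r i)) (free_module (mpoly_ring V) (r' i)) \<and>
      (\<forall>c<r i. \<forall>l. homogeneous (s i c - s' i l) (\<phi> i (unit_vector (mpoly_ring V) c) l))) \<and>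
    (\<forall>x\<in>carrier (free_module (mpoly_ring V) (r 0)). \<epsilon>' (\<phi> 0 x) = \<epsilon> x) \<and>
    (\<forall>i. \<forall>x\<in>carrier (free_module (mpoly_ring V) (r (Suc i))). d' i (\<phi> (Suc i) x) = \<phi> i (d i x))"
proof (rule chain_map_exists[OF mgfr_resolution[OF F] mgfr_resolution[OF G]])
  note F_homs = resolution_homs[OF mgfr_resolution[OF F]]
  note G_homs = resolution_homs[OF mgfr_resolution[OF G]]
  let ?S = "mpoly_ring V" let ?Fr = "free_module ?S" let ?e = "unit_vector ?S"
  have im: "\<epsilon> x \<in> \<epsilon>' ` carrier (?Fr (r' 0))" if "x \<in> carrier (?Fr (r 0))" for x
    using hom_closed[OF F_homs(1) that] resolution_surj[OF mgfr_resolution[OF G]] by simp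
  show "\<exists>h\<in>module_hom ?S (?Fr (r 0)) (?Fr (r' 0)).
      (\<forall>c<r 0. \<forall>l. homogeneous (s 0 c - s' 0 l) (h (?e c) l)) \<and> (\<forall>x\<in>carrier (?Fr (r 0)). \<epsilon>' (h x) = \<epsilon> x)"
    by (rule graded_lift_ideal[OF I G_homs(1) mgfr_homogeneous_aug[OF G] F_homs(1) mgfr_homogeneous_aug[OF F] im])
  fix i \<phi>
  assume \<phi>: "\<phi> \<in> module_hom ?S (?Fr (r i)) (?Fr (r' i))"
    and h: "\<forall>c<r i. \<forall>l. homogeneous (s i c - s' i l) (\<phi> (?e c) l)"
    and im: "\<And>x. x \<in> carrier (?Fr (r (Suc i))) \<Longrightarrow> \<phi> (d i x) \<in> d' i ` carrier (?Fr (r' (Suc i)))"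
  have "homogeneous (s (Suc i) c - s' i l) (\<phi> (d i (?e c)) l)" if c: "c < r (Suc i)" for c l
  proof -
    have "\<phi> (d i (?e c)) l = (\<Sum>k<r i. d i (?e c) k * \<phi> (?e k) l)"
      by (rule hom_free_free[OF \<phi> hom_closed[OF F_homs(2) unit_vector_carrier[OF c]]])
    moreover have "homogeneous (s (Suc i) c - s' i l) (\<Sum>k<r i. d i (?e c) k * \<phi> (?e k) l)"
    proof (rule homogeneous_sum)
      fix k assume "k \<in> {..<r i}"
      then have "homogeneous ((s (Suc i) c - s i k) + (s i k - s' i l)) (d i (?e c) k * \<phi> (?e k) l)"
        using h by (intro homogeneous_mult mgfr_homogeneous[OF F c]) simp
      then show "homogeneous (s (Suc i) c - s' i l) (d i (?e c) k * \<phi> (?e k) l)" by simp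
    qed
    ultimately show ?thesis by simp
  qed
  from graded_lift[OF G_homs(2) mgfr_homogeneous[OF G] hom_comp[OF F_homs(2) \<phi>] this im]
  show "\<exists>h\<in>module_hom ?S (?Fr (r (Suc i))) (?Fr (r' (Suc i))).
      (\<forall>c<r (Suc i). \<forall>l. homogeneous (s (Suc i) c - s' (Suc i) l) (h (?e c) l)) \<and>
      (\<forall>x\<in>carrier (?Fr (r (Suc i))). d' i (h x) = \<phi> (d i x))" .
qed

text \<open>The composite of the comparison maps is the identity on constant coefficients. A
  homogeneous entry between generators of different degrees has no constant term, so the matrices of
  constant coefficients split into blocks by degree, and each block has a one-sided inverse.\<close>

lemma graded_rank_le:
  assumes I: "ideal I (mpoly_ring V)"
    and F: "min_graded_free_resolution V I r s d \<epsilon>" and G: "min_graded_free_resolution V I r' s' d' \<epsilon>'"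
  shows "card {c. c < r i \<and> s i c = j} \<le> card {c. c < r' i \<and> s' i c = j}"
proof -
  let ?S = "mpoly_ring V" let ?Fr = "free_module ?S" let ?e = "unit_vector ?S"
  obtain \<phi> where \<phi>: "\<And>i. \<phi> i \<in> module_hom ?S (?Fr (r i)) (?Fr (r' i))"
    "\<And>i c l. c < r i \<Longrightarrow> homogeneous (s i c - s' i l) (\<phi> i (?e c) l)"
    "\<And>x. x \<in> carrier (?Fr (r 0)) \<Longrightarrow> \<epsilon>' (\<phi> 0 x) = \<epsilon> x"
    "\<And>i x. x \<in> carrier (?Fr (r (Suc i))) \<Longrightarrow> d' i (\<phi> (Suc i) x) = \<phi> i (d i x)"
    using graded_comparison[OF I F G] by blast
  obtain \<psi> where \<psi>: "\<And>i. \<psi> i \<in> module_hom ?S (?Fr (r' i)) (?Fr (r i))"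
    "\<And>x. x \<in> carrier (?Fr (r' 0)) \<Longrightarrow> \<epsilon> (\<psi> 0 x) = \<epsilon>' x"
    "\<And>i x. x \<in> carrier (?Fr (r' (Suc i))) \<Longrightarrow> d i (\<psi> (Suc i) x) = \<psi> i (d' i x)"
    using graded_comparison[OF I G F] by blast
  have end_id: "coef (\<psi> i (\<phi> i x) l) 0 = coef (x l) 0" if "x \<in> carrier (?Fr (r i))" for x l
  proof (rule minimal_endomorphism[OF mgfr_resolution[OF F], where \<theta> = "\<lambda>i x. \<psi> i (\<phi> i x)"])
    show "(\<lambda>x. \<psi> i (\<phi> i x)) \<in> module_hom ?S (?Fr (r i)) (?Fr (r i))" for i by (rule hom_comp[OF \<phi>(1) \<psi>(1)])
    show "\<epsilon> (\<psi> 0 (\<phi> 0 x)) = \<epsilon> x" if "x \<in> carrier (?Fr (r 0))" for x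
      using \<psi>(2)[OF hom_closed[OF \<phi>(1) that]] \<phi>(3)[OF that] by simp
    show "d i (\<psi> (Suc i) (\<phi> (Suc i) x)) = \<psi> i (\<phi> i (d i x))" if "x \<in> carrier (?Fr (r (Suc i)))" for i x
      using \<psi>(3)[OF hom_closed[OF \<phi>(1) that]] \<phi>(4)[OF that] by simp
  qed (use that mgfr_minimal[OF F] in auto)
  let ?B = "{c. c < r' i \<and> s' i c = j}"
  show ?thesis
  proof (rule card_le_of_left_inverse)
    fix c l assume c: "c \<in> {c. c < r i \<and> s i c = j}" and l: "l \<in> {c. c < r i \<and> s i c = j}"
    have ec: "?e c \<in> carrier (?Fr (r i))" using c by (intro unit_vector_carrier) simp
    have "\<psi> i (\<phi> i (?e c)) l = (\<Sum>k<r' i. \<phi> i (?e c) k * \<psi> i (?e k) l)"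
      by (rule hom_free_free[OF \<psi>(1) hom_closed[OF \<phi>(1) ec]])
    then have "coef (\<psi> i (\<phi> i (?e c)) l) 0 = (\<Sum>k<r' i. coef (\<phi> i (?e c) k) 0 * coef (\<psi> i (?e k) l) 0)"
      by (simp add: lookup_sum coef_mult_const)
    also have "\<dots> = (\<Sum>k\<in>?B. coef (\<phi> i (?e c) k) 0 * coef (\<psi> i (?e k) l) 0)"
    proof (rule sum.mono_neutral_right)
      show "\<forall>k\<in>{..<r' i} - ?B. coef (\<phi> i (?e c) k) 0 * coef (\<psi> i (?e k) l) 0 = 0"
      proof
        fix k assume k: "k \<in> {..<r' i} - ?B"
        have "homogeneous (s i c - s' i k) (\<phi> i (?e c) k)" using c by (intro \<phi>(2)) simp
        then have "coef (\<phi> i (?e c) k) 0 = 0" by (rule homogeneous_coef_0) (use c k in auto)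
        then show "coef (\<phi> i (?e c) k) 0 * coef (\<psi> i (?e k) l) 0 = 0" by simp
      qed
    qed auto
    finally show "(\<Sum>k\<in>?B. coef (\<phi> i (?e c) k) 0 * coef (\<psi> i (?e k) l) 0) = (if c = l then 1 else 0)"
      using end_id[OF ec, of l] by (simp add: unit_vector_def)
  qed simp_all
qed

lemma graded_betti_eq:
  assumes "ideal I (mpoly_ring V)" "min_graded_free_resolution V I r s d \<epsilon>"
  shows "graded_betti V I i j = card {l. l < r i \<and> s i l = j}"
  unfolding graded_betti_def
proof (rule the_equality)
  fix b assume "\<exists>r s d \<epsilon>. min_graded_free_resolution V I r s d \<epsilon> \<and> b = card {l. l < r i \<and> s i l = j}"
  then obtain r' s' d' \<epsilon>' where G: "min_graded_free_resolution V I r' s' d' \<epsilon>'"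
    "b = card {l. l < r' i \<and> s' i l = j}" by blast
  show "b = card {l. l < r i \<and> s i l = j}"
    unfolding G(2)
    using graded_rank_le[OF assms G(1), of i j] graded_rank_le[OF assms(1) G(1) assms(2), of i j] by simp
qed (use assms(2) in blast)

text \<open>The total rank is the sum of the graded ranks over the finitely many shifts that
  occur.\<close>

lemma rank_unique:
  assumes I: "ideal I (mpoly_ring V)"
    and F: "min_graded_free_resolution V I r s d \<epsilon>" and G: "min_graded_free_resolution V I r' s' d' \<epsilon>'"
  shows "r i = r' i"
proof -
  define T where "T = s i ` {..<r i} \<union> s' i ` {..<r' i}"
  have finT: "finite T" by (simp add: T_def)
  have "n = (\<Sum>j\<in>T. card {c. c < n \<and> u c = j})" if u: "u ` {..<n} \<subseteq> T" for n and u :: "nat \<Rightarrow> int"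
  proof -
    have "(\<Union>j\<in>T. {c. c < n \<and> u c = j}) = {..<n}" using u by auto
    moreover have "card (\<Union>j\<in>T. {c. c < n \<and> u c = j}) = (\<Sum>j\<in>T. card {c. c < n \<and> u c = j})"
      by (rule card_UN_disjoint) (use finT in auto)
    ultimately show ?thesis by simp
  qed
  then have "r i = (\<Sum>j\<in>T. card {c. c < r i \<and> s i c = j})" "r' i = (\<Sum>j\<in>T. card {c. c < r' i \<and> s' i c = j})"
    by (auto simp: T_def)
  moreover have "card {c. c < r i \<and> s i c = j} = card {c. c < r' i \<and> s' i c = j}" for j
    using graded_rank_le[OF I F G, of i j] graded_rank_le[OF I G F, of i j] by simp
  ultimately show ?thesis by simp
qed

lemma betti_eq:
  assumes "ideal I (mpoly_ring V)" "min_graded_free_resolution V I r s d \<epsilon>"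
  shows "betti V I i = r i"
  unfolding betti_def
proof (rule the_equality)
  fix b assume "\<exists>r s d \<epsilon>. min_graded_free_resolution V I r s d \<epsilon> \<and> b = r i"
  then obtain r' s' d' \<epsilon>' where "min_graded_free_resolution V I r' s' d' \<epsilon>'" "b = r' i" by blast
  then show "b = r i" using rank_unique[OF assms, of r' s' d' \<epsilon>' i] by simp
qed (use assms(2) in blast)

section \<open>Division by a variable\<close>

text \<open>The quotient of division with remainder by the variable \<open>v\<close>: pulling back
  along the injective shift of exponents drops the monomials without \<open>v\<close>.\<close>

definition div_var :: "'v \<Rightarrow> ('v, 'k::field) mpoly \<Rightarrow> ('v, 'k) mpoly" where
  "div_var v = Poly_Mapping.map_key (\<lambda>t. t + mono v 1)"

lemma coef_div_var:
  fixes v :: 'v and p :: "('v, 'k::field) mpoly"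
  shows "coef (div_var v p) t = coef p (t + mono v 1)"
proof -
  have "inj (\<lambda>t :: 'v \<Rightarrow>\<^sub>0 nat. t + mono v 1)" by (simp add: inj_def)
  then show ?thesis by (simp add: div_var_def map_key.rep_eq)
qed

lemma div_var_0 [simp]: "div_var v 0 = 0"
  by (intro poly_mapping_eqI) (simp add: coef_div_var)

lemma div_var_add: "div_var v (p + q) = div_var v p + div_var v q"
  by (intro poly_mapping_eqI) (simp add: coef_div_var lookup_add)

lemma div_var_uminus: "div_var v (- p) = - div_var v p"
  by (intro poly_mapping_eqI) (simp add: coef_div_var)

lemma div_var_sum: "div_var v (sum f A) = (\<Sum>i\<in>A. div_var v (f i))"
  by (induction A rule: infinite_finite_induct) (auto simp: div_var_add)

lemma div_var_var_mult [simp]: "div_var v (var v * p) = p"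
  by (intro poly_mapping_eqI) (simp add: coef_div_var coef_var_mult lookup_add)

lemma div_var_var_mult_neq:
  assumes "u \<noteq> v"
  shows "div_var v (var u * p) = var u * div_var v p"
proof (intro poly_mapping_eqI)
  fix t :: "'a \<Rightarrow>\<^sub>0 nat"
  have "t + mono v 1 - mono u 1 = t - mono u 1 + mono v 1" if "coef t u \<noteq> 0"
    using that assms
    by (intro poly_mapping_eqI) (auto simp: lookup_add lookup_minus lookup_single when_def)
  then show "coef (div_var v (var u * p)) t = coef (var u * div_var v p) t"
    using assms by (simp add: coef_div_var coef_var_mult lookup_add lookup_single_not_eq)
qed

text \<open>The remainder of the division consists of the monomials in which \<open>v\<close> does
  not occur.\<close>

lemma coef_var_div_var:
  "coef (p - var v * div_var v p) t = (if coef t v = 0 then coef p t else 0)"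
proof -
  have "t - mono v 1 + mono v 1 = t" if "coef t v \<noteq> 0"
    using that by (intro poly_mapping_eqI) (auto simp: lookup_add lookup_minus lookup_single when_def)
  then show ?thesis by (simp add: lookup_minus coef_var_mult coef_div_var)
qed

lemma supp_var_div_var:
  "supp (p - var v * div_var v p) = {t \<in> supp p. coef t v = 0}"
  by (auto simp: in_keys_iff coef_var_div_var split: if_splits)

lemma polys_div_var [simp]: "p \<in> polys V \<Longrightarrow> div_var v p \<in> polys V"
  unfolding polys_def
  by (auto simp: in_keys_iff coef_div_var supp_exponent_add
      simp del: lookup_not_eq_zero_eq_in_keys dest!: bspec[where x = "_ + mono v 1"])

section \<open>Squarefree monomials\<close>

definition expo :: "'v set \<Rightarrow> 'v \<Rightarrow>\<^sub>0 nat" where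
  "expo S = (\<Sum>v\<in>S. mono v 1)"

lemma coef_expo: "finite S \<Longrightarrow> coef (expo S) v = (if v \<in> S then 1 else 0)"
  by (simp add: expo_def lookup_sum lookup_single when_def)

lemma prod_var: "(\<Prod>v\<in>S. var v) = (mono (expo S) 1 :: ('v, 'k::field) mpoly)"
proof (induction S rule: infinite_finite_induct)
  case (insert v S)
  have "expo (insert v S) = mono v 1 + expo S" using insert by (simp add: expo_def)
  then have "mono (expo (insert v S)) 1 = (var v * mono (expo S) 1 :: ('v, 'k) mpoly)"
    by (simp add: var_def mult_single)
  then show ?case using insert by simp
qed (simp_all add: expo_def)

section \<open>A cubical complex\<close>

text \<open>Each new index is added together with all its pairs, so the cancellation is literal and
  also valid in characteristic 2, where comparing the sum with its negative would prove
  nothing.\<close>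

lemma sum_antisymmetric:
  fixes g :: "'i \<Rightarrow> 'i \<Rightarrow> 'a::ab_group_add"
  assumes "finite A" "\<And>i j. i \<in> A \<Longrightarrow> j \<in> A \<Longrightarrow> i \<noteq> j \<Longrightarrow> g i j = - g j i"
  shows "(\<Sum>i\<in>A. \<Sum>j\<in>A - {i}. g i j) = 0"
  using assms
proof (induction A rule: finite_induct)
  case (insert a A)
  have "(\<Sum>j\<in>insert a A - {i}. g i j) = g i a + (\<Sum>j\<in>A - {i}. g i j)" if "i \<in> A" for i
  proof -
    have "insert a A - {i} = insert a (A - {i})" using that insert.hyps by auto
    then show ?thesis using insert.hyps by simp
  qed
  moreover have "insert a A - {a} = A" using insert.hyps by auto
  ultimately have "(\<Sum>i\<in>insert a A. \<Sum>j\<in>insert a A - {i}. g i j) =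
      (\<Sum>j\<in>A. g a j) + (\<Sum>i\<in>A. g i a) + (\<Sum>i\<in>A. \<Sum>j\<in>A - {i}. g i j)"
    using insert.hyps by (simp add: sum.distrib add.assoc)
  moreover have "(\<Sum>i\<in>A. g i a) = - (\<Sum>j\<in>A. g a j)"
    unfolding sum_negf[symmetric]
  proof (rule sum.cong)
    fix i assume "i \<in> A"
    then show "g i a = - g a i" using insert.prems[of i a] insert.hyps by blast
  qed simp
  moreover have "(\<Sum>i\<in>A. \<Sum>j\<in>A - {i}. g i j) = 0"
    by (rule insert.IH) (use insert.prems in blast)
  ultimately show ?case by simp
qed simp

text \<open>The usual sign of the cubical boundary, given by the number of directions of the face
  that precede \<open>j\<close>.\<close>

definition face_sign :: "nat \<Rightarrow> nat set \<Rightarrow> ('v, 'k::field) mpoly" where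
  "face_sign j \<sigma> = (- 1) ^ card {i \<in> \<sigma>. i < j}"

lemma face_sign_cases:
  obtains "face_sign j \<sigma> = (1 :: ('v, 'k::field) mpoly)" | "face_sign j \<sigma> = (- 1 :: ('v, 'k) mpoly)"
  unfolding face_sign_def by (metis neg_one_even_power neg_one_odd_power)

context
  fixes p :: "('v, 'k::field) mpoly" and j :: nat and \<sigma> :: "nat set"
begin

lemma face_sign_square: "face_sign j \<sigma> * (face_sign j \<sigma> * p) = p"
  by (cases rule: face_sign_cases[where 'v = 'v and 'k = 'k and j = j and \<sigma> = \<sigma>]) auto

lemma div_var_face_sign: "div_var v (face_sign j \<sigma> * p) = face_sign j \<sigma> * div_var v p"
  by (cases rule: face_sign_cases[where 'v = 'v and 'k = 'k and j = j and \<sigma> = \<sigma>]) (auto simp: div_var_uminus)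

lemma polys_face_sign [simp]: "(face_sign j \<sigma> :: ('v, 'k) mpoly) \<in> polys V"
  by (cases rule: face_sign_cases[where 'v = 'v and 'k = 'k and j = j and \<sigma> = \<sigma>]) auto

end

lemma face_sign_insert:
  assumes "finite \<sigma>" "i \<notin> \<sigma>"
  shows "face_sign j (insert i \<sigma>) = (if i < j then - face_sign j \<sigma> else face_sign j \<sigma>)"
proof (cases "i < j")
  case True
  then have "{l \<in> insert i \<sigma>. l < j} = insert i {l \<in> \<sigma>. l < j}" by auto
  then show ?thesis using assms True by (simp add: face_sign_def)
next
  case False
  then have "{l \<in> insert i \<sigma>. l < j} = {l \<in> \<sigma>. l < j}" by auto
  then show ?thesis using False by (simp add: face_sign_def)
qed

text \<open>Of two directions, one precedes the other and contributes one extra sign in exactly one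
  of the two orders.\<close>

lemma face_sign_swap:
  assumes "finite \<sigma>" "i \<notin> \<sigma>" "j \<notin> \<sigma>" "i \<noteq> j"
  shows "face_sign j \<sigma> * face_sign i (insert j \<sigma>) = - (face_sign i \<sigma> * face_sign j (insert i \<sigma>))"
  using assms by (auto simp: face_sign_insert mult.commute)

locale star_complex =
  fixes V :: "'v set" and J :: "nat set" and Q :: "nat \<Rightarrow> 'v set" and w :: "nat \<Rightarrow> 'v"
    and \<F> :: "(nat \<Rightarrow> 'v) set"
  assumes finite_V: "finite V" and finite_J: "finite J"
    and Q_subset: "\<And>j. j \<in> J \<Longrightarrow> Q j \<subseteq> V"
    and Q_disjoint: "\<And>i j v. i \<in> J \<Longrightarrow> j \<in> J \<Longrightarrow> v \<in> Q i \<Longrightarrow> v \<in> Q j \<Longrightarrow> i = j"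
    and w_Q: "\<And>j. j \<in> J \<Longrightarrow> w j \<in> Q j"
    and \<F>_PiE: "\<F> \<subseteq> Pi\<^sub>E J Q"
    and \<F>_w: "\<And>f j. f \<in> \<F> \<Longrightarrow> j \<in> J \<Longrightarrow> f(j := w j) \<in> \<F>"
begin

lemma finite_Q: "j \<in> J \<Longrightarrow> finite (Q j)"
  using Q_subset finite_V finite_subset by blast

lemma \<F>_in_Q: "f \<in> \<F> \<Longrightarrow> j \<in> J \<Longrightarrow> f j \<in> Q j"
  using \<F>_PiE PiE_mem by blast

lemma finite_\<F>: "finite \<F>"
  by (rule finite_subset[OF \<F>_PiE]) (intro finite_PiE finite_J finite_Q)

text \<open>The pair \<open>(f, \<sigma>)\<close> stands for the cube that is the product of the points \<open>f j\<close> with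
  \<open>j \<notin> \<sigma>\<close> and of the edges from \<open>f j\<close> to \<open>w j\<close> with \<open>j \<in> \<sigma>\<close>.\<close>

definition cell :: "nat \<Rightarrow> (nat \<Rightarrow> 'v) \<Rightarrow> nat set \<Rightarrow> bool" where
  "cell n f \<sigma> \<longleftrightarrow> f \<in> \<F> \<and> \<sigma> \<subseteq> {j \<in> J. f j \<noteq> w j} \<and> card \<sigma> = n"

text \<open>The free module on the cubes of dimension \<open>n\<close>, as functions on all pairs
  that vanish off the cells. Working without a numbered basis keeps the homotopy calculations free
  of indices.\<close>

definition chains :: "nat \<Rightarrow> ((nat \<Rightarrow> 'v) \<Rightarrow> nat set \<Rightarrow> ('v, 'k::field) mpoly) set" where
  "chains n = {x. \<forall>f \<sigma>. x f \<sigma> \<in> polys V \<and> (x f \<sigma> \<noteq> 0 \<longrightarrow> cell n f \<sigma>)}"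

text \<open>The signed coefficients of the cubes having \<open>(f, \<sigma>)\<close> as a face in
  direction \<open>j\<close>. An outer point \<open>f j\<close> is the end of a single edge, whereas
  at the centre \<open>w j\<close> all edges of the star meet, with the opposite
  orientation.\<close>

definition up :: "nat \<Rightarrow> ((nat \<Rightarrow> 'v) \<Rightarrow> nat set \<Rightarrow> ('v, 'k::field) mpoly) \<Rightarrow>
    (nat \<Rightarrow> 'v) \<Rightarrow> nat set \<Rightarrow> ('v, 'k) mpoly" where
  "up j x f \<sigma> = (if f j \<noteq> w j then x f (insert j \<sigma>)
                  else - (\<Sum>v\<in>Q j - {w j}. x (f(j := v)) (insert j \<sigma>)))"

text \<open>The boundary evaluated at a face. The factor \<open>var (f j)\<close> is the quotient of
  the label of the cube by the label of this face, both at an outer point and at the centre.\<close>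

definition bd :: "((nat \<Rightarrow> 'v) \<Rightarrow> nat set \<Rightarrow> ('v, 'k::field) mpoly) \<Rightarrow>
    (nat \<Rightarrow> 'v) \<Rightarrow> nat set \<Rightarrow> ('v, 'k) mpoly" where
  "bd x f \<sigma> = (\<Sum>j\<in>J - \<sigma>. face_sign j \<sigma> * (var (f j) * up j x f \<sigma>))"

text \<open>Extends a face at an outer point along its edge to the centre. Sign and division undo
  the corresponding summand of \<open>bd\<close>.\<close>

definition contr :: "nat \<Rightarrow> ((nat \<Rightarrow> 'v) \<Rightarrow> nat set \<Rightarrow> ('v, 'k::field) mpoly) \<Rightarrow>
    (nat \<Rightarrow> 'v) \<Rightarrow> nat set \<Rightarrow> ('v, 'k) mpoly" where
  "contr j x f \<sigma> = (if j \<in> \<sigma> \<and> f j \<noteq> w j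
     then face_sign j (\<sigma> - {j}) * div_var (f j) (x f (\<sigma> - {j})) else 0)"

definition cov :: "(nat \<Rightarrow> 'v) \<Rightarrow> ('v, 'k::field) mpoly" where
  "cov f = (\<Prod>v\<in>V - f ` J. var v)"

definition aug :: "((nat \<Rightarrow> 'v) \<Rightarrow> nat set \<Rightarrow> ('v, 'k::field) mpoly) \<Rightarrow> ('v, 'k) mpoly" where
  "aug x = (\<Sum>f\<in>\<F>. x f {} * cov f)"

text \<open>The operator \<open>up j\<close> alters coordinate \<open>j\<close> only, so the
  variables \<open>f i\<close> in the other directions can be pulled out.\<close>

lemma up_bd:
  assumes "j \<in> J - \<sigma>"
  shows "up j (bd x) f \<sigma> =
    (\<Sum>i\<in>J - \<sigma> - {j}. face_sign i (insert j \<sigma>) * (var (f i) * up j (up i x) f \<sigma>))"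
proof -
  have J: "J - insert j \<sigma> = J - \<sigma> - {j}" by auto
  have bd_upd: "bd x (f(j := v)) (insert j \<sigma>) = (\<Sum>i\<in>J - \<sigma> - {j}. face_sign i (insert j \<sigma>) *
      (var (f i) * up i x (f(j := v)) (insert j \<sigma>)))" for v
    unfolding bd_def J by (intro sum.cong) auto
  show ?thesis
  proof (cases "f j = w j")
    case True
    then have "up j (bd x) f \<sigma> = - (\<Sum>i\<in>J - \<sigma> - {j}. \<Sum>v\<in>Q j - {w j}. face_sign i (insert j \<sigma>) *
        (var (f i) * up i x (f(j := v)) (insert j \<sigma>)))"
      unfolding up_def[of j "bd x"] bd_upd by (subst sum.swap) simp
    then show ?thesis using True
      by (simp add: up_def[of j "up _ x"] sum_distrib_left sum_negf)
  next
    case False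
    then show ?thesis by (simp add: up_def[of j] bd_def J)
  qed
qed

lemma up_commute:
  assumes "i \<noteq> j"
  shows "up j (up i x) f \<sigma> = up i (up j x) f \<sigma>"
proof (cases "f i = w i \<and> f j = w j")
  case True
  then have "up j (up i x) f \<sigma> =
      (\<Sum>v\<in>Q j - {w j}. \<Sum>u\<in>Q i - {w i}. x (f(j := v, i := u)) (insert i (insert j \<sigma>)))"
    using assms by (simp add: up_def sum_negf)
  also have "\<dots> = (\<Sum>u\<in>Q i - {w i}. \<Sum>v\<in>Q j - {w j}. x (f(i := u, j := v)) (insert j (insert i \<sigma>)))"
    using assms by (subst sum.swap) (simp add: fun_upd_twist[OF assms] insert_commute)
  also have "\<dots> = up i (up j x) f \<sigma>"
    using assms True by (simp add: up_def sum_negf)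
  finally show ?thesis .
next
  case False
  then show ?thesis using assms by (auto simp: up_def insert_commute)
qed

text \<open>The operators \<open>up\<close> commute and so do the variables, while the signs
  anticommute.\<close>

lemma bd_bd:
  fixes x :: "(nat \<Rightarrow> 'v) \<Rightarrow> nat set \<Rightarrow> ('v, 'a::field) mpoly"
  shows "finite \<sigma> \<Longrightarrow> bd (bd x) f \<sigma> = 0"
proof -
  assume \<sigma>: "finite \<sigma>"
  have "bd (bd x) f \<sigma> = (\<Sum>j\<in>J - \<sigma>. \<Sum>i\<in>J - \<sigma> - {j}.
      (face_sign j \<sigma> * face_sign i (insert j \<sigma>)) * (var (f j) * (var (f i) * up j (up i x) f \<sigma>)))"
    unfolding bd_def[of "bd x"]
    by (intro sum.cong refl) (simp add: up_bd sum_distrib_left mult_ac)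
  also have "\<dots> = 0"
  proof (rule sum_antisymmetric)
    fix i j assume ij: "i \<in> J - \<sigma>" "j \<in> J - \<sigma>" "i \<noteq> j"
    have "face_sign i \<sigma> * face_sign j (insert i \<sigma>) =
        - (face_sign j \<sigma> * face_sign i (insert j \<sigma>) :: ('v, 'a) mpoly)"
      using ij \<sigma> by (intro face_sign_swap) auto
    then show "(face_sign i \<sigma> * face_sign j (insert i \<sigma>)) * (var (f i) * (var (f j) * up i (up j x) f \<sigma>)) =
      - ((face_sign j \<sigma> * face_sign i (insert j \<sigma>)) * (var (f j) * (var (f i) * up j (up i x) f \<sigma>)))"
      unfolding up_commute[OF ij(3)] by (simp only: mult_minus_left mult.left_commute[of "var (f i)"])
  qed (simp add: finite_J)
  finally show ?thesis .
qed

lemma up_add: "up j (\<lambda>f \<sigma>. x f \<sigma> + y f \<sigma>) f \<sigma> = up j x f \<sigma> + up j y f \<sigma>"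
  by (simp add: up_def sum.distrib)

lemma up_scale: "up j (\<lambda>f \<sigma>. a * x f \<sigma>) f \<sigma> = a * up j x f \<sigma>"
  by (simp add: up_def sum_distrib_left)

lemma bd_add: "bd (\<lambda>f \<sigma>. x f \<sigma> + y f \<sigma>) f \<sigma> = bd x f \<sigma> + bd y f \<sigma>"
  by (simp add: bd_def up_add sum.distrib distrib_left)

lemma bd_scale: "bd (\<lambda>f \<sigma>. a * x f \<sigma>) f \<sigma> = a * bd x f \<sigma>"
  by (simp add: bd_def up_scale sum_distrib_left mult_ac)

lemma bd_diff: "bd (\<lambda>f \<sigma>. x f \<sigma> - y f \<sigma>) f \<sigma> = bd x f \<sigma> - bd y f \<sigma>"
  using bd_add[of x "\<lambda>f \<sigma>. - 1 * y f \<sigma>" f \<sigma>] bd_scale[of "- 1" y f \<sigma>] by simp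

lemma aug_add: "aug (\<lambda>f \<sigma>. x f \<sigma> + y f \<sigma>) = aug x + aug y"
  by (simp add: aug_def sum.distrib distrib_right)

lemma aug_scale: "aug (\<lambda>f \<sigma>. a * x f \<sigma>) = a * aug x"
  by (simp add: aug_def sum_distrib_left mult_ac)

lemma aug_diff: "aug (\<lambda>f \<sigma>. x f \<sigma> - y f \<sigma>) = aug x - aug y"
  using aug_add[of x "\<lambda>f \<sigma>. - 1 * y f \<sigma>"] aug_scale[of "- 1" y] by simp

lemma chains_polys: "x \<in> chains n \<Longrightarrow> x f \<sigma> \<in> polys V"
  by (simp add: chains_def)

lemma chains_cell: "x \<in> chains n \<Longrightarrow> x f \<sigma> \<noteq> 0 \<Longrightarrow> cell n f \<sigma>"
  by (simp add: chains_def)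

lemma chains_diff: "x \<in> chains n \<Longrightarrow> y \<in> chains n \<Longrightarrow> (\<lambda>f \<sigma>. x f \<sigma> - y f \<sigma>) \<in> chains n"
  unfolding chains_def by simp (metis diff_zero eq_iff_diff_eq_0)

lemma chains_add: "x \<in> chains n \<Longrightarrow> y \<in> chains n \<Longrightarrow> (\<lambda>f \<sigma>. x f \<sigma> + y f \<sigma>) \<in> chains n"
  unfolding chains_def by simp (metis add_0)

lemma cell_finite: "cell n f \<sigma> \<Longrightarrow> finite \<sigma>"
  unfolding cell_def by (auto intro: finite_subset[OF _ finite_J])

lemma polys_up: "(\<And>f \<sigma>. x f \<sigma> \<in> polys V) \<Longrightarrow> up j x f \<sigma> \<in> polys V"
  by (simp add: up_def)

text \<open>Outside of the cells, \<open>bd x\<close> vanishes automatically because a face of a cell is a cell.\<close>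

lemma bd_chains:
  assumes "x \<in> chains (Suc n)"
  shows "bd x \<in> chains n"
proof -
  have var: "var (f j) * up j x f \<sigma> \<in> polys V \<and> (up j x f \<sigma> \<noteq> 0 \<longrightarrow> cell n f \<sigma>)"
    if j: "j \<in> J - \<sigma>" for j f \<sigma>
  proof -
    have c: "cell n f \<sigma>" if nz: "up j x f \<sigma> \<noteq> 0"
    proof -
      obtain f' where f': "x f' (insert j \<sigma>) \<noteq> 0" "f' = f \<or> f j = w j \<and> (\<exists>v. f' = f(j := v))"
        using nz unfolding up_def by (auto split: if_splits elim!: sum.not_neutral_contains_not_neutral)
      have cell: "cell (Suc n) f' (insert j \<sigma>)" using assms f'(1) by (rule chains_cell)
      have "f = f' \<or> f = f'(j := w j)" using f'(2) by auto
      then have "f \<in> \<F>" using cell j \<F>_w[of f' j] by (auto simp: cell_def)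
      moreover have "\<sigma> \<subseteq> {i \<in> J. f i \<noteq> w i}"
      proof
        fix i assume i: "i \<in> \<sigma>"
        then have "i \<noteq> j" using j by auto
        then show "i \<in> {i \<in> J. f i \<noteq> w i}" using cell f'(2) i by (auto simp: cell_def)
      qed
      moreover have "card \<sigma> = n"
        using cell j finite_insert cell_finite[OF cell] by (auto simp: cell_def)
      ultimately show ?thesis by (simp add: cell_def)
    qed
    have "up j x f \<sigma> \<in> polys V" using assms by (intro polys_up chains_polys)
    moreover have "f j \<in> V" if "cell n f \<sigma>"
      using that \<F>_in_Q[of f j] Q_subset[of j] j by (auto simp: cell_def)
    ultimately show ?thesis using c by (cases "up j x f \<sigma> = 0") auto
  qed
  show ?thesis
    unfolding chains_def
  proof (intro CollectI allI conjI impI)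
    fix f \<sigma>
    show "bd x f \<sigma> \<in> polys V" unfolding bd_def
      by (intro polys_sum polys_mult[OF polys_face_sign]) (use var in auto)
    assume "bd x f \<sigma> \<noteq> 0"
    then obtain j where "j \<in> J - \<sigma>" "face_sign j \<sigma> * (var (f j) * up j x f \<sigma>) \<noteq> 0"
      unfolding bd_def by (rule sum.not_neutral_contains_not_neutral)
    then show "cell n f \<sigma>" using var[of j \<sigma> f] by (cases "up j x f \<sigma> = 0") auto
  qed
qed

text \<open>Complements \<open>bd_bd\<close>, where \<open>\<sigma>\<close> is finite: an infinite
  set of directions belongs to no cell.\<close>

lemma bd_infinite:
  assumes "x \<in> chains n" "infinite \<sigma>"
  shows "bd x f \<sigma> = 0"
proof -
  have zero: "x f' (insert i \<sigma>) = 0" for f' i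
  proof (rule ccontr)
    assume "x f' (insert i \<sigma>) \<noteq> 0"
    then have "finite (insert i \<sigma>)" by (rule cell_finite[OF chains_cell[OF assms(1)]])
    then show False using assms(2) by simp
  qed
  have "up j x f \<sigma> = 0" for j by (simp add: up_def zero)
  then show ?thesis by (simp add: bd_def)
qed

lemma contr_chains:
  assumes "x \<in> chains n" "j \<in> J"
  shows "contr j x \<in> chains (Suc n)"
proof -
  have "cell (Suc n) f \<sigma>" if nz: "contr j x f \<sigma> \<noteq> 0" for f \<sigma>
  proof -
    have j: "j \<in> \<sigma>" "f j \<noteq> w j" and "x f (\<sigma> - {j}) \<noteq> 0"
      using nz by (auto simp: contr_def split: if_splits)
    then have "cell n f (\<sigma> - {j})" using assms(1) chains_cell by blast
    then show ?thesis using j assms(2) cell_finite[of n f "\<sigma> - {j}"] card.remove[of \<sigma> j]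
      by (auto simp: cell_def)
  qed
  moreover have "contr j x f \<sigma> \<in> polys V" for f \<sigma>
    using chains_polys[OF assms(1)] by (auto simp: contr_def)
  ultimately show ?thesis by (simp add: chains_def)
qed

text \<open>What the contraction in direction \<open>j\<close> leaves over. Cubes extended in this
  direction disappear, an outer point keeps the remainder modulo \<open>f j\<close>, and the
  quotients move to the centre, where they are multiplied by \<open>w j\<close>.\<close>

definition proj :: "nat \<Rightarrow> ((nat \<Rightarrow> 'v) \<Rightarrow> nat set \<Rightarrow> ('v, 'k::field) mpoly) \<Rightarrow>
    (nat \<Rightarrow> 'v) \<Rightarrow> nat set \<Rightarrow> ('v, 'k) mpoly" where
  "proj j x f \<sigma> = (if j \<in> \<sigma> then 0
     else if f j \<noteq> w j then x f \<sigma> - var (f j) * div_var (f j) (x f \<sigma>)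
     else x f \<sigma> + var (w j) * (\<Sum>v\<in>Q j - {w j}. div_var v (x (f(j := v)) \<sigma>)))"

text \<open>In each multidegree, \<open>contr j\<close> retracts the \<open>j\<close>-th star to its centre \<open>w j\<close> or leaves it
  untouched, according to whether the multidegree involves the variable \<open>f j\<close>.\<close>

lemma homotopy:
  fixes x :: "(nat \<Rightarrow> 'v) \<Rightarrow> nat set \<Rightarrow> ('v, 'a::field) mpoly"
  assumes "f \<in> \<F>" "\<sigma> \<subseteq> {i \<in> J. f i \<noteq> w i}" "j \<in> J"
  shows "bd (contr j x) f \<sigma> + contr j (bd x) f \<sigma> = x f \<sigma> - proj j x f \<sigma>"
proof (cases "j \<in> \<sigma>")
  case False
  have fin: "finite \<sigma>" using assms(2) by (auto intro: finite_subset[OF _ finite_J])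
  \<comment> \<open>Values of \<open>contr j x\<close> live on cubes extended in direction
    \<open>j\<close>, so only the \<open>j\<close>-th summand of the boundary survives.\<close>
  have "up i (contr j x) f \<sigma> = 0" if "i \<in> J - \<sigma> - {j}" for i
    using that False by (simp add: up_def contr_def)
  then have "bd (contr j x) f \<sigma> = face_sign j \<sigma> * (var (f j) * up j (contr j x) f \<sigma>)"
    unfolding bd_def using False assms(3) finite_J by (subst sum.remove[of _ j]) auto
  also have "\<dots> = x f \<sigma> - proj j x f \<sigma>"
  proof (cases "f j = w j")
    case True
    have "up j (contr j x) f \<sigma> = - (\<Sum>v\<in>Q j - {w j}. face_sign j \<sigma> * div_var v (x (f(j := v)) \<sigma>))"
      using True False by (simp add: up_def contr_def)
    then have "up j (contr j x) f \<sigma> = face_sign j \<sigma> * - (\<Sum>v\<in>Q j - {w j}. div_var v (x (f(j := v)) \<sigma>))"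
      by (simp add: sum_distrib_left)
    then show ?thesis using True False face_sign_square[of j \<sigma>]
      by (simp add: proj_def mult.left_commute[of "var _"])
  next
    case ne: False
    have "up j (contr j x) f \<sigma> = face_sign j \<sigma> * div_var (f j) (x f \<sigma>)"
      using ne False by (simp add: up_def contr_def)
    then show ?thesis using ne False face_sign_square[of j \<sigma>]
      by (simp add: proj_def mult.left_commute[of "var _"])
  qed
  finally show ?thesis using False by (simp add: contr_def)
next
  case True
  define \<sigma>' where "\<sigma>' = \<sigma> - {j}"
  have \<sigma>: "\<sigma> = insert j \<sigma>'" "j \<notin> \<sigma>'" using True by (auto simp: \<sigma>'_def)
  have fj: "f j \<noteq> w j" using True assms(2) by auto
  have fin: "finite \<sigma>" using assms(2) by (auto intro: finite_subset[OF _ finite_J])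
  then have fin': "finite \<sigma>'" by (simp add: \<sigma>'_def)
  \<comment> \<open>The summands of \<open>bd x\<close> at the face without direction
    \<open>j\<close>. The \<open>j\<close>-th one gives back \<open>x f \<sigma>\<close>, and each
    of the others cancels against a summand of \<open>bd (contr j x)\<close>.\<close>
  define c where "c = (\<lambda>i. face_sign i \<sigma>' * (var (f i) * up i x f \<sigma>'))"
  have J: "J - \<sigma>' = insert j (J - \<sigma>)" using True assms(3) by (auto simp: \<sigma>'_def)
  have "contr j (bd x) f \<sigma> = face_sign j \<sigma>' * div_var (f j) (c j + (\<Sum>i\<in>J - \<sigma>. c i))"
    using True fj finite_J by (simp add: contr_def bd_def c_def J flip: \<sigma>'_def)
  also have "\<dots> = x f \<sigma> + (\<Sum>i\<in>J - \<sigma>. face_sign j \<sigma>' * div_var (f j) (c i))"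
    using fj \<sigma>(1)[symmetric]
    by (simp add: c_def up_def[of j] div_var_add div_var_sum div_var_face_sign distrib_left
        sum_distrib_left face_sign_square)
  finally have 1: "contr j (bd x) f \<sigma> = x f \<sigma> + (\<Sum>i\<in>J - \<sigma>. face_sign j \<sigma>' * div_var (f j) (c i))" .
  have "face_sign i \<sigma> * (var (f i) * up i (contr j x) f \<sigma>) = - (face_sign j \<sigma>' * div_var (f j) (c i))"
    if i: "i \<in> J - \<sigma>" for i
  proof -
    have ij: "i \<noteq> j" "i \<notin> \<sigma>'" using i True by (auto simp: \<sigma>'_def)
    then have ins: "insert i \<sigma> - {j} = insert i \<sigma>'" by (auto simp: \<sigma>'_def)
    have up: "up i (contr j x) f \<sigma> = face_sign j (insert i \<sigma>') * div_var (f j) (up i x f \<sigma>')"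
      using True fj ij
      by (simp add: up_def contr_def ins div_var_uminus div_var_sum sum_distrib_left)
    \<comment> \<open>Disjointness of the stars makes division by one variable commute with
      multiplication by the other.\<close>
    have "f i \<noteq> f j"
      using Q_disjoint[of i j "f i"] \<F>_in_Q[of f] assms(1,3) i ij by auto
    then have "face_sign j \<sigma>' * div_var (f j) (c i) =
        (face_sign j \<sigma>' * face_sign i \<sigma>') * (var (f i) * div_var (f j) (up i x f \<sigma>'))"
      by (simp add: c_def div_var_face_sign div_var_var_mult_neq mult_ac)
    moreover have "face_sign i \<sigma> * face_sign j (insert i \<sigma>') = - (face_sign j \<sigma>' * face_sign i \<sigma>' :: ('v, 'a) mpoly)"
      using ij \<sigma>(2) fin' unfolding \<sigma>(1) by (auto simp: face_sign_insert mult.commute)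
    moreover have "face_sign i \<sigma> * (var (f i) * up i (contr j x) f \<sigma>) =
        (face_sign i \<sigma> * face_sign j (insert i \<sigma>')) * (var (f i) * div_var (f j) (up i x f \<sigma>'))"
      unfolding up by (simp only: mult_ac)
    ultimately show ?thesis by simp
  qed
  then have "bd (contr j x) f \<sigma> = - (\<Sum>i\<in>J - \<sigma>. face_sign j \<sigma>' * div_var (f j) (c i))"
    unfolding bd_def by (simp add: sum_negf)
  then show ?thesis using 1 True by (simp add: proj_def)
qed

text \<open>The shape of \<open>proj j x\<close> for all \<open>j\<close> in \<open>A\<close> at
  once: no cube extends in these directions, and the coefficient at an outer point does not involve
  the variable of that point.\<close>

definition normal :: "nat set \<Rightarrow> ((nat \<Rightarrow> 'v) \<Rightarrow> nat set \<Rightarrow> ('v, 'k::field) mpoly) \<Rightarrow> bool" where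
  "normal A x \<longleftrightarrow> (\<forall>f \<sigma>. \<forall>j\<in>A. (j \<in> \<sigma> \<longrightarrow> x f \<sigma> = 0) \<and>
     (f j \<noteq> w j \<longrightarrow> (\<forall>t\<in>supp (x f \<sigma>). coef t (f j) = 0)))"

lemma normalD:
  assumes "normal A x" "i \<in> A"
  shows "i \<in> \<sigma> \<Longrightarrow> x f \<sigma> = 0" "f i \<noteq> w i \<Longrightarrow> t \<in> supp (x f \<sigma>) \<Longrightarrow> coef t (f i) = 0"
proof -
  have "(i \<in> \<sigma> \<longrightarrow> x f \<sigma> = 0) \<and> (f i \<noteq> w i \<longrightarrow> (\<forall>t\<in>supp (x f \<sigma>). coef t (f i) = 0))"
    using assms(1)[unfolded normal_def, rule_format, OF assms(2)] by simp
  then show "i \<in> \<sigma> \<Longrightarrow> x f \<sigma> = 0" "f i \<noteq> w i \<Longrightarrow> t \<in> supp (x f \<sigma>) \<Longrightarrow> coef t (f i) = 0"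
    by simp_all
qed

lemma supp_var_mult: "t \<in> supp (var v * p) \<Longrightarrow> \<exists>s\<in>supp p. t = mono v 1 + s"
  by (auto simp: var_def elim!: supp_mult split: if_splits)

text \<open>For a cycle the homotopy formula turns the difference into \<open>proj j x\<close>. This
  is normal in direction \<open>j\<close>, and the earlier directions are not disturbed: coordinate
  \<open>i\<close> stays the same, and the only new variable \<open>w j\<close> differs from
  \<open>f i\<close>.\<close>

lemma normal_step:
  assumes x: "x \<in> chains n" "\<And>f \<sigma>. bd x f \<sigma> = 0" "normal A x" and j: "j \<in> J" "j \<notin> A" "A \<subseteq> J"
  shows "normal (insert j A) (\<lambda>f \<sigma>. x f \<sigma> - bd (contr j x) f \<sigma>)" (is "normal _ ?x")
proof -
  have ch: "?x \<in> chains n" by (intro chains_diff bd_chains contr_chains x j)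
  have eq: "?x f \<sigma> = proj j x f \<sigma>" if "?x f \<sigma> \<noteq> 0" for f \<sigma>
  proof -
    have "cell n f \<sigma>" using chains_cell[OF ch that] .
    then have "bd (contr j x) f \<sigma> + contr j (bd x) f \<sigma> = x f \<sigma> - proj j x f \<sigma>"
      using j by (intro homotopy) (auto simp: cell_def)
    moreover have "contr j (bd x) f \<sigma> = 0" using x(2) by (simp add: contr_def)
    ultimately show ?thesis by simp
  qed
  have key: "(i \<in> \<sigma> \<longrightarrow> proj j x f \<sigma> = 0) \<and> (f i \<noteq> w i \<longrightarrow> (\<forall>t\<in>supp (proj j x f \<sigma>). coef t (f i) = 0))"
    if i: "i \<in> insert j A" and f: "f \<in> \<F>" for i f \<sigma>
  proof (cases "j \<in> \<sigma>")
    case True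
    then show ?thesis by (simp add: proj_def)
  next
    case j\<sigma>: False
    show ?thesis
    proof (cases "f j = w j")
      case False
      have p: "proj j x f \<sigma> = x f \<sigma> - var (f j) * div_var (f j) (x f \<sigma>)"
        using False j\<sigma> by (simp add: proj_def)
      show ?thesis
      proof (cases "i = j")
        case True
        then show ?thesis using j\<sigma> unfolding p supp_var_div_var by simp
      next
        case False
        then have iA: "i \<in> A" using i by simp
        show ?thesis
          using normalD(1)[OF x(3) iA, of \<sigma> f] normalD(2)[OF x(3) iA, of f _ \<sigma>]
          unfolding p supp_var_div_var by auto
      qed
    next
      case True
      have p: "proj j x f \<sigma> = x f \<sigma> + var (w j) * (\<Sum>v\<in>Q j - {w j}. div_var v (x (f(j := v)) \<sigma>))"
        using True j\<sigma> by (simp add: proj_def)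
      show ?thesis
      proof (cases "i = j")
        case True
        then show ?thesis using j\<sigma> \<open>f j = w j\<close> by simp
      next
        case ij: False
        then have iA: "i \<in> A" "i \<in> J" using i j by auto
        have "coef t (f i) = 0" if fi: "f i \<noteq> w i" and t: "t \<in> supp (proj j x f \<sigma>)" for t
        proof -
          have wj: "w j \<noteq> f i" using Q_disjoint[of i j "f i"] \<F>_in_Q[OF f] w_Q[of j] j(1) iA ij by auto
          have "t \<in> supp (x f \<sigma>) \<union>
              supp (var (w j) * (\<Sum>v\<in>Q j - {w j}. div_var v (x (f(j := v)) \<sigma>)))"
            by (rule subsetD[OF keys_add t[unfolded p]])
          then show ?thesis
          proof
            assume "t \<in> supp (x f \<sigma>)"
            then show ?thesis by (rule normalD(2)[where f = f and \<sigma> = \<sigma>, OF x(3) iA(1) fi])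
          next
            assume "t \<in> supp (var (w j) * (\<Sum>v\<in>Q j - {w j}. div_var v (x (f(j := v)) \<sigma>)))"
            from supp_var_mult[OF this] obtain s where s: "s \<in> supp (\<Sum>v\<in>Q j - {w j}. div_var v (x (f(j := v)) \<sigma>))"
              "t = mono (w j) 1 + s" by blast
            then obtain v where "s \<in> supp (div_var v (x (f(j := v)) \<sigma>))"
              using subsetD[OF keys_sum s(1)] by blast
            then have "s + mono v 1 \<in> supp (x (f(j := v)) \<sigma>)"
              by (simp add: in_keys_iff coef_div_var del: lookup_not_eq_zero_eq_in_keys)
            then have "coef (s + mono v 1) (f i) = 0"
              using normalD(2)[OF x(3) iA(1), of "f(j := v)" "s + mono v 1" \<sigma>] fi ij by simp
            then show ?thesis using s(2) wj by (simp add: lookup_add lookup_single_not_eq)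
          qed
        qed
        moreover have "proj j x f \<sigma> = 0" if "i \<in> \<sigma>"
          unfolding p by (simp add: normalD(1)[OF x(3) iA(1) that])
        ultimately show ?thesis by blast
      qed
    qed
  qed
  have res: "(i \<in> \<sigma> \<longrightarrow> ?x f \<sigma> = 0) \<and> (f i \<noteq> w i \<longrightarrow> (\<forall>t\<in>supp (?x f \<sigma>). coef t (f i) = 0))"
    if i: "i \<in> insert j A" for i f \<sigma>
  proof (cases "?x f \<sigma> = 0")
    case False
    then have "f \<in> \<F>" using chains_cell[OF ch] by (auto simp: cell_def)
    then show ?thesis using key[OF i, of f \<sigma>] eq[OF False] by metis
  qed simp
  show ?thesis unfolding normal_def by (intro allI ballI res)
qed

section \<open>The augmentation and exactness of the complex\<close>

lemma cov_mono: "cov f = mono (expo (V - f ` J)) 1"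
  by (simp add: cov_def prod_var)

lemma coef_cov_expo: "coef (expo (V - f ` J)) v = (if v \<in> V - f ` J then 1 else 0)"
  using finite_V by (simp add: coef_expo)

lemma polys_cov [simp]: "cov f \<in> polys V"
  unfolding cov_def by (intro polys_prod polys_var) auto

text \<open>For normal \<open>z\<close> no two transversals contribute the same monomial to
  \<open>aug z\<close>. A variable missing from the monomial \<open>b\<close> must be a point of the
  transversal, and normality guarantees that the outer points are missing; the remaining coordinates
  are the centres.\<close>

lemma aug_normal:
  assumes z: "z \<in> chains 0" "normal J z" "aug z = 0"
  shows "z g {} = 0"
proof (rule ccontr)
  assume nz: "z g {} \<noteq> 0"
  then obtain t where t: "t \<in> supp (z g {})" by (metis ex_in_conv keys_eq_empty)
  have g: "g \<in> \<F>" using chains_cell[OF z(1) nz] by (simp add: cell_def)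
  let ?e = "\<lambda>f. expo (V - f ` J)"
  define b where "b = ?e g + t"
  have "coef (z f {} * cov f) b = 0" if f: "f \<in> \<F> - {g}" for f
  proof (rule ccontr)
    assume "coef (z f {} * cov f) b \<noteq> 0"
    then have "b \<in> supp (cov f * z f {})"
      by (simp add: in_keys_iff mult.commute del: lookup_not_eq_zero_eq_in_keys)
    then obtain s where s: "s \<in> supp (z f {})" "b = ?e f + s"
      unfolding cov_mono by (auto elim!: supp_mult split: if_splits)
    have in_image: "v \<in> f ` J" if "v \<in> V" "coef b v = 0" for v
      using that s(2) by (auto simp: lookup_add coef_cov_expo split: if_splits)
    have in_image': "v \<in> g ` J" if "v \<in> V" "coef b v = 0" for v
      using that by (auto simp: b_def lookup_add coef_cov_expo split: if_splits)
    have "f j = g j" if j: "j \<in> J" for j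
    proof -
      have V: "f j \<in> V" "g j \<in> V" "f j \<in> Q j" "g j \<in> Q j"
        using \<F>_in_Q g f j Q_subset by blast+
      consider "g j \<noteq> w j" | "f j \<noteq> w j" | "f j = w j" "g j = w j" by blast
      then show ?thesis
      proof cases
        case 1
        then have "coef t (g j) = 0" using t by (rule normalD(2)[OF z(2) j])
        then have "coef b (g j) = 0" using j by (simp add: b_def lookup_add coef_cov_expo)
        then obtain i where i: "i \<in> J" "g j = f i" using in_image V by blast
        then show ?thesis using Q_disjoint[of i j "f i"] \<F>_in_Q[of f i] f j V by auto
      next
        case 2
        then have "coef s (f j) = 0" using s(1) by (rule normalD(2)[OF z(2) j])
        then have "coef b (f j) = 0" using j s(2) by (simp add: lookup_add coef_cov_expo)
        then obtain i where i: "i \<in> J" "f j = g i" using in_image' V by blast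
        then show ?thesis using Q_disjoint[of i j "g i"] \<F>_in_Q[of g i] g j V by auto
      qed auto
    qed
    then have "f = g" using PiE_ext[of f J Q g] \<F>_PiE f g by blast
    then show False using f by simp
  qed
  then have "coef (aug z) b = coef (z g {} * cov g) b"
    using g finite_\<F> by (simp add: aug_def lookup_add lookup_sum sum.remove[of \<F> g])
  also have "\<dots> = coef (z g {}) t"
    using coef_mono_mult_add[of "?e g" 1 "z g {}" t] by (simp add: cov_mono b_def mult.commute)
  finally show False using t z(3) by (simp add: in_keys_iff)
qed

text \<open>Both sides are the label of the edge from \<open>f\<close> to
  \<open>f(j := w j)\<close>, the product over all vertices except the points in the other
  directions.\<close>

lemma var_cov:
  assumes "f \<in> \<F>" "j \<in> J"
  shows "var (w j) * cov (f(j := w j)) = var (f j) * (cov f :: ('v, 'k::field) mpoly)"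
proof -
  have img: "f(j := u) ` J = insert u (f ` (J - {j}))" for u
  proof -
    have "f(j := u) ` (J - {j}) = f ` (J - {j})" by (intro image_cong) auto
    moreover have "f(j := u) ` insert j (J - {j}) = insert u (f(j := u) ` (J - {j}))"
      by (simp only: image_insert fun_upd_same)
    ultimately show ?thesis using assms(2) by (simp only: insert_Diff)
  qed
  have nin: "u \<notin> f ` (J - {j})" if u: "u \<in> Q j" for u
  proof
    assume "u \<in> f ` (J - {j})"
    then obtain i where i: "i \<in> J - {j}" "u = f i" by (rule imageE)
    then have "f i \<in> Q i" "f i \<in> Q j" using \<F>_in_Q[OF assms(1), of i] u by simp_all
    then have "i = j" using Q_disjoint[of i j "f i"] i(1) assms(2) by simp
    then show False using i(1) by simp
  qed
  have *: "var u * cov (f(j := u)) = (\<Prod>v\<in>V - f ` (J - {j}). var v :: ('v, 'k) mpoly)" if u: "u \<in> Q j" for u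
  proof -
    let ?W = "V - f(j := u) ` J"
    have "V - f ` (J - {j}) = insert u ?W"
      using nin[OF u] Q_subset[OF assms(2)] u unfolding img by blast
    moreover have "u \<notin> ?W" unfolding img by blast
    then have "(\<Prod>v\<in>insert u ?W. var v :: ('v, 'k) mpoly) = var u * (\<Prod>v\<in>?W. var v)"
      using finite_V by (intro prod.insert) auto
    ultimately show ?thesis unfolding cov_def by (simp only:)
  qed
  show ?thesis using *[OF w_Q[OF assms(2)]] *[OF \<F>_in_Q[OF assms]] by simp
qed

text \<open>An edge contributes at its two ends with opposite signs, and \<open>var_cov\<close>
  makes the contributions equal.\<close>

lemma aug_bd:
  assumes y: "y \<in> chains (Suc 0)"
  shows "aug (bd y) = 0"
proof -
  have "(\<Sum>f\<in>\<F>. var (f j) * up j y f {} * cov f) = 0" if j: "j \<in> J" for j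
  proof -
    let ?A = "{f \<in> \<F>. f j \<noteq> w j}" and ?B = "{f \<in> \<F>. f j = w j}"
    have "(\<Sum>f\<in>?B. var (f j) * up j y f {} * cov f) =
        - (\<Sum>f\<in>?B. \<Sum>v\<in>Q j - {w j}. var (w j) * y (f(j := v)) {j} * cov f)"
      by (simp add: up_def sum_distrib_left sum_distrib_right sum_negf)
    also have "(\<Sum>f\<in>?B. \<Sum>v\<in>Q j - {w j}. var (w j) * y (f(j := v)) {j} * cov f) =
        (\<Sum>(f, v)\<in>?B \<times> (Q j - {w j}). var (w j) * y (f(j := v)) {j} * cov f)"
      using finite_\<F> finite_Q[OF j] by (intro sum.cartesian_product)
    also have "\<dots> = (\<Sum>g\<in>?A. var (w j) * y g {j} * cov (g(j := w j)))"
    \<comment> \<open>A centre \<open>f\<close> together with an outer point \<open>v\<close>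
      encodes the edge at \<open>f(j := v)\<close>. Pairs that leave \<open>\<F>\<close> are no
      edges, and their coefficients vanish.\<close>
    proof (rule sum.reindex_bij_witness_not_neutral[where
          S' = "{(f, v) \<in> ?B \<times> (Q j - {w j}). f(j := v) \<notin> \<F>}" and T' = "{}"
          and i = "\<lambda>g. (g(j := w j), g j)" and j = "\<lambda>(f, v). f(j := v)"])
      show "finite {(f, v) \<in> ?B \<times> (Q j - {w j}). f(j := v) \<notin> \<F>}"
        using finite_\<F> finite_Q[OF j] by (auto intro: finite_subset[of _ "?B \<times> (Q j - {w j})"])
      show "(g(j := w j), g j) \<in> ?B \<times> (Q j - {w j}) - {(f, v) \<in> ?B \<times> (Q j - {w j}). f(j := v) \<notin> \<F>}"
        if "g \<in> ?A - {}" for g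
        using that \<F>_w[of g j] \<F>_in_Q[of g j] j by auto
      show "(case a of (f, v) \<Rightarrow> var (w j) * y (f(j := v)) {j} * cov f) = 0"
        if a': "a \<in> {(f, v) \<in> ?B \<times> (Q j - {w j}). f(j := v) \<notin> \<F>}" for a
      proof -
        obtain f v where a: "a = (f, v)" "f(j := v) \<notin> \<F>" using a' by auto
        then have "y (f(j := v)) {j} = 0" using chains_cell[OF y] by (auto simp: cell_def)
        then show ?thesis using a by simp
      qed
    qed (auto simp: fun_upd_idem)
    also have "\<dots> = (\<Sum>g\<in>?A. var (g j) * up j y g {} * cov g)"
    proof (rule sum.cong)
      fix g assume g: "g \<in> ?A"
      have "var (w j) * y g {j} * cov (g(j := w j)) = y g {j} * (var (w j) * cov (g(j := w j)))"
        by (simp add: mult_ac)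
      also have "\<dots> = y g {j} * (var (g j) * cov g)" using g j by (subst var_cov) auto
      finally show "var (w j) * y g {j} * cov (g(j := w j)) = var (g j) * up j y g {} * cov g"
        using g by (simp add: up_def mult_ac)
    qed simp
    finally have "(\<Sum>f\<in>?A \<union> ?B. var (f j) * up j y f {} * cov f) = 0"
      using finite_\<F> by (subst sum.union_disjoint) auto
    moreover have "?A \<union> ?B = \<F>" by auto
    ultimately show ?thesis by simp
  qed
  moreover have "aug (bd y) = (\<Sum>j\<in>J. \<Sum>f\<in>\<F>. var (f j) * up j y f {} * cov f)"
    unfolding aug_def bd_def
    by (subst sum.swap) (simp add: face_sign_def sum_distrib_right)
  ultimately show ?thesis by simp
qed

text \<open>Boundaries are subtracted for one direction after another until the cycle is normal in
  all of \<open>J\<close>. A normal chain vanishes on cubes of positive dimension, and on points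
  \<open>aug_normal\<close> applies.\<close>

lemma exactness:
  assumes x: "x \<in> chains n" "\<And>f \<sigma>. bd x f \<sigma> = 0" and aug: "n = 0 \<Longrightarrow> aug x = 0"
  shows "\<exists>y\<in>chains (Suc n). bd y = x"
proof -
  have "\<exists>y\<in>chains (Suc n). normal A (\<lambda>f \<sigma>. x f \<sigma> - bd y f \<sigma>)" if "finite A" "A \<subseteq> J" for A
    using that
  proof (induction A rule: finite_induct)
    case empty
    have "(\<lambda>f \<sigma>. 0) \<in> chains (Suc n)" by (simp add: chains_def)
    then show ?case by (auto simp: normal_def)
  next
    case (insert j A)
    then obtain y where y: "y \<in> chains (Suc n)" "normal A (\<lambda>f \<sigma>. x f \<sigma> - bd y f \<sigma>)" by auto
    let ?x = "\<lambda>f \<sigma>. x f \<sigma> - bd y f \<sigma>"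
    have x': "?x \<in> chains n" using x y by (intro chains_diff bd_chains)
    have "bd ?x f \<sigma> = 0" for f \<sigma>
    proof (cases "finite \<sigma>")
      case True
      then show ?thesis using x(2) bd_bd by (simp add: bd_diff)
    next
      case False
      then show ?thesis by (rule bd_infinite[OF x'])
    qed
    then have "normal (insert j A) (\<lambda>f \<sigma>. ?x f \<sigma> - bd (contr j ?x) f \<sigma>)"
      using insert.hyps(2) insert.prems by (intro normal_step[OF x' _ y(2)]) auto
    then have "normal (insert j A) (\<lambda>f \<sigma>. x f \<sigma> - bd (\<lambda>f \<sigma>. y f \<sigma> + contr j ?x f \<sigma>) f \<sigma>)"
      by (simp add: bd_add algebra_simps)
    moreover have "(\<lambda>f \<sigma>. y f \<sigma> + contr j ?x f \<sigma>) \<in> chains (Suc n)"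
      using y x' insert.prems by (intro chains_add contr_chains) auto
    ultimately show ?case by (rule bexI)
  qed
  from this[OF finite_J subset_refl]
  obtain y where y: "y \<in> chains (Suc n)" "normal J (\<lambda>f \<sigma>. x f \<sigma> - bd y f \<sigma>)" by (rule bexE)
  let ?z = "\<lambda>f \<sigma>. x f \<sigma> - bd y f \<sigma>"
  have z: "?z \<in> chains n" using x y by (intro chains_diff bd_chains)
  have "?z f \<sigma> = 0" for f \<sigma>
  proof (rule ccontr)
    assume nz: "?z f \<sigma> \<noteq> 0"
    have c: "cell n f \<sigma>" using chains_cell[OF z nz] .
    show False
    proof (cases "\<sigma> = {}")
      case True
      then have "n = 0" using c by (simp add: cell_def)
      then have "aug ?z = 0" using aug aug_bd y(1) by (simp add: aug_diff)
      then show False using aug_normal[of ?z f] z y(2) nz True \<open>n = 0\<close> by auto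
    next
      case False
      then obtain j where "j \<in> \<sigma>" "j \<in> J" using c by (auto simp: cell_def)
      then show False using normalD(1)[OF y(2)] nz by blast
    qed
  qed
  then have "bd y = x" by (intro ext) (metis eq_iff_diff_eq_0)
  then show ?thesis using y(1) by blast
qed

end

section \<open>Quasi-regular sequences\<close>

text \<open>For positive exponent \<open>j\<close> this is \<open>I\<close> plus the
  \<open>j\<close>-th power of the ideal of \<open>p 0, ..., p (n - 1)\<close>, unfolded along the
  last generator. The double recursion is shared with \<open>form_exps\<close> and
  \<open>form_val\<close>, so that all inductions run in parallel.\<close>

fun power_ideal :: "'v set \<Rightarrow> ('v, 'k::field) mpoly set \<Rightarrow> (nat \<Rightarrow> ('v, 'k) mpoly) \<Rightarrow> nat \<Rightarrow> nat \<Rightarrow>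
    ('v, 'k) mpoly set" where
  "power_ideal V I p n 0 = polys V"
| "power_ideal V I p 0 (Suc j) = I"
| "power_ideal V I p (Suc n) (Suc j) =
     {x + p n * y |x y. x \<in> power_ideal V I p n (Suc j) \<and> y \<in> power_ideal V I p (Suc n) j}"

fun form_exps :: "nat \<Rightarrow> nat \<Rightarrow> (nat \<Rightarrow>\<^sub>0 nat) set" where
  "form_exps n 0 = {0}"
| "form_exps 0 (Suc j) = {}"
| "form_exps (Suc n) (Suc j) = form_exps n (Suc j) \<union> (\<lambda>\<alpha>. \<alpha> + mono n 1) ` form_exps (Suc n) j"

lemma form_exps_supp: "\<alpha> \<in> form_exps n j \<Longrightarrow> supp \<alpha> \<subseteq> {..<n}"
proof (induction n j arbitrary: \<alpha> rule: form_exps.induct)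
  case (3 n j)
  show ?case
  proof (cases "\<alpha> \<in> form_exps n (Suc j)")
    case True
    then show ?thesis using 3(1) by fastforce
  next
    case False
    then obtain \<beta> where "\<beta> \<in> form_exps (Suc n) j" "\<alpha> = \<beta> + mono n 1" using 3(3) by auto
    then show ?thesis using 3(2)[of \<beta>] by (auto simp: supp_exponent_add)
  qed
qed simp_all

lemma monom_deg_eq_0: "monom_deg \<alpha> = 0 \<Longrightarrow> \<alpha> = 0"
  by (intro poly_mapping_eqI) (auto simp: monom_deg_def in_keys_iff)

text \<open>The recursion suits induction; this description is for the leading term argument, where
  exponents are added and compared.\<close>

lemma form_exps_iff: "\<alpha> \<in> form_exps n j \<longleftrightarrow> supp \<alpha> \<subseteq> {..<n} \<and> monom_deg \<alpha> = j"
proof (induction n j arbitrary: \<alpha> rule: form_exps.induct)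
  case (1 n)
  then show ?case using monom_deg_eq_0[of \<alpha>] by (auto simp: monom_deg_def)
next
  case (2 j)
  then show ?case by (auto simp: monom_deg_def)
next
  case (3 n j)
  have deg1: "monom_deg (mono n 1) = 1" by (simp add: monom_deg_def)
  show ?case
  proof (cases "coef \<alpha> n = 0")
    case True
    then have "\<alpha> \<notin> (\<lambda>\<alpha>. \<alpha> + mono n 1) ` form_exps (Suc n) j" by (auto simp: lookup_add)
    moreover have "n \<notin> supp \<alpha>" using True by (simp add: in_keys_iff)
    then have "supp \<alpha> \<subseteq> {..<Suc n} \<longleftrightarrow> supp \<alpha> \<subseteq> {..<n}" by (simp add: lessThan_Suc subset_insert)
    ultimately show ?thesis using 3(1)[of \<alpha>] by simp
  next
    case False
    then have eq: "\<alpha> = (\<alpha> - mono n 1) + mono n 1"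
      by (intro poly_mapping_eqI) (auto simp: lookup_add lookup_minus lookup_single when_def)
    have "n \<in> supp \<alpha>" using False by (simp add: in_keys_iff)
    then have "\<alpha> \<notin> form_exps n (Suc j)" using form_exps_supp[of \<alpha> n "Suc j"] by blast
    moreover have "\<alpha> \<in> (\<lambda>\<alpha>. \<alpha> + mono n 1) ` form_exps (Suc n) j \<longleftrightarrow> \<alpha> - mono n 1 \<in> form_exps (Suc n) j"
    proof
      assume "\<alpha> \<in> (\<lambda>\<alpha>. \<alpha> + mono n 1) ` form_exps (Suc n) j"
      then obtain \<beta> where "\<beta> \<in> form_exps (Suc n) j" "\<alpha> = \<beta> + mono n 1" by blast
      then show "\<alpha> - mono n 1 \<in> form_exps (Suc n) j" by simp
    next
      assume "\<alpha> - mono n 1 \<in> form_exps (Suc n) j"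
      then show "\<alpha> \<in> (\<lambda>\<alpha>. \<alpha> + mono n 1) ` form_exps (Suc n) j" using eq by (rule rev_image_eqI)
    qed
    moreover have "monom_deg \<alpha> = monom_deg (\<alpha> - mono n 1) + 1"
      using arg_cong[OF eq, of monom_deg] by (simp add: monom_deg_add deg1[simplified])
    moreover have "supp \<alpha> \<subseteq> {..<Suc n} \<longleftrightarrow> supp (\<alpha> - mono n 1) \<subseteq> {..<Suc n}"
      using arg_cong[OF eq, of supp] by (simp add: supp_exponent_add)
    ultimately show ?thesis using 3(2)[of "\<alpha> - mono n 1"] by simp
  qed
qed

lemma finite_form_exps: "finite (form_exps n j)"
  by (induction n j rule: form_exps.induct) simp_all

definition monom_val :: "nat \<Rightarrow> (nat \<Rightarrow> 'a::comm_ring_1) \<Rightarrow> (nat \<Rightarrow>\<^sub>0 nat) \<Rightarrow> 'a" where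
  "monom_val N p \<alpha> = (\<Prod>i<N. p i ^ coef \<alpha> i)"

lemma monom_val_add: "monom_val N p (\<alpha> + \<beta>) = monom_val N p \<alpha> * monom_val N p \<beta>"
  by (simp add: monom_val_def lookup_add power_add prod.distrib)

lemma monom_val_single:
  assumes "n < N"
  shows "monom_val N p (mono n 1) = p n"
proof -
  have "monom_val N p (mono n 1) = (\<Prod>i<N. if i = n then p n else 1)"
    unfolding monom_val_def by (rule prod.cong) (simp_all add: lookup_single when_def)
  then show ?thesis using assms by simp
qed

lemma monom_val_cut:
  assumes "supp \<alpha> \<subseteq> {..<n}" "n \<le> N"
  shows "monom_val N p \<alpha> = monom_val n p \<alpha>"
  unfolding monom_val_def
proof (rule prod.mono_neutral_right)
  show "\<forall>i\<in>{..<N} - {..<n}. p i ^ coef \<alpha> i = 1"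
  proof
    fix i assume "i \<in> {..<N} - {..<n}"
    then have "i \<notin> supp \<alpha>" using assms(1) by blast
    then show "p i ^ coef \<alpha> i = 1" by (simp add: in_keys_iff)
  qed
qed (use assms(2) in auto)

definition form_val :: "(nat \<Rightarrow> 'a::comm_ring_1) \<Rightarrow> nat \<Rightarrow> nat \<Rightarrow> ((nat \<Rightarrow>\<^sub>0 nat) \<Rightarrow> 'a) \<Rightarrow> 'a" where
  "form_val p n j c = (\<Sum>\<alpha>\<in>form_exps n j. c \<alpha> * monom_val n p \<alpha>)"

lemma form_val_sum: "n \<le> N \<Longrightarrow> form_val p n j c = (\<Sum>\<alpha>\<in>form_exps n j. c \<alpha> * monom_val N p \<alpha>)"
  unfolding form_val_def using form_exps_supp[of _ n j] by (intro sum.cong) (simp_all add: monom_val_cut[of _ n N])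

lemma form_val_simps [simp]:
  "form_val p n 0 c = c 0"
  "form_val p 0 (Suc j) c = 0"
  "form_val p (Suc n) (Suc j) c =
     form_val p n (Suc j) c + p n * form_val p (Suc n) j (\<lambda>\<alpha>. c (\<alpha> + mono n 1))"
proof -
  have disj: "form_exps n (Suc j) \<inter> (\<lambda>\<alpha>. \<alpha> + mono n 1) ` form_exps (Suc n) j = {}"
    using form_exps_supp[of _ n "Suc j"] by (fastforce simp: supp_exponent_add)
  have "(\<Sum>\<alpha>\<in>form_exps (Suc n) (Suc j). c \<alpha> * monom_val (Suc n) p \<alpha>) =
      (\<Sum>\<alpha>\<in>form_exps n (Suc j). c \<alpha> * monom_val (Suc n) p \<alpha>) +
      (\<Sum>\<alpha>\<in>(\<lambda>\<alpha>. \<alpha> + mono n 1) ` form_exps (Suc n) j. c \<alpha> * monom_val (Suc n) p \<alpha>)"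
    unfolding form_exps.simps using disj finite_form_exps by (intro sum.union_disjoint) auto
  also have "(\<Sum>\<alpha>\<in>(\<lambda>\<alpha>. \<alpha> + mono n 1) ` form_exps (Suc n) j. c \<alpha> * monom_val (Suc n) p \<alpha>) =
      (\<Sum>\<alpha>\<in>form_exps (Suc n) j. c (\<alpha> + mono n 1) * (monom_val (Suc n) p \<alpha> * p n))"
    by (subst sum.reindex) (simp_all add: inj_on_def monom_val_add monom_val_single[simplified])
  also have "\<dots> = p n * (\<Sum>\<alpha>\<in>form_exps (Suc n) j. c (\<alpha> + mono n 1) * monom_val (Suc n) p \<alpha>)"
    by (simp add: sum_distrib_left mult_ac)
  finally show "form_val p (Suc n) (Suc j) c =
     form_val p n (Suc j) c + p n * form_val p (Suc n) j (\<lambda>\<alpha>. c (\<alpha> + mono n 1))"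
    unfolding form_val_def[of p "Suc n"] form_val_sum[of n "Suc n", OF le_SucI[OF order_refl]] .
qed (simp_all add: form_val_def monom_val_def)

lemma form_val_cong: "(\<And>\<alpha>. \<alpha> \<in> form_exps n j \<Longrightarrow> c \<alpha> = c' \<alpha>) \<Longrightarrow> form_val p n j c = form_val p n j c'"
  unfolding form_val_def by (rule sum.cong) simp_all

lemma form_val_add: "form_val p n j (\<lambda>\<alpha>. c \<alpha> + c' \<alpha>) = form_val p n j c + form_val p n j c'"
  by (simp add: form_val_def sum.distrib distrib_right)

lemma form_val_scale: "form_val p n j (\<lambda>\<alpha>. a * c \<alpha>) = a * form_val p n j c"
  by (simp add: form_val_def sum_distrib_left mult.assoc)

section \<open>Powers of the ideal of a sequence, and quasi-regularity\<close>

context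
  fixes V :: "'v set" and I :: "('v, 'k::field) mpoly set" and p :: "nat \<Rightarrow> ('v, 'k) mpoly" and N :: nat
  assumes I: "ideal I (mpoly_ring V)" and p: "\<And>i. p i \<in> polys V"
begin

abbreviation "pw \<equiv> power_ideal V I p"

lemma pwI: "x \<in> pw n (Suc j) \<Longrightarrow> y \<in> pw (Suc n) j \<Longrightarrow> x + p n * y \<in> pw (Suc n) (Suc j)"
  by auto

lemma ideal_polys: "ideal (polys V) (mpoly_ring V)"
  by (rule ideal_mpoly_ringI) simp_all

lemma ideal_power_ideal: "ideal (pw n j) (mpoly_ring V)"
proof (induction n j rule: form_exps.induct)
  case (3 n j)
  show ?case
  proof (rule ideal_mpoly_ringI)
    show "pw (Suc n) (Suc j) \<subseteq> polys V"
      using ideal_subset[OF 3(1)] ideal_subset[OF 3(2)] p by auto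
    show "0 \<in> pw (Suc n) (Suc j)" using ideal_0[OF 3(1)] ideal_0[OF 3(2)] by force
    fix a assume "a \<in> pw (Suc n) (Suc j)"
    then obtain x y where xy: "a = x + p n * y" "x \<in> pw n (Suc j)" "y \<in> pw (Suc n) j" by auto
    {
      fix b assume "b \<in> pw (Suc n) (Suc j)"
      then obtain x' y' where xy': "b = x' + p n * y'" "x' \<in> pw n (Suc j)" "y' \<in> pw (Suc n) j" by auto
      have "a + b = (x + x') + p n * (y + y')" using xy xy' by (simp add: algebra_simps)
      then show "a + b \<in> pw (Suc n) (Suc j)"
        using ideal_add[OF 3(1) xy(2) xy'(2)] ideal_add[OF 3(2) xy(3) xy'(3)] by auto
    }
    {
      fix q :: "('v, 'k) mpoly" assume q: "q \<in> polys V"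
      have "q * a = q * x + p n * (q * y)" using xy by (simp add: algebra_simps)
      then show "q * a \<in> pw (Suc n) (Suc j)"
        using ideal_mult[OF 3(1) xy(2) q] ideal_mult[OF 3(2) xy(3) q] by auto
    }
  qed
qed (simp_all add: ideal_polys I)

lemmas pw_subset = ideal_subset[OF ideal_power_ideal]
  and pw_0 = ideal_0[OF ideal_power_ideal]
  and pw_add = ideal_add[OF ideal_power_ideal]
  and pw_diff = ideal_diff[OF ideal_power_ideal]
  and pw_mult = ideal_mult[OF ideal_power_ideal]
  and pw_sum = ideal_sum[OF ideal_power_ideal]

lemma pw_I: "x \<in> I \<Longrightarrow> x \<in> pw n j"
proof (induction n j rule: form_exps.induct)
  case (3 n j)
  show ?case using pwI[OF 3(1)[OF 3(3)] pw_0] by simp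
qed (simp_all add: ideal_subset[OF I])

lemma pw_Suc_n: "x \<in> pw n j \<Longrightarrow> x \<in> pw (Suc n) j"
proof (cases j)
  case (Suc i)
  assume "x \<in> pw n j"
  then show ?thesis using pwI[of x n i 0] pw_0 Suc by simp
qed simp

lemma pw_decr: "x \<in> pw n (Suc j) \<Longrightarrow> x \<in> pw n j"
proof (induction n j arbitrary: x rule: form_exps.induct)
  case (1 n)
  then show ?case using pw_subset by simp
next
  case (3 n j)
  from 3(3) obtain a b where ab: "x = a + p n * b" "a \<in> pw n (Suc (Suc j))" "b \<in> pw (Suc n) (Suc j)" by auto
  show ?case unfolding ab(1) by (rule pwI[OF 3(1)[OF ab(2)] 3(2)[OF ab(3)]])
qed simp

lemma pw_mono: "i \<le> j \<Longrightarrow> x \<in> pw n j \<Longrightarrow> x \<in> pw n i"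
proof (induction j)
  case (Suc j)
  then show ?case using pw_decr[of x n j] by (cases "i = Suc j") auto
qed simp

text \<open>The recursion isolates the last generator, so an earlier one is moved in by an outer
  induction on \<open>n\<close> and an inner one on \<open>j\<close>.\<close>

lemma pw_gen_mult: "i < n \<Longrightarrow> x \<in> pw n j \<Longrightarrow> p i * x \<in> pw n (Suc j)"
proof (induction n arbitrary: x j)
  case (Suc n)
  note IHn = Suc.IH
  show ?case
  proof (cases "i = n")
    case True
    then show ?thesis using pwI[OF pw_0 Suc.prems(2)] by simp
  next
    case False
    then have i: "i < n" using Suc.prems(1) by simp
    show ?thesis using Suc.prems(2)
    proof (induction j arbitrary: x)
      case 0
      then have "p i * x \<in> pw n (Suc 0)" using i by (intro IHn) simp_all
      then show ?case by (rule pw_Suc_n)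
    next
      case (Suc j)
      then obtain a b where ab: "x = a + p n * b" "a \<in> pw n (Suc j)" "b \<in> pw (Suc n) j" by auto
      have eq: "p i * x = p i * a + p n * (p i * b)" using ab by (simp add: algebra_simps)
      show ?case unfolding eq by (rule pwI[OF IHn[OF i ab(2)] Suc.IH[OF ab(3)]])
    qed
  qed
qed simp

lemma pw_monom_mult:
  assumes x: "x \<in> pw N j" and \<alpha>: "supp \<alpha> \<subseteq> {..<N}"
  shows "x * monom_val N p \<alpha> \<in> pw N (j + monom_deg \<alpha>)"
proof -
  have step: "x * p i ^ k \<in> pw N (j + k)" if "i < N" "x \<in> pw N j" for x i j k
  proof (induction k)
    case (Suc k)
    have "p i * (x * p i ^ k) \<in> pw N (Suc (j + k))" using pw_gen_mult[OF that(1) Suc] .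
    then show ?case by (simp add: algebra_simps)
  qed (use that in simp)
  have prod: "n \<le> N \<Longrightarrow> x * (\<Prod>i<n. p i ^ coef \<alpha> i) \<in> pw N (j + (\<Sum>i<n. coef \<alpha> i))" for n :: nat
  proof (induction n)
    case (Suc n)
    then show ?case using step[of n "x * (\<Prod>i<n. p i ^ coef \<alpha> i)" "j + (\<Sum>i<n. coef \<alpha> i)" "coef \<alpha> n"]
      by (simp add: algebra_simps)
  qed (use x in simp)
  show ?thesis using prod[of N] monom_deg_superset[OF _ \<alpha>] by (simp add: monom_val_def)
qed

lemma form_val_in_pw: "(\<And>\<alpha>. c \<alpha> \<in> polys V) \<Longrightarrow> form_val p n j c \<in> pw n j"
proof (induction n j arbitrary: c rule: form_exps.induct)
  case (3 n j)
  have "form_val p n (Suc j) c \<in> pw n (Suc j)" using 3(1,3) by simp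
  moreover have "form_val p (Suc n) j (\<lambda>\<alpha>. c (\<alpha> + mono n 1)) \<in> pw (Suc n) j" using 3(2,3) by simp
  ultimately show ?case unfolding form_val_simps by (rule pwI)
qed (simp_all add: ideal_0[OF I])

text \<open>The ideal belongs to a fixed \<open>M\<close>, because the recursion on the form lowers
  \<open>n\<close> while the coefficients stay in the larger ideal.\<close>

lemma form_val_K:
  "n \<le> M \<Longrightarrow> (\<And>\<alpha>. \<alpha> \<in> form_exps n j \<Longrightarrow> c \<alpha> \<in> pw M (Suc 0)) \<Longrightarrow> form_val p n j c \<in> pw M (Suc j)"
proof (induction n j arbitrary: c rule: form_exps.induct)
  case (2 j)
  then show ?case using pw_0 by simp
next
  case (3 n j)
  have "form_val p n (Suc j) c \<in> pw M (Suc (Suc j))" using 3(3,4) by (intro 3(1)) simp_all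
  moreover have "form_val p (Suc n) j (\<lambda>\<alpha>. c (\<alpha> + mono n 1)) \<in> pw M (Suc j)" using 3(3,4) by (intro 3(2)) simp_all
  then have "p n * form_val p (Suc n) j (\<lambda>\<alpha>. c (\<alpha> + mono n 1)) \<in> pw M (Suc (Suc j))"
    using 3(3) by (intro pw_gen_mult) simp_all
  ultimately show ?case unfolding form_val_simps by (rule pw_add)
qed simp

lemma pw_form_val:
  "x \<in> pw n j \<Longrightarrow> \<exists>c. (\<forall>\<alpha>. c \<alpha> \<in> polys V) \<and> x - form_val p n j c \<in> I"
proof (induction n j arbitrary: x rule: form_exps.induct)
  case (1 n)
  then show ?case using ideal_0[OF I] by (intro exI[of _ "\<lambda>_. x"]) simp
next
  case (2 j)
  then show ?case by (intro exI[of _ "\<lambda>_. 0"]) simp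
next
  case (3 n j)
  from 3(3) obtain a b where ab: "x = a + p n * b" "a \<in> pw n (Suc j)" "b \<in> pw (Suc n) j" by auto
  obtain c where c: "\<forall>\<alpha>. c \<alpha> \<in> polys V" "a - form_val p n (Suc j) c \<in> I" using 3(1)[OF ab(2)] by blast
  obtain c' where c': "\<forall>\<alpha>. c' \<alpha> \<in> polys V" "b - form_val p (Suc n) j c' \<in> I" using 3(2)[OF ab(3)] by blast
  \<comment> \<open>Exponents without variable \<open>n\<close> belong to the first summand, all
    others to the second after removing one factor.\<close>
  define e where "e = (\<lambda>\<alpha>. if coef \<alpha> n = 0 then c \<alpha> else c' (\<alpha> - mono n 1))"
  have "form_val p n (Suc j) e = form_val p n (Suc j) c"
  proof (rule form_val_cong)
    fix \<alpha> assume "\<alpha> \<in> form_exps n (Suc j)"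
    then have "n \<notin> supp \<alpha>" using form_exps_supp by blast
    then show "e \<alpha> = c \<alpha>" by (simp add: e_def in_keys_iff)
  qed
  moreover have "e (\<alpha> + mono n 1) = c' \<alpha>" for \<alpha> by (simp add: e_def lookup_add)
  then have "form_val p (Suc n) j (\<lambda>\<alpha>. e (\<alpha> + mono n 1)) = form_val p (Suc n) j c'"
    by (intro form_val_cong) simp
  ultimately have "x - form_val p (Suc n) (Suc j) e =
      (a - form_val p n (Suc j) c) + p n * (b - form_val p (Suc n) j c')"
    using ab(1) by (simp add: algebra_simps)
  also have "\<dots> \<in> I" using c(2) c'(2) p by (intro ideal_add[OF I] ideal_mult[OF I])
  finally have "x - form_val p (Suc n) (Suc j) e \<in> I" .
  moreover have "\<forall>\<alpha>. e \<alpha> \<in> polys V" using c(1) c'(1) by (simp add: e_def)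
  ultimately show ?case by blast
qed

text \<open>In other words, the associated graded ring of the filtration \<open>pw n\<close> is a
  polynomial ring over the quotient by \<open>pw n (Suc 0)\<close>.\<close>

definition quasi_regular :: "nat \<Rightarrow> bool" where
  "quasi_regular n \<longleftrightarrow> (\<forall>j c. (\<forall>\<alpha>. c \<alpha> \<in> polys V) \<and> form_val p n j c \<in> pw n (Suc j) \<longrightarrow>
     (\<forall>\<alpha>\<in>form_exps n j. c \<alpha> \<in> pw n (Suc 0)))"

lemma quasi_regularD:
  "quasi_regular n \<Longrightarrow> (\<And>\<alpha>. c \<alpha> \<in> polys V) \<Longrightarrow> form_val p n j c \<in> pw n (Suc j) \<Longrightarrow>
    \<alpha> \<in> form_exps n j \<Longrightarrow> c \<alpha> \<in> pw n (Suc 0)"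
  unfolding quasi_regular_def by blast

text \<open>An element regular modulo the first power stays regular modulo all powers: it acts on
  the coefficients of initial forms, and these live modulo the first power.\<close>

lemma quasi_regular_cancel:
  assumes qr: "quasi_regular n"
    and reg: "\<And>x. x \<in> polys V \<Longrightarrow> p n * x \<in> pw n (Suc 0) \<Longrightarrow> x \<in> pw n (Suc 0)"
    and x: "x \<in> polys V"
  shows "p n * x \<in> pw n j \<Longrightarrow> x \<in> pw n j"
proof (induction j)
  case (Suc j)
  have "x \<in> pw n j" using Suc.IH pw_decr Suc.prems by blast
  then obtain c where c: "\<forall>\<alpha>. c \<alpha> \<in> polys V" "x - form_val p n j c \<in> I" using pw_form_val by blast
  have "form_val p n j (\<lambda>\<alpha>. p n * c \<alpha>) = p n * x - p n * (x - form_val p n j c)"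
    unfolding form_val_scale by (simp add: algebra_simps)
  also have "\<dots> \<in> pw n (Suc j)"
    using Suc.prems pw_I[OF ideal_mult[OF I c(2) p]] by (intro pw_diff)
  finally have "p n * c \<alpha> \<in> pw n (Suc 0)" if "\<alpha> \<in> form_exps n j" for \<alpha>
    using quasi_regularD[OF qr, of "\<lambda>\<alpha>. p n * c \<alpha>" j \<alpha>] c(1) p that by simp
  then have "form_val p n j c \<in> pw n (Suc j)" using reg c(1) by (intro form_val_K) simp_all
  then have "form_val p n j c + (x - form_val p n j c) \<in> pw n (Suc j)" using pw_I[OF c(2)] by (intro pw_add)
  then show ?case by simp
qed (use x in simp)

text \<open>Split the form as \<open>g + p n * h\<close> with \<open>g\<close> free of the new
  variable. Cancelling \<open>p n\<close> shows that \<open>h\<close> lies one power higher, so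
  induction on the degree handles its coefficients. Writing \<open>h - b\<close> as a form
  \<open>e\<close> in the old variables corrects \<open>g\<close> to \<open>g + p n * e\<close>, to
  which quasi-regularity for \<open>n\<close> applies.\<close>

lemma quasi_regular_Suc:
  assumes qr: "quasi_regular n"
    and reg: "\<And>x. x \<in> polys V \<Longrightarrow> p n * x \<in> pw n (Suc 0) \<Longrightarrow> x \<in> pw n (Suc 0)"
  shows "quasi_regular (Suc n)"
proof -
  have "\<forall>\<alpha>\<in>form_exps (Suc n) j. c \<alpha> \<in> pw (Suc n) (Suc 0)"
    if "\<And>\<alpha>. c \<alpha> \<in> polys V" "form_val p (Suc n) j c \<in> pw (Suc n) (Suc j)" for j c
    using that
  proof (induction j arbitrary: c)
    case 0
    then show ?case by simp
  next
    case (Suc j)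
    define g where "g = form_val p n (Suc j) c"
    define c' where "c' = (\<lambda>\<alpha>. c (\<alpha> + mono n 1))"
    define h where "h = form_val p (Suc n) j c'"
    have c': "c' \<alpha> \<in> polys V" for \<alpha> using Suc.prems(1) by (simp add: c'_def)
    have g: "g \<in> pw n (Suc j)" unfolding g_def by (rule form_val_in_pw) (rule Suc.prems(1))
    have h: "h \<in> polys V" unfolding h_def by (rule pw_subset[OF form_val_in_pw[OF c']])
    obtain a b where ab: "g + p n * h = a + p n * b" "a \<in> pw n (Suc (Suc j))" "b \<in> pw (Suc n) (Suc j)"
      using Suc.prems(2) by (auto simp: g_def h_def c'_def)
    have "p n * (h - b) = a - g" using ab(1) by (simp add: algebra_simps)
    also have "a - g \<in> pw n (Suc j)" using pw_decr[OF ab(2)] g by (rule pw_diff)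
    finally have "p n * (h - b) \<in> pw n (Suc j)" .
    moreover have "h - b \<in> polys V" using h pw_subset[OF ab(3)] by simp
    ultimately have hb: "h - b \<in> pw n (Suc j)" using quasi_regular_cancel[OF qr reg] by metis
    have "(h - b) + b \<in> pw (Suc n) (Suc j)" using pw_Suc_n[OF hb] ab(3) by (rule pw_add)
    then have "form_val p (Suc n) j c' \<in> pw (Suc n) (Suc j)" by (simp add: h_def)
    then have 1: "\<forall>\<alpha>\<in>form_exps (Suc n) j. c' \<alpha> \<in> pw (Suc n) (Suc 0)" by (rule Suc.IH[OF c'])
    obtain e where e: "\<forall>\<alpha>. e \<alpha> \<in> polys V" "(h - b) - form_val p n (Suc j) e \<in> I"
      using pw_form_val[OF hb] by blast
    have "form_val p n (Suc j) (\<lambda>\<alpha>. c \<alpha> + p n * e \<alpha>) = g + p n * form_val p n (Suc j) e"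
      by (simp add: form_val_add form_val_scale g_def)
    also have "\<dots> = a - p n * ((h - b) - form_val p n (Suc j) e)" using ab(1) by (simp add: algebra_simps)
    also have "\<dots> \<in> pw n (Suc (Suc j))"
      using ab(2) pw_I[OF ideal_mult[OF I e(2) p]] by (rule pw_diff)
    finally have 2: "c \<alpha> + p n * e \<alpha> \<in> pw n (Suc 0)" if "\<alpha> \<in> form_exps n (Suc j)" for \<alpha>
      using quasi_regularD[OF qr, of "\<lambda>\<alpha>. c \<alpha> + p n * e \<alpha>" "Suc j" \<alpha>] Suc.prems(1) e(1) p that by simp
    have "c \<alpha> \<in> pw (Suc n) (Suc 0)" if "\<alpha> \<in> form_exps n (Suc j)" for \<alpha>
    proof -
      have "c \<alpha> = (c \<alpha> + p n * e \<alpha>) + p n * (- e \<alpha>)" by simp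
      moreover have "- e \<alpha> \<in> pw (Suc n) 0" using e(1) by simp
      ultimately show ?thesis using pwI[OF 2[OF that], of "- e \<alpha>"] by simp
    qed
    then show ?case using 1 by (auto simp: c'_def)
  qed
  then show ?thesis unfolding quasi_regular_def by blast
qed

lemma quasi_regular_of_regular:
  assumes "\<And>n x. n < N \<Longrightarrow> x \<in> polys V \<Longrightarrow> p n * x \<in> pw n (Suc 0) \<Longrightarrow> x \<in> pw n (Suc 0)"
  shows "n \<le> N \<Longrightarrow> quasi_regular n"
proof (induction n)
  case 0
  have "\<forall>\<alpha>\<in>form_exps 0 j. c \<alpha> \<in> pw 0 (Suc 0)" if "form_val p 0 j c \<in> pw 0 (Suc j)" for j c
    using that by (cases j) simp_all
  then show ?case unfolding quasi_regular_def by blast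
next
  case (Suc n)
  then show ?case using assms by (intro quasi_regular_Suc) simp_all
qed

text \<open>Compare the products of the largest exponents in the initial forms of \<open>f\<close> and of the
  polynomial relation.\<close>

lemma quasi_regular_relation:
  assumes qr: "quasi_regular N" and f: "f \<in> pw N j" "f \<notin> pw N (Suc j)"
    and A: "finite A" "\<And>\<alpha>. \<alpha> \<in> A \<Longrightarrow> supp \<alpha> \<subseteq> {..<N}" and nz: "\<exists>\<alpha>\<in>A. \<gamma> \<alpha> \<noteq> 0"
  shows "f * (\<Sum>\<alpha>\<in>A. mono 0 (\<gamma> \<alpha>) * monom_val N p \<alpha>) \<notin> I"
proof
  assume rel: "f * (\<Sum>\<alpha>\<in>A. mono 0 (\<gamma> \<alpha>) * monom_val N p \<alpha>) \<in> I"
  define B where "B = {\<alpha> \<in> A. \<gamma> \<alpha> \<noteq> 0}"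
  have B: "finite B" "B \<noteq> {}" using A nz by (auto simp: B_def)
  \<comment> \<open>The lowest degree of the relation. Its terms of higher degree, multiplied by
    \<open>f\<close>, lie in the power \<open>Suc (j + e)\<close>, so the lowest part does
    too.\<close>
  define e where "e = Min (monom_deg ` B)"
  have e_le: "e \<le> monom_deg \<alpha>" if "\<alpha> \<in> B" for \<alpha> using that B by (simp add: e_def)
  define Be where "Be = {\<alpha> \<in> B. monom_deg \<alpha> = e}"
  have "e \<in> monom_deg ` B" unfolding e_def using B by (intro Min_in) simp_all
  then have Be: "finite Be" "Be \<noteq> {}" using B by (auto simp: Be_def)
  have fS: "f \<in> polys V" by (rule pw_subset[OF f(1)])
  obtain x where x: "\<forall>\<beta>. x \<beta> \<in> polys V" "f - form_val p N j x \<in> I" using pw_form_val[OF f(1)] by blast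
  have mvS: "monom_val N p \<alpha> \<in> polys V" for \<alpha> unfolding monom_val_def using p by (intro polys_prod polys_power)
  let ?t = "\<lambda>\<alpha>. mono 0 (\<gamma> \<alpha>) * monom_val N p \<alpha>"
  have "(\<Sum>\<alpha>\<in>A. f * ?t \<alpha>) = (\<Sum>\<alpha>\<in>B. f * ?t \<alpha>)"
    using A by (intro sum.mono_neutral_right) (auto simp: B_def)
  also have "\<dots> = (\<Sum>\<alpha>\<in>Be. f * ?t \<alpha>) + (\<Sum>\<alpha>\<in>B - Be. f * ?t \<alpha>)"
    using B by (subst sum.subset_diff[of Be]) (auto simp: Be_def add.commute)
  finally have split: "(\<Sum>\<alpha>\<in>Be. f * ?t \<alpha>) = f * (\<Sum>\<alpha>\<in>A. ?t \<alpha>) - (\<Sum>\<alpha>\<in>B - Be. f * ?t \<alpha>)"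
    by (simp add: sum_distrib_left)
  have high: "f * ?t \<alpha> \<in> pw N (Suc (j + e))" if "\<alpha> \<in> B - Be" for \<alpha>
  proof -
    have "f * monom_val N p \<alpha> \<in> pw N (j + monom_deg \<alpha>)"
      using that A(2) by (intro pw_monom_mult[OF f(1)]) (simp add: B_def)
    moreover have "Suc (j + e) \<le> j + monom_deg \<alpha>" using that e_le[of \<alpha>] by (auto simp: Be_def)
    ultimately have "f * monom_val N p \<alpha> \<in> pw N (Suc (j + e))" by (rule pw_mono[rotated])
    then have "mono 0 (\<gamma> \<alpha>) * (f * monom_val N p \<alpha>) \<in> pw N (Suc (j + e))" by (rule pw_mult) simp
    then show ?thesis by (simp add: mult.left_commute)
  qed
  have low: "(\<Sum>\<alpha>\<in>Be. f * ?t \<alpha>) \<in> pw N (Suc (j + e))"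
    unfolding split by (rule pw_diff[OF pw_I[OF rel] pw_sum[OF high]])
  \<comment> \<open>The coefficients of the form for \<open>f\<close> multiplied by the monomial
    \<open>\<alpha>\<close>, with 0 wherever \<open>\<alpha>\<close> does not divide.\<close>
  define sh where "sh = (\<lambda>\<alpha> \<beta>. if \<exists>\<delta>. \<beta> = \<alpha> + \<delta> then x (\<beta> - \<alpha>) else 0)"
  define y where "y = (\<lambda>\<beta>. \<Sum>\<alpha>\<in>Be. mono 0 (\<gamma> \<alpha>) * sh \<alpha> \<beta>)"
  have sh_add: "sh \<alpha> (\<alpha> + \<beta>) = x \<beta>" for \<alpha> \<beta> by (auto simp: sh_def)
  have shS: "sh \<alpha> \<beta> \<in> polys V" for \<alpha> \<beta> using x(1) by (simp add: sh_def)
  have yS: "y \<beta> \<in> polys V" for \<beta> unfolding y_def using shS by (intro polys_sum polys_mult polys_const)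
  have shift: "form_val p N (j + e) (sh \<alpha>) = monom_val N p \<alpha> * form_val p N j x" if \<alpha>: "\<alpha> \<in> Be" for \<alpha>
  proof -
    have \<alpha>': "supp \<alpha> \<subseteq> {..<N}" "monom_deg \<alpha> = e" using \<alpha> A(2) by (auto simp: Be_def B_def)
    have "(\<Sum>\<beta>\<in>form_exps N (j + e). sh \<alpha> \<beta> * monom_val N p \<beta>) =
        (\<Sum>\<beta>\<in>(\<lambda>\<beta>. \<alpha> + \<beta>) ` form_exps N j. sh \<alpha> \<beta> * monom_val N p \<beta>)"
    proof (rule sum.mono_neutral_right)
      show "(\<lambda>\<beta>. \<alpha> + \<beta>) ` form_exps N j \<subseteq> form_exps N (j + e)"
        using \<alpha>' by (auto simp: form_exps_iff supp_exponent_add monom_deg_add)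
      show "\<forall>\<beta>\<in>form_exps N (j + e) - (\<lambda>\<beta>. \<alpha> + \<beta>) ` form_exps N j. sh \<alpha> \<beta> * monom_val N p \<beta> = 0"
      proof
        fix \<beta> assume \<beta>: "\<beta> \<in> form_exps N (j + e) - (\<lambda>\<beta>. \<alpha> + \<beta>) ` form_exps N j"
        have "\<beta> \<noteq> \<alpha> + \<delta>" for \<delta>
        proof
          assume eq: "\<beta> = \<alpha> + \<delta>"
          then have "\<delta> \<in> form_exps N j" using \<beta> \<alpha>' by (auto simp: form_exps_iff supp_exponent_add monom_deg_add)
          then show False using \<beta> eq by blast
        qed
        then show "sh \<alpha> \<beta> * monom_val N p \<beta> = 0" by (simp add: sh_def)
      qed
    qed (rule finite_form_exps)
    also have "\<dots> = (\<Sum>\<beta>\<in>form_exps N j. x \<beta> * (monom_val N p \<alpha> * monom_val N p \<beta>))"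
      by (subst sum.reindex) (simp_all add: sh_add monom_val_add)
    also have "\<dots> = monom_val N p \<alpha> * (\<Sum>\<beta>\<in>form_exps N j. x \<beta> * monom_val N p \<beta>)"
      by (simp add: sum_distrib_left mult_ac)
    finally show ?thesis by (simp add: form_val_sum[of N N])
  qed
  have "form_val p N (j + e) y = (\<Sum>\<alpha>\<in>Be. mono 0 (\<gamma> \<alpha>) * form_val p N (j + e) (sh \<alpha>))"
    unfolding y_def form_val_sum[OF order_refl] sum_distrib_left sum_distrib_right
    by (subst sum.swap) (simp add: mult.assoc)
  also have "\<dots> = (\<Sum>\<alpha>\<in>Be. ?t \<alpha> * form_val p N j x)" by (simp add: shift mult.assoc)
  also have "\<dots> = (\<Sum>\<alpha>\<in>Be. f * ?t \<alpha>) - (\<Sum>\<alpha>\<in>Be. ?t \<alpha> * (f - form_val p N j x))"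
    unfolding sum_subtractf[symmetric] by (rule sum.cong) (simp_all add: algebra_simps)
  also have "\<dots> \<in> pw N (Suc (j + e))"
  proof (rule pw_diff[OF low pw_sum])
    fix \<alpha>
    show "?t \<alpha> * (f - form_val p N j x) \<in> pw N (Suc (j + e))"
      by (rule pw_I[OF ideal_mult[OF I x(2)]]) (simp add: mvS)
  qed
  finally have y: "y \<beta> \<in> pw N (Suc 0)" if "\<beta> \<in> form_exps N (j + e)" for \<beta>
    using quasi_regularD[OF qr, of y "j + e" \<beta>] yS that by blast
  \<comment> \<open>The exponents that really occur in the initial form of \<open>f\<close>, that
    is, with a coefficient nonzero modulo the first power.\<close>
  define X where "X = {\<beta> \<in> form_exps N j. x \<beta> \<notin> pw N (Suc 0)}"
  have "X \<noteq> {}"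
  proof
    assume "X = {}"
    then have "form_val p N j x \<in> pw N (Suc j)" by (intro form_val_K) (auto simp: X_def)
    then have "form_val p N j x + (f - form_val p N j x) \<in> pw N (Suc j)" using pw_I[OF x(2)] by (rule pw_add)
    then show False using f(2) by simp
  qed
  then have X: "finite X" "X \<noteq> {}" using finite_form_exps by (auto simp: X_def)
  \<comment> \<open>\<open>Max\<close> refers to the linear order on exponent vectors, which is
    compatible with addition.\<close>
  define \<alpha>0 where "\<alpha>0 = Max Be"
  define \<beta>0 where "\<beta>0 = Max X"
  have \<alpha>0: "\<alpha>0 \<in> Be" "\<And>\<alpha>. \<alpha> \<in> Be \<Longrightarrow> \<alpha> \<le> \<alpha>0" using Be by (simp_all add: \<alpha>0_def)
  have \<beta>0: "\<beta>0 \<in> X" "\<And>\<beta>. \<beta> \<in> X \<Longrightarrow> \<beta> \<le> \<beta>0" using X by (simp_all add: \<beta>0_def)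
  have "supp \<alpha> \<subseteq> {..<N} \<and> monom_deg \<alpha> = e" if "\<alpha> \<in> Be" for \<alpha>
    using that A(2) by (auto simp: Be_def B_def)
  note Be_supp = this
  have \<beta>0': "supp \<beta>0 \<subseteq> {..<N}" "monom_deg \<beta>0 = j" using \<beta>0(1) by (auto simp: X_def form_exps_iff)
  have "\<alpha>0 + \<beta>0 \<in> form_exps N (j + e)"
    using Be_supp[OF \<alpha>0(1)] \<beta>0' by (simp add: form_exps_iff supp_exponent_add monom_deg_add)
  then have y0: "y (\<alpha>0 + \<beta>0) \<in> pw N (Suc 0)" by (rule y)
  have other: "mono 0 (\<gamma> \<alpha>) * sh \<alpha> (\<alpha>0 + \<beta>0) \<in> pw N (Suc 0)" if \<alpha>: "\<alpha> \<in> Be - {\<alpha>0}" for \<alpha>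
  proof (cases "\<exists>\<delta>. \<alpha>0 + \<beta>0 = \<alpha> + \<delta>")
    case False
    then show ?thesis using pw_0 by (simp add: sh_def)
  next
    case True
    then obtain \<delta> where \<delta>: "\<alpha>0 + \<beta>0 = \<alpha> + \<delta>" by blast
    have "\<alpha> < \<alpha>0" using \<alpha> \<alpha>0(2)[of \<alpha>] by auto
    \<comment> \<open>A smaller first factor forces a larger second one, beyond the maximum of
      \<open>X\<close>.\<close>
    then have "\<not> \<delta> \<le> \<beta>0" using \<delta> add_less_le_mono[of \<alpha> \<alpha>0 \<delta> \<beta>0] by auto
    then have "\<delta> \<notin> X" using \<beta>0(2) by blast
    moreover have "supp \<delta> \<subseteq> {..<N}"
      using arg_cong[OF \<delta>, of supp] Be_supp[OF \<alpha>0(1)] \<beta>0' by (auto simp: supp_exponent_add)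
    moreover have "monom_deg \<delta> = j"
      using arg_cong[OF \<delta>, of monom_deg] Be_supp[OF \<alpha>0(1)] Be_supp[of \<alpha>] \<alpha> \<beta>0' by (simp add: monom_deg_add)
    ultimately have "x \<delta> \<in> pw N (Suc 0)" by (simp add: X_def form_exps_iff)
    then show ?thesis unfolding \<delta> sh_add by (rule pw_mult) simp
  qed
  have "y (\<alpha>0 + \<beta>0) = mono 0 (\<gamma> \<alpha>0) * x \<beta>0 + (\<Sum>\<alpha>\<in>Be - {\<alpha>0}. mono 0 (\<gamma> \<alpha>) * sh \<alpha> (\<alpha>0 + \<beta>0))"
    unfolding y_def using Be(1) \<alpha>0(1) by (simp add: sum.remove sh_add)
  then have "mono 0 (\<gamma> \<alpha>0) * x \<beta>0 = y (\<alpha>0 + \<beta>0) - (\<Sum>\<alpha>\<in>Be - {\<alpha>0}. mono 0 (\<gamma> \<alpha>) * sh \<alpha> (\<alpha>0 + \<beta>0))"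
    by simp
  also have "\<dots> \<in> pw N (Suc 0)" by (rule pw_diff[OF y0 pw_sum[OF other]])
  finally have "mono 0 (1 / \<gamma> \<alpha>0) * (mono 0 (\<gamma> \<alpha>0) * x \<beta>0) \<in> pw N (Suc 0)" by (rule pw_mult) simp
  moreover have "mono 0 (1 / \<gamma> \<alpha>0) * mono 0 (\<gamma> \<alpha>0) = (1 :: ('v, 'k) mpoly)"
    using \<alpha>0(1) by (simp add: mult_single Be_def B_def)
  ultimately have "x \<beta>0 \<in> pw N (Suc 0)" by (simp flip: mult.assoc)
  then show False using \<beta>0(1) by (simp add: X_def)
qed

end

section \<open>Quotient rings\<close>

context
  fixes V :: "'v set" and I :: "('v, 'k::field) mpoly set"
  assumes I: "ideal I (mpoly_ring V)"
begin

abbreviation quot :: "('v, 'k) mpoly set ring" where "quot \<equiv> mpoly_ring V Quot I"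
abbreviation coset :: "('v, 'k) mpoly \<Rightarrow> ('v, 'k) mpoly set" where "coset p \<equiv> I +>\<^bsub>mpoly_ring V\<^esub> p"

lemma coset_hom: "coset \<in> ring_hom (mpoly_ring V) quot"
  by (rule ideal.rcos_ring_hom[OF I])

lemma coset_carrier: "carrier quot = coset ` polys V"
  unfolding FactRing_simps by auto

lemma coset_mult: "p \<in> polys V \<Longrightarrow> q \<in> polys V \<Longrightarrow> coset p \<otimes>\<^bsub>quot\<^esub> coset q = coset (p * q)"
  using ring_hom_mult[OF coset_hom, of p q] by simp

lemma coset_add: "p \<in> polys V \<Longrightarrow> q \<in> polys V \<Longrightarrow> coset p \<oplus>\<^bsub>quot\<^esub> coset q = coset (p + q)"
  using ring_hom_add[OF coset_hom, of p q] by simp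

lemma coset_eq_iff:
  assumes "p \<in> polys V" "q \<in> polys V"
  shows "coset p = coset q \<longleftrightarrow> p - q \<in> I"
proof -
  interpret ring "mpoly_ring V" by (rule ring_mpoly_ring)
  have "p \<ominus>\<^bsub>mpoly_ring V\<^esub> q = p - q" using assms by (simp add: a_minus_def a_inv_mpoly_ring)
  then show ?thesis using quotient_eq_iff_same_a_r_cos[OF I, of p q] assms by simp
qed

lemma ring_quot: "ring quot"
  by (rule ideal.quotient_is_ring[OF I])

lemma cring_quot: "cring quot"
  by (rule ideal.quotient_is_cring[OF I cring_mpoly_ring])

lemma ideal_coset_image: "ideal L (mpoly_ring V) \<Longrightarrow> ideal (coset ` L) quot"
  by (rule ring.ring_ideal_imp_quot_ideal[OF ring_mpoly_ring I])

lemma coset_image_iff: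
  assumes L: "ideal L (mpoly_ring V)" "I \<subseteq> L" and p: "p \<in> polys V"
  shows "coset p \<in> coset ` L \<longleftrightarrow> p \<in> L"
proof
  assume "coset p \<in> coset ` L"
  then obtain q where q: "q \<in> L" "coset p = coset q" by blast
  then have "p - q \<in> L" using coset_eq_iff[of p q] p ideal_subset[OF L(1)] L(2) by blast
  then have "(p - q) + q \<in> L" using q(1) by (rule ideal_add[OF L(1)])
  then show "p \<in> L" by simp
qed blast

section \<open>The Krull dimension of a monomial quotient\<close>

lemma primeideal_coset_image:
  assumes L: "ideal L (mpoly_ring V)" "I \<subseteq> L" "1 \<notin> L"
    and prime: "\<And>p q. p \<in> polys V \<Longrightarrow> q \<in> polys V \<Longrightarrow> p * q \<in> L \<Longrightarrow> p \<in> L \<or> q \<in> L"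
  shows "primeideal (coset ` L) quot"
proof (rule primeidealI[OF ideal_coset_image[OF L(1)] cring_quot])
  show "carrier quot \<noteq> coset ` L"
  proof
    assume "carrier quot = coset ` L"
    moreover have "coset 1 \<in> carrier quot" unfolding coset_carrier by simp
    ultimately show False using coset_image_iff[OF L(1,2), of 1] L(3) by simp
  qed
  fix a b assume ab: "a \<in> carrier quot" "b \<in> carrier quot" "a \<otimes>\<^bsub>quot\<^esub> b \<in> coset ` L"
  obtain p where p: "a = coset p" "p \<in> polys V" using ab(1) unfolding coset_carrier by (rule imageE)
  obtain q where q: "b = coset q" "q \<in> polys V" using ab(2) unfolding coset_carrier by (rule imageE)
  have "coset (p * q) \<in> coset ` L" using ab(3) p q by (simp add: coset_mult)
  then have "p * q \<in> L" using coset_image_iff[OF L(1,2)] p q by simp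
  then have "p \<in> L \<or> q \<in> L" by (rule prime[OF p(2) q(2)])
  then show "a \<in> coset ` L \<or> b \<in> coset ` L" unfolding p(1) q(1) by blast
qed

text \<open>Ideals above \<open>I\<close> are recovered from their images, so strict inclusions and
  primality survive in the quotient.\<close>

lemma krull_dim_ge:
  assumes L: "\<And>i. i \<le> n \<Longrightarrow> ideal (L i) (mpoly_ring V)" "\<And>i. i \<le> n \<Longrightarrow> I \<subseteq> L i"
    "\<And>i. i \<le> n \<Longrightarrow> 1 \<notin> L i"
    and prime: "\<And>i p q. i \<le> n \<Longrightarrow> p \<in> polys V \<Longrightarrow> q \<in> polys V \<Longrightarrow> p * q \<in> L i \<Longrightarrow> p \<in> L i \<or> q \<in> L i"
    and chain: "\<And>i. i < n \<Longrightarrow> L i \<subset> L (Suc i)"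
  shows "enat n \<le> krull_dim quot"
proof -
  have "primeideal (coset ` L i) quot" if "i \<le> n" for i
    by (rule primeideal_coset_image[OF L(1)[OF that] L(2)[OF that] L(3)[OF that] prime[OF that]])
  moreover have "coset ` L i \<subset> coset ` L (Suc i)" if i: "i < n" for i
  proof
    show "coset ` L i \<subseteq> coset ` L (Suc i)" using chain[OF i] by blast
    obtain p where p: "p \<in> L (Suc i)" "p \<notin> L i" using chain[OF i] by blast
    have le: "i \<le> n" and le': "Suc i \<le> n" using i by simp_all
    have "p \<in> polys V" by (rule ideal_subset[OF L(1)[OF le'] p(1)])
    then have "coset p \<notin> coset ` L i" using coset_image_iff[OF L(1)[OF le] L(2)[OF le]] p(2) by blast
    then show "coset ` L i \<noteq> coset ` L (Suc i)" using p(1) by blast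
  qed
  ultimately have "\<exists>P. (\<forall>i\<le>n. primeideal (P i) quot) \<and> (\<forall>i<n. P i \<subset> P (Suc i))"
    by (intro exI[of _ "\<lambda>i. coset ` L i"]) blast
  then show ?thesis unfolding krull_dim_def by (intro Sup_upper) blast
qed

section \<open>Regular sequences in the quotient\<close>

text \<open>Moves regularity from cosets to polynomials: the ideal generated by the first
  \<open>n\<close> cosets is the image of the first power, as shown by the inclusions
  \<open>upper\<close> and \<open>lower\<close>.\<close>

lemma regular_sequence_lift:
  assumes reg: "regular_sequence quot as" and as: "set as \<subseteq> coset ` irrelevant_ideal V"
  obtains p where "\<And>i. p i \<in> irrelevant_ideal V"
    "\<And>n x. n < length as \<Longrightarrow> x \<in> polys V \<Longrightarrow> p n * x \<in> power_ideal V I p n (Suc 0) \<Longrightarrow>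
      x \<in> power_ideal V I p n (Suc 0)"
proof -
  have "\<exists>q. q \<in> irrelevant_ideal V \<and> as ! i = coset q" if "i < length as" for i
    using as nth_mem[OF that] by blast
  then obtain p' where p': "\<And>i. i < length as \<Longrightarrow> p' i \<in> irrelevant_ideal V \<and> as ! i = coset (p' i)" by metis
  \<comment> \<open>The default 0 lies in the irrelevant ideal, so membership holds for every
    index.\<close>
  define p where "p = (\<lambda>i. if i < length as then p' i else 0)"
  have p: "p i \<in> irrelevant_ideal V" for i
    by (cases "i < length as") (simp_all add: p_def p' ideal_0[OF ideal_irrelevant])
  have as_p: "as ! i = coset (p i)" if "i < length as" for i using p'[OF that] that by (simp add: p_def)
  have pV: "p i \<in> polys V" for i by (rule ideal_subset[OF ideal_irrelevant p])
  note idl = ideal_power_ideal[OF I, of p, OF pV] and sub = pw_I[OF I, of p, OF pV]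
  let ?K = "\<lambda>n. power_ideal V I p n (Suc 0)"
  interpret Q: ring quot by (rule ring_quot)
  have p_in: "p i \<in> ?K n" if "i < n" for i n
    using pw_gen_mult[OF I pV that, where x = 1 and j = 0] by simp
  have take_carrier: "set (take n as) \<subseteq> carrier quot" for n
    using reg set_take_subset[of n as] by (auto simp: regular_sequence_def)
  have upper: "Idl\<^bsub>quot\<^esub> (set (take n as)) \<subseteq> coset ` ?K n" if "n \<le> length as" for n
  proof (rule Q.genideal_minimal[OF ideal_coset_image[OF idl]])
    show "set (take n as) \<subseteq> coset ` ?K n"
    proof
      fix a assume "a \<in> set (take n as)"
      then obtain i where "i < n" "a = as ! i" using that by (auto simp: in_set_conv_nth)
      then show "a \<in> coset ` ?K n" using as_p[of i] p_in[of i n] that by simp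
    qed
  qed
  have lower: "coset x \<in> L" if L: "ideal L quot" "set (take n as) \<subseteq> L" "n \<le> length as" and x: "x \<in> ?K n" for L n x
    using L(2,3) x
  proof (induction n arbitrary: x)
    case 0
    then have "x \<in> I" by simp
    then have "coset x = coset 0" using coset_eq_iff[of x 0] ideal_subset[OF I] by simp
    also have "coset 0 = \<zero>\<^bsub>quot\<^esub>"
      using ring_hom_zero[OF coset_hom ring_mpoly_ring ring_quot] by simp
    finally show ?case using additive_subgroup.zero_closed[OF ideal.axioms(1)[OF L(1)]] by simp
  next
    case (Suc n)
    obtain a b where ab: "x = a + p n * b" "a \<in> ?K n" "b \<in> polys V" using Suc.prems(3) by auto
    have n: "n < length as" using Suc.prems(2) by simp
    have tk: "take (Suc n) as = take n as @ [as ! n]" by (rule take_Suc_conv_app_nth[OF n])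
    have "coset a \<in> L" using Suc.prems(1,2) ab(2) tk by (intro Suc.IH) simp_all
    moreover have "coset (p n) \<in> L" using Suc.prems(1) tk as_p[OF n] by simp
    then have "coset (p n) \<otimes>\<^bsub>quot\<^esub> coset b \<in> L"
      using ab(3) coset_carrier by (intro ideal.I_r_closed[OF L(1)]) auto
    then have "coset (p n * b) \<in> L" using ab(3) pV by (simp add: coset_mult)
    ultimately have "coset a \<oplus>\<^bsub>quot\<^esub> coset (p n * b) \<in> L"
      by (rule additive_subgroup.a_closed[OF ideal.axioms(1)[OF L(1)]])
    then show ?case using ab ideal_subset[OF idl ab(2)] pV by (simp add: coset_add)
  qed
  show thesis
  proof (rule that[of p])
    fix n x assume n: "n < length as" and x: "x \<in> polys V" "p n * x \<in> ?K n"
    have "coset (p n * x) \<in> Idl\<^bsub>quot\<^esub> (set (take n as))"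
      by (rule lower[OF Q.genideal_ideal[OF take_carrier] Q.genideal_self[OF take_carrier] _ x(2)]) (use n in simp)
    then have "as ! n \<otimes>\<^bsub>quot\<^esub> coset x \<in> Idl\<^bsub>quot\<^esub> (set (take n as))"
      using as_p[OF n] x(1) pV by (simp add: coset_mult)
    moreover have "coset x \<in> carrier quot" using x(1) unfolding coset_carrier by blast
    ultimately have "coset x \<in> Idl\<^bsub>quot\<^esub> (set (take n as))"
      using reg n unfolding regular_sequence_def by blast
    then have "coset x \<in> coset ` ?K n" by (rule subsetD[OF upper[OF less_imp_le[OF n]]])
    moreover have "I \<subseteq> ?K n" by (rule subsetI) (rule sub)
    ultimately show "x \<in> ?K n" using coset_image_iff[OF idl _ x(1)] by simp
  qed (rule p)
qed

end

section \<open>Monomial prime ideals\<close>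

text \<open>The prime generated by the variables in \<open>X\<close>, for
  \<open>X \<subseteq> V\<close>, described by terms so that membership can be tested coefficient by
  coefficient.\<close>

definition face_ideal :: "'v set \<Rightarrow> 'v set \<Rightarrow> ('v, 'k::field) mpoly set" where
  "face_ideal V X = {p \<in> polys V. \<forall>t\<in>supp p. supp t \<inter> X \<noteq> {}}"

lemma ideal_face_ideal: "ideal (face_ideal V X) (mpoly_ring V)"
proof (rule ideal_mpoly_ringI)
  show "p + q \<in> face_ideal V X" if "p \<in> face_ideal V X" "q \<in> face_ideal V X" for p q :: "('a, 'b) mpoly"
    using that keys_add[of p q] by (auto simp: face_ideal_def)
  show "q * p \<in> face_ideal V X" if p: "p \<in> face_ideal V X" and q: "q \<in> polys V" for p q :: "('a, 'b) mpoly"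
  proof -
    have "supp u \<inter> X \<noteq> {}" if u: "u \<in> supp (q * p)" for u
    proof -
      obtain s t where "s \<in> supp q" "t \<in> supp p" "u = s + t" using u by (rule supp_mult)
      then show ?thesis using p by (auto simp: face_ideal_def supp_exponent_add)
    qed
    then show ?thesis using p q by (simp add: face_ideal_def)
  qed
qed (auto simp: face_ideal_def)

text \<open>Among the terms that avoid \<open>X\<close>, the largest one of \<open>p\<close> and the
  largest one of \<open>q\<close> multiply to a term that cannot cancel. The variable type carries
  no order, so the finite set \<open>V\<close> is numbered by \<open>idx\<close>, and
  \<open>\<kappa>\<close> transports exponents additively to vectors over the naturals, which are
  linearly ordered.\<close>

lemma face_ideal_prime:
  fixes p q :: "('v, 'k::field) mpoly"
  assumes V: "finite V" and pq: "p \<in> polys V" "q \<in> polys V" "p * q \<in> face_ideal V X"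
  shows "p \<in> face_ideal V X \<or> q \<in> face_ideal V X"
proof (rule ccontr)
  assume no: "\<not> ?thesis"
  obtain idx :: "'v \<Rightarrow> nat" where idx: "inj_on idx V" using finite_imp_inj_to_nat_seg[OF V] by blast
  define \<kappa> :: "('v \<Rightarrow>\<^sub>0 nat) \<Rightarrow> (nat \<Rightarrow>\<^sub>0 nat)" where "\<kappa> = (\<lambda>t. \<Sum>v\<in>V. mono (idx v) (coef t v))"
  have \<kappa>_add: "\<kappa> (s + t) = \<kappa> s + \<kappa> t" for s t
    by (simp add: \<kappa>_def lookup_add single_add sum.distrib)
  have \<kappa>_coef: "coef (\<kappa> t) (idx v) = coef t v" if v: "v \<in> V" for t v
  proof -
    have "coef (\<kappa> t) (idx v) = (\<Sum>u\<in>V. if u = v then coef t u else 0)"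
      unfolding \<kappa>_def lookup_sum using idx v
      by (intro sum.cong) (auto simp: lookup_single when_def inj_on_def)
    then show ?thesis using V v by simp
  qed
  have \<kappa>_inj: "s = t" if "supp s \<subseteq> V" "supp t \<subseteq> V" "\<kappa> s = \<kappa> t" for s t
  proof (rule poly_mapping_eqI)
    fix v
    show "coef s v = coef t v"
    proof (cases "v \<in> V")
      case True
      then show ?thesis using \<kappa>_coef[of v s] \<kappa>_coef[of v t] that(3) by simp
    next
      case False
      then have "v \<notin> supp s" "v \<notin> supp t" using that by blast+
      then show ?thesis by (simp add: in_keys_iff)
    qed
  qed
  define lead :: "('v, 'k) mpoly \<Rightarrow> ('v \<Rightarrow>\<^sub>0 nat) \<Rightarrow> bool" where
    "lead = (\<lambda>r t. t \<in> supp r \<and> supp t \<inter> X = {} \<and> supp t \<subseteq> V \<and>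
      (\<forall>s\<in>supp r. supp s \<inter> X = {} \<longrightarrow> s = t \<or> \<kappa> s < \<kappa> t))"
  have top: "\<exists>t. lead r t"
    if r: "r \<in> polys V" "r \<notin> face_ideal V X" for r :: "('v, 'k) mpoly"
  proof -
    let ?T = "{t \<in> supp r. supp t \<inter> X = {}}"
    have T: "finite (\<kappa> ` ?T)" "\<kappa> ` ?T \<noteq> {}" using r by (auto simp: face_ideal_def)
    have "Max (\<kappa> ` ?T) \<in> \<kappa> ` ?T" by (rule Max_in[OF T])
    then obtain t where t: "t \<in> ?T" "\<kappa> t = Max (\<kappa> ` ?T)" by auto
    have sub: "supp s \<subseteq> V" if "s \<in> ?T" for s using that r(1) by (auto simp: polys_def)
    have max: "s = t \<or> \<kappa> s < \<kappa> t" if s: "s \<in> ?T" for s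
    proof (cases "\<kappa> s = \<kappa> t")
      case True
      then show ?thesis using \<kappa>_inj[OF sub[OF s] sub[OF t(1)]] by simp
    next
      case False
      have "\<kappa> s \<le> \<kappa> t" unfolding t(2) by (rule Max_ge[OF T(1)]) (use s in blast)
      then have "\<kappa> s < \<kappa> t" using False by (rule order_le_neq_trans)
      then show ?thesis by (rule disjI2)
    qed
    have "lead r t"
      unfolding lead_def
    proof (intro conjI ballI impI)
      show "t \<in> supp r" "supp t \<inter> X = {}" using t(1) by simp_all
      show "supp t \<subseteq> V" by (rule sub[OF t(1)])
      fix s assume "s \<in> supp r" "supp s \<inter> X = {}"
      then show "s = t \<or> \<kappa> s < \<kappa> t" by (intro max) simp
    qed
    then show ?thesis by (rule exI)
  qed
  have np: "p \<notin> face_ideal V X" and nq: "q \<notin> face_ideal V X" using no by simp_all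
  obtain t where lt: "lead p t" using top[OF pq(1) np] by (rule exE)
  have t: "t \<in> supp p" "supp t \<inter> X = {}" "supp t \<subseteq> V" using lt unfolding lead_def by simp_all
  have t_max: "s = t \<or> \<kappa> s < \<kappa> t" if "s \<in> supp p" "supp s \<inter> X = {}" for s
    by (rule bspec[OF conjunct2[OF conjunct2[OF conjunct2[OF lt[unfolded lead_def]]]], THEN mp, OF that])
  obtain u where lu: "lead q u" using top[OF pq(2) nq] by (rule exE)
  have u: "u \<in> supp q" "supp u \<inter> X = {}" "supp u \<subseteq> V" using lu unfolding lead_def by simp_all
  have u_max: "s = u \<or> \<kappa> s < \<kappa> u" if "s \<in> supp q" "supp s \<inter> X = {}" for s
    by (rule bspec[OF conjunct2[OF conjunct2[OF conjunct2[OF lu[unfolded lead_def]]]], THEN mp, OF that])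
  have disj: "supp (t + u) \<inter> X = {}" using t(2) u(2) by (auto simp: supp_exponent_add)
  have zero: "coef (mono s (coef p s) * q) (t + u) = 0" if s: "s \<in> supp p - {t}" for s
  proof (rule ccontr)
    assume "coef (mono s (coef p s) * q) (t + u) \<noteq> 0"
    then have "t + u \<in> supp (mono s (coef p s) * q)" by (simp add: in_keys_iff)
    then obtain a b where ab: "a \<in> supp (mono s (coef p s))" "b \<in> supp q" "t + u = a + b" by (rule supp_mult)
    have eq: "t + u = s + b" using ab(1,3) by (simp split: if_splits)
    then have "supp s \<inter> X = {}" "supp b \<inter> X = {}" using disj by (auto simp: supp_exponent_add)
    then have "\<kappa> s < \<kappa> t" "\<kappa> b \<le> \<kappa> u" using t_max[of s] u_max[of b] s ab(2) by auto
    then have "\<kappa> s + \<kappa> b < \<kappa> t + \<kappa> u" by (rule add_less_le_mono)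
    then show False using arg_cong[OF eq, of \<kappa>] by (simp add: \<kappa>_add)
  qed
  have "coef (p * q) (t + u) = coef (mono t (coef p t) * q) (t + u)"
    unfolding coef_mult[of p] using t(1) zero by (simp add: sum.remove)
  also have "\<dots> = coef p t * coef q u" by (rule coef_mono_mult_add)
  also have "\<dots> \<noteq> 0" using t(1) u(1) by (simp add: in_keys_iff)
  finally have "t + u \<in> supp (p * q)" by (simp add: in_keys_iff)
  then show False using pq(3) disj unfolding face_ideal_def by blast
qed

lemma one_notin_face_ideal: "1 \<notin> face_ideal V X"
  by (simp add: face_ideal_def)

lemma face_ideal_mono: "X \<subseteq> Y \<Longrightarrow> face_ideal V X \<subseteq> face_ideal V Y"
  unfolding face_ideal_def by blast

lemma var_face_ideal: "v \<in> V \<Longrightarrow> var v \<in> face_ideal V X \<longleftrightarrow> v \<in> X"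
  by (simp add: face_ideal_def) (simp add: var_def)

context simple_graph_loc
begin

lemma edge_gens: "{var u * var v |u v. {u, v} \<in> E} \<subseteq> polys V"
  using edge_in_V by auto

lemma ideal_edge_ideal: "ideal (edge_ideal V E) (mpoly_ring V)"
  unfolding edge_ideal_def by (rule ideal_genideal[OF edge_gens])

lemma edge_ideal_gen: "{u, v} \<in> E \<Longrightarrow> var u * var v \<in> edge_ideal V E"
  unfolding edge_ideal_def by (rule set_mp[OF genideal_incl[OF edge_gens]]) blast

lemma edge_ideal_subset:
  assumes "C \<in> vertex_covers V E"
  shows "edge_ideal V E \<subseteq> face_ideal V C"
  unfolding edge_ideal_def
proof (rule genideal_least[OF ideal_face_ideal])
  show "{var u * var v |u v. {u, v} \<in> E} \<subseteq> face_ideal V C"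
  proof clarify
    fix u v assume uv: "{u, v} \<in> E"
    have V: "u \<in> V" "v \<in> V" using edge_in_V[OF uv] by auto
    have "u \<in> C \<or> v \<in> C" using assms uv by (auto simp: vertex_covers_def)
    then show "var u * var v \<in> face_ideal V C"
    proof
      assume "v \<in> C"
      then have "var v \<in> face_ideal V C" using var_face_ideal[OF V(2)] by blast
      then show ?thesis by (rule ideal_mult[OF ideal_face_ideal]) (simp add: V)
    next
      assume "u \<in> C"
      then have "var u \<in> face_ideal V C" using var_face_ideal[OF V(1)] by blast
      then have "var v * var u \<in> face_ideal V C" by (rule ideal_mult[OF ideal_face_ideal]) (simp add: V)
      then show ?thesis by (simp add: mult.commute)
    qed
  qed
qed

text \<open>Starting from the prime of the cover, the remaining variables are adjoined one by
  one.\<close>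

lemma krull_dim_edge_ideal:
  assumes C: "C \<in> vertex_covers V E"
  shows "enat (card (V - C)) \<le> krull_dim (mpoly_ring V Quot (edge_ideal V E :: ('v, 'k::field) mpoly set))"
proof -
  have "finite (V - C)" using finite_V by simp
  from ex_bij_betw_nat_finite[OF this] obtain d where d: "bij_betw d {0..<card (V - C)} (V - C)" by blast
  define L :: "nat \<Rightarrow> ('v, 'k) mpoly set" where "L = (\<lambda>i. face_ideal V (C \<union> d ` {0..<i}))"
  show ?thesis
  proof (rule krull_dim_ge[OF ideal_edge_ideal, where L = L])
    show "ideal (L i) (mpoly_ring V)" for i unfolding L_def by (rule ideal_face_ideal)
    show "edge_ideal V E \<subseteq> L i" for i
      unfolding L_def using edge_ideal_subset[OF C] face_ideal_mono[of C "C \<union> d ` {0..<i}"] by blast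
    show "1 \<notin> L i" for i unfolding L_def by (rule one_notin_face_ideal)
    show "p \<in> L i \<or> q \<in> L i" if "p \<in> polys V" "q \<in> polys V" "p * q \<in> L i" for i p q
      using face_ideal_prime[OF finite_V that(1,2)] that(3) unfolding L_def by blast
    show "L i \<subset> L (Suc i)" if i: "i < card (V - C)" for i
    proof
      show "L i \<subseteq> L (Suc i)" unfolding L_def by (rule face_ideal_mono) auto
      have di: "d i \<in> V - C" using d i by (auto simp: bij_betw_def)
      have nin: "d i \<notin> d ` {0..<i}"
      proof
        assume "d i \<in> d ` {0..<i}"
        then obtain k where k: "k \<in> {0..<i}" "d i = d k" by blast
        then have "i = k" using d i by (auto simp: bij_betw_def inj_on_def)
        then show False using k by simp
      qed
      have "var (d i) \<notin> L i" "var (d i) \<in> L (Suc i)"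
        unfolding L_def using di nin by (simp_all add: var_face_ideal)
      then show "L i \<noteq> L (Suc i)" by blast
    qed
  qed
qed

end

section \<open>Algebraic dependence\<close>

text \<open>Bounding every exponent separately, not the total degree, makes the count a plain
  power.\<close>

lemma card_box_exponents:
  assumes "finite D"
  shows "card {t :: 'v \<Rightarrow>\<^sub>0 nat. supp t \<subseteq> D \<and> (\<forall>v. coef t v \<le> L)} = (L + 1) ^ card D"
    and "finite {t :: 'v \<Rightarrow>\<^sub>0 nat. supp t \<subseteq> D \<and> (\<forall>v. coef t v \<le> L)}"
proof -
  let ?T = "{t :: 'v \<Rightarrow>\<^sub>0 nat. supp t \<subseteq> D \<and> (\<forall>v. coef t v \<le> L)}"
  let ?P = "D \<rightarrow>\<^sub>E {..L}"
  let ?h = "\<lambda>g. \<Sum>v\<in>D. mono v (g v :: nat)"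
  have coef_h: "coef (?h g) v = (if v \<in> D then g v else 0)" for g v
    using assms by (simp add: lookup_sum lookup_single when_def)
  have "bij_betw ?h ?P ?T"
  proof (rule bij_betwI[where g = "\<lambda>t. restrict (coef t) D"])
    show "?h \<in> ?P \<rightarrow> ?T"
    proof
      fix g assume g: "g \<in> ?P"
      have "v \<in> D" if "v \<in> supp (?h g)" for v
      proof (rule ccontr)
        assume "v \<notin> D"
        then have "coef (?h g) v = 0" by (simp add: coef_h)
        then show False using that by (simp only: in_keys_iff)
      qed
      moreover have "coef (?h g) v \<le> L" for v
      proof (cases "v \<in> D")
        case True
        then have "g v \<in> {..L}" using g by blast
        then show ?thesis using True by (simp add: coef_h)
      qed (simp add: coef_h)
      ultimately show "?h g \<in> ?T" by blast
    qed
    show "(\<lambda>t. restrict (coef t) D) \<in> ?T \<rightarrow> ?P" by auto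
    show "restrict (coef (?h g)) D = g" if "g \<in> ?P" for g
    proof
      fix v
      show "restrict (coef (?h g)) D v = g v"
        using PiE_arb[OF that, of v] by (cases "v \<in> D") (simp_all add: coef_h)
    qed
    show "?h (restrict (coef t) D) = t" if t: "t \<in> ?T" for t
    proof (rule poly_mapping_eqI)
      fix v
      have "v \<in> D \<or> coef t v = 0" using t by (auto simp: in_keys_iff)
      then show "coef (?h (restrict (coef t) D)) v = coef t v" by (auto simp: coef_h)
    qed
  qed
  moreover have "card ?P = (L + 1) ^ card D" using assms by (simp add: card_PiE)
  moreover have "finite ?P" using assms by (intro finite_PiE) simp_all
  ultimately show "card ?T = (L + 1) ^ card D" "finite ?T"
    using bij_betw_same_card[of ?h ?P ?T] bij_betw_finite[of ?h ?P ?T] by simp_all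
qed

definition exps_le :: "nat \<Rightarrow> ('v, 'k::field) mpoly \<Rightarrow> bool" where
  "exps_le B p \<longleftrightarrow> (\<forall>t\<in>supp p. \<forall>v. coef t v \<le> B)"

lemma exps_le_mult:
  assumes "exps_le A p" "exps_le B q"
  shows "exps_le (A + B) (p * q)"
  unfolding exps_le_def
proof (intro ballI allI)
  fix u v assume "u \<in> supp (p * q)"
  then obtain s t where "s \<in> supp p" "t \<in> supp q" "u = s + t" by (rule supp_mult)
  then show "coef u v \<le> A + B" using assms by (simp add: exps_le_def lookup_add add_mono)
qed

lemma exps_le_power: "exps_le B p \<Longrightarrow> exps_le (k * B) (p ^ k)"
proof (induction k)
  case 0
  show ?case by (simp add: exps_le_def)
next
  case (Suc k)
  then show ?case using exps_le_mult[of B p "k * B" "p ^ k"] by simp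
qed

lemma exps_le_mono: "exps_le A p \<Longrightarrow> A \<le> B \<Longrightarrow> exps_le B p"
  unfolding exps_le_def using le_trans by blast

lemma exps_le_monom_val:
  assumes "\<And>i. i < N \<Longrightarrow> exps_le B (p i)" "\<And>i. coef \<alpha> i \<le> d"
  shows "exps_le (N * (d * B)) (monom_val N p \<alpha>)"
proof -
  have "n \<le> N \<Longrightarrow> exps_le (n * (d * B)) (\<Prod>i<n. p i ^ coef \<alpha> i)" for n
  proof (induction n)
    case 0
    show ?case by (simp add: exps_le_def)
  next
    case (Suc n)
    have "exps_le (coef \<alpha> n * B) (p n ^ coef \<alpha> n)" using Suc.prems assms(1) by (intro exps_le_power) simp
    then have "exps_le (d * B) (p n ^ coef \<alpha> n)" by (rule exps_le_mono) (simp add: assms(2))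
    then have "exps_le (n * (d * B) + d * B) ((\<Prod>i<n. p i ^ coef \<alpha> i) * p n ^ coef \<alpha> n)"
      using Suc by (intro exps_le_mult) simp_all
    then show ?case by (simp add: add.commute)
  qed
  then show ?thesis by (simp add: monom_val_def)
qed

text \<open>Modulo the prime of \<open>C\<close> only exponents supported in \<open>D\<close>
  matter. Monomials in the \<open>p i\<close> with exponents up to \<open>d\<close> number
  \<open>(d + 1) ^ N\<close>, while their terms on \<open>D\<close> lie in a box of side
  \<open>L + 1\<close>, where \<open>L\<close> is linear in \<open>d\<close>. As
  \<open>card D < N\<close>, a large \<open>d\<close> yields a linear dependency.\<close>

lemma algebraic_dependence:
  fixes p :: "nat \<Rightarrow> ('v, 'k::field) mpoly"
  assumes D: "finite D" "card D < N" and p: "\<And>i. p i \<in> polys V" and V: "D = V - C"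
  obtains A and \<gamma> :: "(nat \<Rightarrow>\<^sub>0 nat) \<Rightarrow> 'k"
  where "finite A" "\<And>\<alpha>. \<alpha> \<in> A \<Longrightarrow> supp \<alpha> \<subseteq> {..<N}" "\<exists>\<alpha>\<in>A. \<gamma> \<alpha> \<noteq> 0"
    "(\<Sum>\<alpha>\<in>A. mono 0 (\<gamma> \<alpha>) * monom_val N p \<alpha>) \<in> face_ideal V C"
proof -
  have "finite (\<Union>i<N. \<Union>t\<in>supp (p i). coef t ` supp t)" by simp
  from this[unfolded finite_nat_set_iff_bounded_le]
  obtain B where B: "\<forall>k\<in>(\<Union>i<N. \<Union>t\<in>supp (p i). coef t ` supp t). k \<le> B" by (rule exE)
  have pB: "exps_le B (p i)" if i: "i < N" for i
    unfolding exps_le_def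
  proof (intro ballI allI)
    fix t v assume t: "t \<in> supp (p i)"
    show "coef t v \<le> B"
    proof (cases "v \<in> supp t")
      case True
      have "coef t v \<in> coef t ` supp t" using True by (rule imageI)
      with t have "coef t v \<in> (\<Union>t\<in>supp (p i). coef t ` supp t)" by (rule UN_I)
      moreover have "i \<in> {..<N}" using i by simp
      ultimately have "coef t v \<in> (\<Union>i<N. \<Union>t\<in>supp (p i). coef t ` supp t)" by (rule UN_I[rotated])
      then show ?thesis by (rule bspec[OF B])
    next
      case False
      then show ?thesis by (simp add: in_keys_iff)
    qed
  qed
  \<comment> \<open>Chosen to absorb the constant: \<open>L + 1 \<le> (N * B + 1) * (d + 1)\<close>,
    so the box has at most \<open>d * (d + 1) ^ card D\<close> points.\<close>
  define d where "d = (N * B + 1) ^ card D"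
  define L where "L = N * (d * B)"
  define A where "A = {\<alpha> :: nat \<Rightarrow>\<^sub>0 nat. supp \<alpha> \<subseteq> {..<N} \<and> (\<forall>i. coef \<alpha> i \<le> d)}"
  define T where "T = {t :: 'v \<Rightarrow>\<^sub>0 nat. supp t \<subseteq> D \<and> (\<forall>v. coef t v \<le> L)}"
  have A: "card A = (d + 1) ^ N" "finite A" using card_box_exponents[of "{..<N}" d] by (simp_all add: A_def)
  have T: "card T = (L + 1) ^ card D" "finite T" using card_box_exponents[OF D(1), of L] by (simp_all add: T_def)
  have "L + 1 \<le> (N * B + 1) * (d + 1)" by (simp add: L_def algebra_simps)
  then have "(L + 1) ^ card D \<le> ((N * B + 1) * (d + 1)) ^ card D" by (rule power_mono) simp
  also have "\<dots> = d * (d + 1) ^ card D" by (simp only: power_mult_distrib d_def)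
  also have "\<dots> < (d + 1) ^ Suc (card D)" by simp
  also have "\<dots> \<le> (d + 1) ^ N" using D(2) by (intro power_increasing) simp_all
  finally have "card T < card A" by (simp add: A T)
  from linear_dependence[OF T(2) A(2) this, of "\<lambda>\<alpha> t. coef (monom_val N p \<alpha>) t"]
  obtain \<gamma> where "(\<exists>\<alpha>\<in>A. \<gamma> \<alpha> \<noteq> 0) \<and>
    (\<forall>t\<in>T. (\<Sum>\<alpha>\<in>A. \<gamma> \<alpha> * coef (monom_val N p \<alpha>) t) = 0)" by (rule exE)
  note \<gamma> = conjunct1[OF this] conjunct2[OF this]
  let ?g = "\<Sum>\<alpha>\<in>A. mono 0 (\<gamma> \<alpha>) * monom_val N p \<alpha>"
  have scale: "coef (mono 0 c * q) t = c * coef q t" for c and q :: "('v, 'k) mpoly" and t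
    using coef_mono_mult_add[of 0 c q t] by simp
  have g_coef: "coef ?g t = (\<Sum>\<alpha>\<in>A. \<gamma> \<alpha> * coef (monom_val N p \<alpha>) t)" for t
    by (simp add: lookup_sum scale)
  have gV: "?g \<in> polys V" unfolding monom_val_def
    using p by (intro polys_sum polys_mult polys_const polys_prod polys_power)
  have "supp t \<inter> C \<noteq> {}" if t: "t \<in> supp ?g" for t
  proof
    assume disj: "supp t \<inter> C = {}"
    have "supp t \<subseteq> V" using t gV by (simp add: polys_def)
    then have tD: "supp t \<subseteq> D" using disj V by blast
    have nz: "(\<Sum>\<alpha>\<in>A. \<gamma> \<alpha> * coef (monom_val N p \<alpha>) t) \<noteq> 0"
      using t unfolding in_keys_iff g_coef .
    then obtain \<alpha> where \<alpha>: "\<alpha> \<in> A" "\<gamma> \<alpha> * coef (monom_val N p \<alpha>) t \<noteq> 0"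
      by (rule sum.not_neutral_contains_not_neutral)
    then have "t \<in> supp (monom_val N p \<alpha>)" by (simp add: in_keys_iff)
    moreover have "exps_le L (monom_val N p \<alpha>)"
      unfolding L_def using pB \<alpha>(1) by (intro exps_le_monom_val) (simp_all add: A_def)
    ultimately have "t \<in> T" using tD by (simp add: T_def exps_le_def)
    then have "(\<Sum>\<alpha>\<in>A. \<gamma> \<alpha> * coef (monom_val N p \<alpha>) t) = 0" by (rule bspec[OF \<gamma>(2)])
    then show False using nz by contradiction
  qed
  then have "?g \<in> face_ideal V C" using gV by (simp add: face_ideal_def)
  then show thesis using A(2) \<gamma>(1) by (intro that[of A \<gamma>]) (simp_all add: A_def)
qed

section \<open>Cohen--Macaulay graphs are unmixed\<close>

context simple_graph_loc
begin

text \<open>Each term of \<open>g\<close> contains some \<open>v\<close> in \<open>C\<close>, and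
  \<open>v\<close> has a neighbour \<open>u\<close> in \<open>V - C\<close> by maximality. The
  product of the monomial of \<open>V - C\<close> with this term is then divisible by the edge
  monomial of \<open>u\<close> and \<open>v\<close>.\<close>

lemma edge_ideal_annihilator:
  fixes g :: "('v, 'k::field) mpoly"
  assumes C: "C \<in> min_vertex_covers V E" and g: "g \<in> face_ideal V C"
  shows "mono (expo (V - C)) 1 * g \<in> edge_ideal V E"
proof -
  let ?I = "edge_ideal V E :: ('v, 'k) mpoly set" and ?D = "V - C"
  have CV: "C \<subseteq> V" and max: "max_indep V E ?D" using C by (simp_all add: min_vertex_cover_iff)
  have "mono (expo ?D) 1 * mono t (coef g t) \<in> ?I" if t: "t \<in> supp g" for t
  proof -
    obtain v where v: "v \<in> supp t" "v \<in> C" using g t by (auto simp: face_ideal_def)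
    then have "v \<in> V - ?D" using CV by blast
    then obtain u where u: "u \<in> ?D" "{v, u} \<in> E" using max unfolding max_indep_def by blast
    have tV: "supp t \<subseteq> V" using g t by (auto simp: face_ideal_def polys_def)
    let ?s = "(expo ?D - mono u 1) + (t - mono v 1)"
    have "expo ?D + t = (mono v 1 + mono u 1) + ?s"
    proof (rule poly_mapping_eqI)
      fix x
      have "coef t v \<noteq> 0" using v(1) by (simp add: in_keys_iff)
      then show "coef (expo ?D + t) x = coef ((mono v 1 + mono u 1) + ?s) x"
        using u(1) v(2) finite_V
        by (auto simp: lookup_add lookup_minus lookup_single when_def coef_expo)
    qed
    then have "mono (expo ?D) 1 * mono t (coef g t) = mono ?s (coef g t) * (var v * var u)"
      by (simp add: mult_single var_def add.commute)
    moreover have "supp ?s \<subseteq> V"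
    proof
      fix x assume "x \<in> supp ?s"
      then have "coef ?s x \<noteq> 0" unfolding in_keys_iff .
      then have "coef (expo ?D) x \<noteq> 0 \<or> coef t x \<noteq> 0" by (auto simp: lookup_add lookup_minus)
      then show "x \<in> V"
      proof
        assume "coef (expo ?D) x \<noteq> 0"
        then show ?thesis using finite_V by (simp add: coef_expo split: if_splits)
      next
        assume "coef t x \<noteq> 0"
        then have "x \<in> supp t" by (simp add: in_keys_iff)
        then show ?thesis using tV by blast
      qed
    qed
    ultimately show ?thesis
      using ideal_mult[OF ideal_edge_ideal edge_ideal_gen[OF u(2)], of "mono ?s (coef g t)"] by simp
  qed
  then have "(\<Sum>t\<in>supp g. mono (expo ?D) 1 * mono t (coef g t)) \<in> ?I"
    by (rule ideal_sum[OF ideal_edge_ideal])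
  then show ?thesis
    using poly_eq_sum_mono[of "supp g" g] by (simp flip: sum_distrib_left)
qed

text \<open>The monomial \<open>f\<close> of the maximal independent set \<open>V - C\<close> is annihilated by the prime of \<open>C\<close>,
  and \<open>f g(p)\<close> vanishes for an algebraic relation \<open>g\<close> of the \<open>p i\<close> modulo that prime.\<close>

lemma depth_edge_ideal:
  assumes C: "C \<in> min_vertex_covers V E"
  shows "depth (mpoly_ring V Quot (edge_ideal V E :: ('v, 'k::field) mpoly set))
    ((\<lambda>p. edge_ideal V E +>\<^bsub>mpoly_ring V\<^esub> p) ` irrelevant_ideal V) \<le> enat (card (V - C))"
  unfolding depth_def
proof (rule Sup_least)
  let ?I = "edge_ideal V E :: ('v, 'k) mpoly set" and ?D = "V - C"
  let ?Q = "mpoly_ring V Quot ?I" and ?m = "(\<lambda>p. ?I +>\<^bsub>mpoly_ring V\<^esub> p) ` irrelevant_ideal V"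
  have cover: "C \<in> vertex_covers V E" using C by (simp add: min_vertex_covers_def)
  fix x assume "x \<in> {enat (length as) |as. set as \<subseteq> ?m \<and> regular_sequence ?Q as}"
  then obtain as where as: "x = enat (length as)" "set as \<subseteq> ?m" "regular_sequence ?Q as" by blast
  obtain p where p: "\<And>i. p i \<in> irrelevant_ideal V"
    "\<And>n x. n < length as \<Longrightarrow> x \<in> polys V \<Longrightarrow> p n * x \<in> power_ideal V ?I p n (Suc 0) \<Longrightarrow>
      x \<in> power_ideal V ?I p n (Suc 0)"
    using regular_sequence_lift[OF ideal_edge_ideal as(3,2)] by metis
  define N where "N = length as"
  have pV: "p i \<in> polys V" for i by (rule ideal_subset[OF ideal_irrelevant p(1)])
  note I = ideal_edge_ideal
  have qr: "quasi_regular V ?I p N"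
    by (rule quasi_regular_of_regular[OF I pV, of N]) (use p(2) in \<open>simp_all add: N_def\<close>)
  define f :: "('v, 'k) mpoly" where "f = mono (expo ?D) 1"
  have coefD: "coef (expo ?D) v = (if v \<in> ?D then 1 else 0)" for v using finite_V by (simp add: coef_expo)
  have suppD: "supp (expo ?D) = ?D" using coefD by (auto simp: in_keys_iff split: if_splits)
  have fV: "f \<in> polys V" by (simp add: f_def suppD)
  have degD: "monom_deg (expo ?D) = card ?D"
    unfolding monom_deg_def suppD by (simp add: coefD)
  \<comment> \<open>Modulo the prime of \<open>C\<close> the edge ideal vanishes, and every
    \<open>p i\<close> starts in degree 1, so the \<open>j\<close>-th power starts in degree
    \<open>j\<close>. Hence \<open>f\<close> lies in only finitely many of the powers, and its order
    \<open>j\<close> in the filtration exists.\<close>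
  have low: "coef y t = 0" if "y \<in> power_ideal V ?I p n j" "supp t \<subseteq> ?D" "monom_deg t < j" for y t n j
    using that
  proof (induction n j arbitrary: y t rule: form_exps.induct)
    case (2 j)
    then have "y \<in> face_ideal V C" using edge_ideal_subset[OF cover] by auto
    then show ?case using 2(2) by (auto simp: face_ideal_def in_keys_iff)
  next
    case (3 n j)
    obtain a b where ab: "y = a + p n * b" "a \<in> power_ideal V ?I p n (Suc j)" "b \<in> power_ideal V ?I p (Suc n) j"
      using 3(3) by auto
    have "coef a t = 0" by (rule 3(1)[OF ab(2) 3(4,5)])
    moreover have "coef (p n * b) t = 0"
    proof (rule ccontr)
      assume "coef (p n * b) t \<noteq> 0"
      then have "t \<in> supp (p n * b)" by (simp add: in_keys_iff)
      then obtain s u where su: "s \<in> supp (p n)" "u \<in> supp b" "t = s + u" by (rule supp_mult)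
      have "coef (p n) 0 = 0" by (rule irrelevant_coef_0[OF p(1)])
      then have "s \<noteq> 0" using su(1) by (auto simp: in_keys_iff)
      then have "monom_deg s \<noteq> 0" using monom_deg_eq_0 by blast
      then have "monom_deg u < j" using 3(5) su(3) by (simp add: monom_deg_add)
      moreover have "supp u \<subseteq> ?D" using 3(4) su(3) by (simp add: supp_exponent_add)
      ultimately have "coef b u = 0" by (intro 3(2)[OF ab(3)])
      then show False using su(2) by (simp add: in_keys_iff)
    qed
    ultimately show ?case by (simp add: ab(1) lookup_add)
  qed simp
  have "f \<notin> power_ideal V ?I p N (Suc (card ?D))"
    using low[of f N "Suc (card ?D)" "expo ?D"] by (auto simp: f_def suppD degD)
  then have ex: "\<exists>j. f \<notin> power_ideal V ?I p N (Suc j)" by blast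
  define j where "j = (LEAST j. f \<notin> power_ideal V ?I p N (Suc j))"
  have j: "f \<notin> power_ideal V ?I p N (Suc j)" unfolding j_def by (rule LeastI_ex[OF ex])
  have j': "f \<in> power_ideal V ?I p N j"
  proof (cases j)
    case (Suc i)
    then show ?thesis using not_less_Least[of i "\<lambda>j. f \<notin> power_ideal V ?I p N (Suc j)"] by (auto simp: j_def)
  qed (simp add: fV)
  have "N \<le> card ?D"
  proof (rule ccontr)
    assume "\<not> N \<le> card ?D"
    then have less: "card ?D < N" by simp
    have finD: "finite ?D" using finite_V by simp
    show False
    proof (rule algebraic_dependence[where p = p, OF finD less pV refl])
      fix A and \<gamma> :: "(nat \<Rightarrow>\<^sub>0 nat) \<Rightarrow> 'k"
      assume A: "finite A" "\<And>\<alpha>. \<alpha> \<in> A \<Longrightarrow> supp \<alpha> \<subseteq> {..<N}" "\<exists>\<alpha>\<in>A. \<gamma> \<alpha> \<noteq> 0"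
        "(\<Sum>\<alpha>\<in>A. mono 0 (\<gamma> \<alpha>) * monom_val N p \<alpha>) \<in> face_ideal V C"
      have "f * (\<Sum>\<alpha>\<in>A. mono 0 (\<gamma> \<alpha>) * monom_val N p \<alpha>) \<in> ?I"
        unfolding f_def by (rule edge_ideal_annihilator[OF C A(4)])
      moreover have "f * (\<Sum>\<alpha>\<in>A. mono 0 (\<gamma> \<alpha>) * monom_val N p \<alpha>) \<notin> ?I"
        using quasi_regular_relation[OF I pV qr j' j A(1,2,3)] .
      ultimately show False by contradiction
    qed
  qed
  then show "x \<le> enat (card (V - C))" by (simp add: as(1) N_def)
qed

text \<open>The dimension is at least, and the depth at most, every \<open>card (V - C)\<close>;
  equality of the two squeezes all these numbers together.\<close>

lemma cohen_macaulay_unmixed: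
  assumes "cohen_macaulay_quotient V (edge_ideal V E :: ('v, 'k::field) mpoly set)"
    and C: "C \<in> min_vertex_covers V E" "C' \<in> min_vertex_covers V E"
  shows "card C = card C'"
proof -
  have le: "card (V - C') \<le> card (V - C)"
    if "C \<in> min_vertex_covers V E" "C' \<in> min_vertex_covers V E" for C C'
  proof -
    have "enat (card (V - C')) \<le> krull_dim (mpoly_ring V Quot (edge_ideal V E :: ('v, 'k) mpoly set))"
      using that(2) by (intro krull_dim_edge_ideal) (simp add: min_vertex_covers_def)
    also have "\<dots> = depth (mpoly_ring V Quot (edge_ideal V E :: ('v, 'k) mpoly set))
        ((\<lambda>p. edge_ideal V E +>\<^bsub>mpoly_ring V\<^esub> p) ` irrelevant_ideal V)"
      using assms(1) by (simp add: cohen_macaulay_quotient_def Let_def)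
    also have "\<dots> \<le> enat (card (V - C))" by (rule depth_edge_ideal[OF that(1)])
    finally show ?thesis by simp
  qed
  have "card (V - C) = card (V - C')" using le[OF C] le[OF C(2,1)] by simp
  moreover have "C \<subseteq> V" "C' \<subseteq> V" using C by (simp_all add: min_vertex_cover_iff)
  ultimately show ?thesis using finite_V
    by (metis card_Diff_subset card_mono diff_diff_cancel finite_subset)
qed

end

lemma proj_dim_le:
  fixes F :: "nat \<Rightarrow> ('a, nat \<Rightarrow> 'a) module"
  assumes "resolution R M F d \<epsilon>" "\<And>i. projective_module R (F i)"
    "\<And>i. n < i \<Longrightarrow> carrier (F i) = {\<zero>\<^bsub>F i\<^esub>}"
  shows "proj_dim R M \<le> enat n"
  unfolding proj_dim_def using assms by (intro Inf_lower) blast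

lemma proj_dim_ge:
  fixes M :: "('a, 'b) module"
  assumes "\<And>n (F :: nat \<Rightarrow> ('a, nat \<Rightarrow> 'a) module) d \<epsilon>. resolution R M F d \<epsilon> \<Longrightarrow>
    (\<And>i. projective_module R (F i)) \<Longrightarrow> (\<And>i. n < i \<Longrightarrow> carrier (F i) = {\<zero>\<^bsub>F i\<^esub>}) \<Longrightarrow> a \<le> enat n"
  shows "a \<le> proj_dim R M"
  unfolding proj_dim_def using assms by (intro Inf_greatest) blast

section \<open>The cellular resolution\<close>

context star_complex
begin

definition cells :: "nat \<Rightarrow> ((nat \<Rightarrow> 'v) \<times> nat set) set" where
  "cells n = (SIGMA f:\<F>. {\<sigma>. \<sigma> \<subseteq> {j \<in> J. f j \<noteq> w j} \<and> card \<sigma> = n})"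

definition rank :: "nat \<Rightarrow> nat" where
  "rank n = card (cells n)"

text \<open>Any numbering of the cubes will do: it identifies chains with the coordinate vectors
  that \<open>free_module\<close> asks for.\<close>

definition enum :: "nat \<Rightarrow> nat \<Rightarrow> (nat \<Rightarrow> 'v) \<times> nat set" where
  "enum n = (SOME e. bij_betw e {0..<rank n} (cells n))"

definition chain :: "nat \<Rightarrow> (nat \<Rightarrow> ('v, 'k::field) mpoly) \<Rightarrow> (nat \<Rightarrow> 'v) \<Rightarrow> nat set \<Rightarrow> ('v, 'k) mpoly" where
  "chain n y f \<sigma> = (if cell n f \<sigma> then y (inv_into {0..<rank n} (enum n) (f, \<sigma>)) else 0)"

definition vec :: "nat \<Rightarrow> ((nat \<Rightarrow> 'v) \<Rightarrow> nat set \<Rightarrow> ('v, 'k::field) mpoly) \<Rightarrow> nat \<Rightarrow> ('v, 'k) mpoly" where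
  "vec n x = (\<lambda>l. if l < rank n then x (fst (enum n l)) (snd (enum n l)) else 0)"

definition differential :: "nat \<Rightarrow> (nat \<Rightarrow> ('v, 'k::field) mpoly) \<Rightarrow> nat \<Rightarrow> ('v, 'k) mpoly" where
  "differential n y = vec n (bd (chain (Suc n) y))"

definition augmentation :: "(nat \<Rightarrow> ('v, 'k::field) mpoly) \<Rightarrow> ('v, 'k) mpoly" where
  "augmentation y = aug (chain 0 y)"

lemma cells_iff: "(f, \<sigma>) \<in> cells n \<longleftrightarrow> cell n f \<sigma>"
  by (simp add: cells_def cell_def)

text \<open>Each cube is counted at its outermost vertex \<open>f\<close>; its directions are a
  subset of the coordinates that differ from the centre.\<close>

lemma rank_eq: "rank n = (\<Sum>f\<in>\<F>. card {j \<in> J. f j \<noteq> w j} choose n)"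
proof -
  have fin: "finite {j \<in> J. f j \<noteq> w j}" for f using finite_J by simp
  have "rank n = (\<Sum>f\<in>\<F>. card {\<sigma>. \<sigma> \<subseteq> {j \<in> J. f j \<noteq> w j} \<and> card \<sigma> = n})"
    unfolding rank_def cells_def using finite_\<F> finite_J by (subst card_SigmaI) auto
  also have "\<dots> = (\<Sum>f\<in>\<F>. card {j \<in> J. f j \<noteq> w j} choose n)"
    by (rule sum.cong[OF refl]) (rule n_subsets[OF fin])
  finally show ?thesis .
qed

lemma finite_cells: "finite (cells n)"
  unfolding cells_def using finite_\<F> finite_J by (intro finite_SigmaI) auto

lemma bij_enum: "bij_betw (enum n) {0..<rank n} (cells n)"
  unfolding enum_def rank_def by (rule someI_ex[OF ex_bij_betw_nat_finite[OF finite_cells]])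

lemma enum_cell: "l < rank n \<Longrightarrow> cell n (fst (enum n l)) (snd (enum n l))"
  using bij_betwE[OF bij_enum, of n] by (simp flip: cells_iff)

lemma inv_enum: "l < rank n \<Longrightarrow> inv_into {0..<rank n} (enum n) (enum n l) = l"
  by (rule bij_betw_inv_into_left[OF bij_enum]) simp

lemma enum_inv:
  assumes "cell n f \<sigma>"
  shows "enum n (inv_into {0..<rank n} (enum n) (f, \<sigma>)) = (f, \<sigma>)"
    "inv_into {0..<rank n} (enum n) (f, \<sigma>) < rank n"
proof -
  have c: "(f, \<sigma>) \<in> cells n" using assms by (simp add: cells_iff)
  show "enum n (inv_into {0..<rank n} (enum n) (f, \<sigma>)) = (f, \<sigma>)"
    by (rule bij_betw_inv_into_right[OF bij_enum c])
  have "inv_into {0..<rank n} (enum n) (f, \<sigma>) \<in> {0..<rank n}"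
    using bij_betwE[OF bij_betw_inv_into[OF bij_enum]] c by blast
  then show "inv_into {0..<rank n} (enum n) (f, \<sigma>) < rank n" by simp
qed

lemma chain_add: "chain n (\<lambda>i. x i + y i) = (\<lambda>f \<sigma>. chain n x f \<sigma> + chain n y f \<sigma>)"
  by (intro ext) (simp add: chain_def)

lemma chain_scale: "chain n (\<lambda>i. a * x i) = (\<lambda>f \<sigma>. a * chain n x f \<sigma>)"
  by (intro ext) (simp add: chain_def)

lemma chain_0: "chain n (\<lambda>i. 0) = (\<lambda>f \<sigma>. 0)"
  by (intro ext) (simp add: chain_def)

lemma chain_chains: "y \<in> carrier (free_module (mpoly_ring V) (rank n)) \<Longrightarrow> chain n y \<in> chains n"
  by (simp add: chains_def chain_def free_module_carrier)

lemma vec_carrier: "x \<in> chains n \<Longrightarrow> vec n x \<in> carrier (free_module (mpoly_ring V) (rank n))"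
  by (simp add: free_module_carrier vec_def chains_polys)

lemma chain_vec:
  assumes "x \<in> chains n"
  shows "chain n (vec n x) = x"
proof (intro ext)
  fix f \<sigma>
  show "chain n (vec n x) f \<sigma> = x f \<sigma>"
  proof (cases "cell n f \<sigma>")
    case True
    then show ?thesis by (simp add: chain_def vec_def enum_inv)
  next
    case False
    then show ?thesis using chains_cell[OF assms, of f \<sigma>] by (auto simp: chain_def)
  qed
qed

lemma vec_chain:
  assumes "y \<in> carrier (free_module (mpoly_ring V) (rank n))"
  shows "vec n (chain n y) = y"
proof (rule ext)
  fix l
  show "vec n (chain n y) l = y l"
  proof (cases "l < rank n")
    case True
    then show ?thesis using enum_cell[OF True] inv_enum[OF True] by (simp add: vec_def chain_def)
  next
    case False
    then show ?thesis using assms by (simp add: vec_def free_module_carrier)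
  qed
qed

lemma bd_chain_chains:
  "y \<in> carrier (free_module (mpoly_ring V) (rank (Suc n))) \<Longrightarrow> bd (chain (Suc n) y) \<in> chains n"
  by (intro bd_chains chain_chains)

lemma bd_chains_0:
  assumes "x \<in> chains 0"
  shows "bd x f \<sigma> = 0"
proof -
  have "x g (insert j \<sigma>) = 0" for g j
  proof (rule ccontr)
    assume "x g (insert j \<sigma>) \<noteq> 0"
    then have "cell 0 g (insert j \<sigma>)" by (rule chains_cell[OF assms])
    moreover from this have "finite (insert j \<sigma>)" by (rule cell_finite)
    ultimately show False by (simp add: cell_def)
  qed
  then show ?thesis unfolding bd_def by (intro sum.neutral ballI) (simp add: up_def)
qed

lemma differential_hom:
  "differential n \<in> module_hom (mpoly_ring V) (free_module (mpoly_ring V) (rank (Suc n)))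
     (free_module (mpoly_ring V) (rank n))"
proof (rule module_homI)
  fix x :: "nat \<Rightarrow> ('v, 'b::field) mpoly"
  assume "x \<in> carrier (free_module (mpoly_ring V) (rank (Suc n)))"
  then show "differential n x \<in> carrier (free_module (mpoly_ring V) (rank n))"
    unfolding differential_def by (intro vec_carrier bd_chain_chains)
qed (simp_all add: differential_def vec_def chain_add chain_scale bd_add bd_scale fun_eq_iff)

text \<open>The complex resolves the image of the augmentation, whatever \<open>\<F>\<close> is; for
  the transversals this image is later recognised as the cover ideal.\<close>

lemma ideal_aug_chains: "ideal (aug ` chains 0) (mpoly_ring V)"
proof (rule ideal_mpoly_ringI)
  show "aug ` chains 0 \<subseteq> polys V" by (auto simp: aug_def chains_polys)
  have "(\<lambda>f \<sigma>. 0) \<in> chains 0" by (simp add: chains_def)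
  then show "0 \<in> aug ` chains 0" by (rule rev_image_eqI) (simp add: aug_def)
next
  fix p q :: "('v, 'b::field) mpoly" assume "p \<in> aug ` chains 0" "q \<in> aug ` chains 0"
  then obtain x y where xy: "p = aug x" "x \<in> chains 0" "q = aug y" "y \<in> chains 0" by (elim imageE)
  show "p + q \<in> aug ` chains 0"
    unfolding xy(1,3) aug_add[symmetric] by (intro imageI chains_add xy(2,4))
next
  fix p q :: "('v, 'b::field) mpoly" assume p: "p \<in> aug ` chains 0" and q: "q \<in> polys V"
  then obtain x where x: "p = aug x" "x \<in> chains 0" by (elim imageE)
  have "(\<lambda>f \<sigma>. q * x f \<sigma>) \<in> chains 0" using x(2) q unfolding chains_def by (simp; metis mult_zero_right)
  then show "q * p \<in> aug ` chains 0" unfolding x(1) aug_scale[symmetric] by (rule imageI)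
qed

lemma augmentation_hom:
  "augmentation \<in> module_hom (mpoly_ring V) (free_module (mpoly_ring V) (rank 0))
     (ideal_module (mpoly_ring V) (aug ` chains 0))"
proof (rule module_homI)
  fix x :: "nat \<Rightarrow> ('v, 'b::field) mpoly"
  assume "x \<in> carrier (free_module (mpoly_ring V) (rank 0))"
  then show "augmentation x \<in> carrier (ideal_module (mpoly_ring V) (aug ` chains 0))"
    by (simp add: augmentation_def chain_chains)
qed (simp_all add: augmentation_def chain_add chain_scale aug_add aug_scale)

text \<open>\<open>chain\<close> and \<open>vec\<close> are mutually inverse, so exactness of the
  chains carries over to vectors. Surjectivity of the augmentation is built into the choice of the
  ideal.\<close>

lemma cellular_resolution:
  "resolution (mpoly_ring V) (ideal_module (mpoly_ring V) (aug ` chains 0 :: ('v, 'k::field) mpoly set))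
     (\<lambda>i. free_module (mpoly_ring V) (rank i)) differential augmentation"
  unfolding resolution_def
proof (intro conjI allI differential_hom augmentation_hom module_free_module
    module_ideal_module ideal_aug_chains)
  let ?Fr = "\<lambda>i. free_module (mpoly_ring V :: ('v, 'k) mpoly ring) (rank i)"
  let ?M = "ideal_module (mpoly_ring V) (aug ` chains 0 :: ('v, 'k) mpoly set)"
  have "p \<in> augmentation ` carrier (?Fr 0)" if p: "p \<in> aug ` chains 0" for p :: "('v, 'k) mpoly"
  proof -
    obtain x where x: "p = aug x" "x \<in> chains 0" using p by (elim imageE)
    have "p = augmentation (vec 0 x)" by (simp add: augmentation_def chain_vec x)
    then show ?thesis using vec_carrier[OF x(2)] by (rule image_eqI)
  qed
  then show "augmentation ` carrier (?Fr 0) = carrier ?M"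
    by (auto simp: augmentation_def chain_chains)
  show "differential 0 ` carrier (?Fr (Suc 0)) = {x \<in> carrier (?Fr 0). augmentation x = \<zero>\<^bsub>?M\<^esub>}"
  proof (intro equalityI subsetI)
    fix x assume "x \<in> differential 0 ` carrier (?Fr (Suc 0))"
    then obtain y where y: "x = differential 0 y" "y \<in> carrier (?Fr (Suc 0))" by (elim imageE)
    have "augmentation x = 0"
      unfolding y(1) augmentation_def differential_def chain_vec[OF bd_chain_chains[OF y(2)]]
      by (rule aug_bd[OF chain_chains[OF y(2)]])
    then show "x \<in> {x \<in> carrier (?Fr 0). augmentation x = \<zero>\<^bsub>?M\<^esub>}"
      using hom_closed[OF differential_hom y(2)] y(1) by simp
  next
    fix x assume "x \<in> {x \<in> carrier (?Fr 0). augmentation x = \<zero>\<^bsub>?M\<^esub>}"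
    then have x: "x \<in> carrier (?Fr 0)" "aug (chain 0 x) = 0" by (simp_all add: augmentation_def)
    have "\<exists>y\<in>chains (Suc 0). bd y = chain 0 x"
      by (rule exactness[OF chain_chains[OF x(1)] bd_chains_0[OF chain_chains[OF x(1)]] x(2)])
    then obtain y where y: "y \<in> chains (Suc 0)" "bd y = chain 0 x" by (rule bexE)
    have "x = differential 0 (vec (Suc 0) y)"
      by (simp add: differential_def chain_vec y vec_chain x(1))
    then show "x \<in> differential 0 ` carrier (?Fr (Suc 0))" using vec_carrier[OF y(1)] by (rule image_eqI)
  qed
  fix i
  show "differential (Suc i) ` carrier (?Fr (Suc (Suc i))) =
      {x \<in> carrier (?Fr (Suc i)). differential i x = \<zero>\<^bsub>?Fr i\<^esub>}"
  proof (intro equalityI subsetI)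
    fix x assume "x \<in> differential (Suc i) ` carrier (?Fr (Suc (Suc i)))"
    then obtain y where y: "x = differential (Suc i) y" "y \<in> carrier (?Fr (Suc (Suc i)))" by (elim imageE)
    have "bd (bd (chain (Suc (Suc i)) y)) = (\<lambda>f \<sigma>. 0)"
    proof (intro ext)
      fix f \<sigma>
      show "bd (bd (chain (Suc (Suc i)) y)) f \<sigma> = 0"
        using bd_bd bd_infinite[OF bd_chain_chains[OF y(2)]] by (cases "finite \<sigma>") blast+
    qed
    then have "differential i x = (\<lambda>i. 0)"
      unfolding y(1) differential_def chain_vec[OF bd_chain_chains[OF y(2)]] by (simp add: vec_def)
    then show "x \<in> {x \<in> carrier (?Fr (Suc i)). differential i x = \<zero>\<^bsub>?Fr i\<^esub>}"
      using hom_closed[OF differential_hom y(2)] y(1) by simp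
  next
    fix x assume "x \<in> {x \<in> carrier (?Fr (Suc i)). differential i x = \<zero>\<^bsub>?Fr i\<^esub>}"
    then have x: "x \<in> carrier (?Fr (Suc i))" "vec i (bd (chain (Suc i) x)) = (\<lambda>i. 0)"
      by (simp_all add: differential_def)
    have "bd (chain (Suc i) x) = (\<lambda>f \<sigma>. 0)"
      using chain_vec[OF bd_chain_chains[OF x(1)]] unfolding x(2) chain_0 by simp
    then have "\<exists>y\<in>chains (Suc (Suc i)). bd y = chain (Suc i) x"
      by (intro exactness chain_chains x(1)) simp_all
    then obtain y where y: "y \<in> chains (Suc (Suc i))" "bd y = chain (Suc i) x" by (rule bexE)
    have "x = differential (Suc i) (vec (Suc (Suc i)) y)"
      by (simp add: differential_def chain_vec y vec_chain x(1))
    then show "x \<in> differential (Suc i) ` carrier (?Fr (Suc (Suc i)))"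
      using vec_carrier[OF y(1)] by (rule image_eqI)
  qed
qed

lemma card_V_diff: "f \<in> \<F> \<Longrightarrow> card (V - f ` J) = card V - card J"
proof -
  assume f: "f \<in> \<F>"
  have "inj_on f J"
  proof (rule inj_onI)
    fix i j assume ij: "i \<in> J" "j \<in> J" "f i = f j"
    show "i = j" using Q_disjoint[OF ij(1,2) \<F>_in_Q[OF f ij(1)]] \<F>_in_Q[OF f ij(2)] ij(3) by simp
  qed
  moreover have "f ` J \<subseteq> V" using \<F>_in_Q[OF f] Q_subset by blast
  ultimately show ?thesis using finite_J by (simp add: card_Diff_subset card_image)
qed

lemma homogeneous_cov:
  assumes "f \<in> \<F>"
  shows "homogeneous (int (card V - card J)) (cov f)"
proof -
  have "supp (expo (V - f ` J)) \<subseteq> V - f ` J" by (auto simp: in_keys_iff coef_cov_expo split: if_splits)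
  then have "monom_deg (expo (V - f ` J)) = (\<Sum>v\<in>V - f ` J. coef (expo (V - f ` J)) v)"
    using finite_V by (intro monom_deg_superset) simp_all
  also have "\<dots> = card V - card J" by (simp add: coef_cov_expo card_V_diff[OF assms])
  finally show ?thesis by (auto simp: homogeneous_def cov_mono split: if_splits)
qed

lemma homogeneous_up: "(\<And>f \<sigma>. homogeneous 0 (x f \<sigma>)) \<Longrightarrow> homogeneous 0 (up j x f \<sigma>)"
  by (simp add: up_def homogeneous_uminus homogeneous_sum)

lemma homogeneous_bd:
  fixes x :: "(nat \<Rightarrow> 'v) \<Rightarrow> nat set \<Rightarrow> ('v, 'k::field) mpoly"
  assumes "\<And>f \<sigma>. homogeneous 0 (x f \<sigma>)"
  shows "homogeneous 1 (bd x f \<sigma>)"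
  unfolding bd_def
proof (rule homogeneous_sum)
  fix j
  have v: "homogeneous 1 (var (f j) :: ('v, 'k) mpoly)"
    by (auto simp: homogeneous_def var_def monom_deg_def)
  have "homogeneous 1 (var (f j) * up j x f \<sigma>)"
    using homogeneous_mult[OF v homogeneous_up[OF assms]] by simp
  then show "homogeneous 1 (face_sign j \<sigma> * (var (f j) * up j x f \<sigma>))"
    by (cases rule: face_sign_cases[where 'v = 'v and 'k = 'k and j = j and \<sigma> = \<sigma>])
      (simp_all add: homogeneous_uminus)
qed

lemma bd_irrelevant:
  assumes "x \<in> chains n" "f \<in> \<F>"
  shows "bd x f \<sigma> \<in> irrelevant_ideal V"
  unfolding bd_def
proof (rule ideal_sum[OF ideal_irrelevant])
  fix j assume "j \<in> J - \<sigma>"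
  then have "f j \<in> V" using \<F>_in_Q[OF assms(2)] Q_subset by blast
  then have "up j x f \<sigma> * var (f j) \<in> irrelevant_ideal V"
    by (rule ideal_mult[OF ideal_irrelevant var_irrelevant polys_up[OF chains_polys[OF assms(1)]]])
  then have "var (f j) * up j x f \<sigma> \<in> irrelevant_ideal V" by (simp only: mult.commute)
  then show "face_sign j \<sigma> * (var (f j) * up j x f \<sigma>) \<in> irrelevant_ideal V"
    by (rule ideal_mult[OF ideal_irrelevant _ polys_face_sign])
qed

lemma differential_irrelevant:
  assumes "x \<in> carrier (free_module (mpoly_ring V) (rank (Suc i)))"
  shows "differential i x l \<in> irrelevant_ideal V"
proof (cases "l < rank i")
  case True
  then have "fst (enum i l) \<in> \<F>" using enum_cell unfolding cell_def by blast
  then have "bd (chain (Suc i) x) (fst (enum i l)) (snd (enum i l)) \<in> irrelevant_ideal V"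
    by (rule bd_irrelevant[OF chain_chains[OF assms]])
  then show ?thesis using True by (simp add: differential_def vec_def)
next
  case False
  then show ?thesis by (simp add: differential_def vec_def ideal_0[OF ideal_irrelevant])
qed

lemma homogeneous_chain_unit: "homogeneous 0 (chain n (unit_vector (mpoly_ring V) c) f \<sigma>)"
  by (auto simp: chain_def unit_vector_def homogeneous_def monom_deg_def)

text \<open>All generators \<open>cov f\<close> have the same degree, since transversals are
  injective on \<open>J\<close>. Each boundary contributes exactly one variable, so the shift grows
  by 1 at every step.\<close>

lemma minimal_cellular_resolution:
  "min_graded_free_resolution V (aug ` chains 0 :: ('v, 'k::field) mpoly set) rank
     (\<lambda>i l. int (card V - card J + i)) differential augmentation"
  unfolding min_graded_free_resolution_def Let_def
proof (intro conjI allI impI ballI)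
  show "resolution (mpoly_ring V) (ideal_module (mpoly_ring V) (aug ` chains 0 :: ('v, 'k) mpoly set))
     (\<lambda>i. free_module (mpoly_ring V) (rank i)) differential augmentation"
    by (rule cellular_resolution)
next
  fix c and t
  assume t: "t \<in> supp (augmentation (unit_vector (mpoly_ring V) c) :: ('v, 'k) mpoly)"
  have "homogeneous (0 + int (card V - card J))
      (augmentation (unit_vector (mpoly_ring V) c) :: ('v, 'k) mpoly)"
    unfolding augmentation_def aug_def
    by (intro homogeneous_sum homogeneous_mult homogeneous_chain_unit homogeneous_cov)
  then show "int (monom_deg t) = int (card V - card J + 0)" using t by (simp add: homogeneous_def)
next
  fix i c l t
  assume l: "l < rank i"
    and t: "t \<in> supp (differential i (unit_vector (mpoly_ring V) c) l :: ('v, 'k) mpoly)"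
  have "homogeneous 1 (differential i (unit_vector (mpoly_ring V) c) l :: ('v, 'k) mpoly)"
    using l by (simp add: differential_def vec_def homogeneous_bd homogeneous_chain_unit)
  then show "int (monom_deg t) + int (card V - card J + i) = int (card V - card J + Suc i)"
    using t by (simp add: homogeneous_def)
next
  fix i l and x :: "nat \<Rightarrow> ('v, 'k) mpoly"
  assume "x \<in> carrier (free_module (mpoly_ring V) (rank (Suc i)))"
  then show "differential i x l \<in> irrelevant_ideal V" by (rule differential_irrelevant)
qed

lemma cov_in_aug_chains:
  assumes "f \<in> \<F>"
  shows "(cov f :: ('v, 'k::field) mpoly) \<in> aug ` chains 0"
proof -
  define x :: "(nat \<Rightarrow> 'v) \<Rightarrow> nat set \<Rightarrow> ('v, 'k) mpoly"
    where "x = (\<lambda>g \<sigma>. if g = f \<and> \<sigma> = {} then 1 else 0)"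
  have "x \<in> chains 0" using assms by (auto simp: x_def chains_def cell_def)
  moreover have "cov f = aug x"
  proof -
    have "aug x = (\<Sum>g\<in>\<F>. if g = f then cov g else 0)"
      unfolding aug_def by (rule sum.cong) (simp_all add: x_def)
    also have "\<dots> = cov f" using assms finite_\<F> by (subst sum.delta) simp_all
    finally show ?thesis by (rule sym)
  qed
  ultimately show ?thesis by (rule image_eqI[where f = aug, rotated])
qed

lemma aug_chains_subset:
  assumes I: "ideal I (mpoly_ring V)" and cov: "\<And>f. f \<in> \<F> \<Longrightarrow> cov f \<in> I"
  shows "aug ` chains 0 \<subseteq> I"
  unfolding aug_def by (auto intro!: ideal_sum[OF I] ideal_mult[OF I] cov chains_polys)

text \<open>Beyond the maximum there are no cubes. In the maximal dimension there is one, so the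
  minimal resolution does not vanish there, and \<open>minimal_resolution_length\<close> excludes
  shorter projective resolutions.\<close>

lemma proj_dim_cellular:
  assumes "\<F> \<noteq> {}"
  shows "proj_dim (mpoly_ring V) (ideal_module (mpoly_ring V) (aug ` chains 0 :: ('v, 'k::field) mpoly set)) =
    enat (Max ((\<lambda>f. card {j \<in> J. f j \<noteq> w j}) ` \<F>))" (is "proj_dim ?S ?M = enat ?N")
proof (rule antisym)
  have le: "card {j \<in> J. f j \<noteq> w j} \<le> ?N" if f: "f \<in> \<F>" for f
    using f finite_\<F> by (intro Max_ge) simp_all
  have rank0: "rank i = 0" if i: "?N < i" for i
    unfolding rank_eq
  proof (rule sum.neutral, rule ballI)
    fix f assume "f \<in> \<F>"
    then show "card {j \<in> J. f j \<noteq> w j} choose i = 0"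
      by (intro binomial_eq_0 le_less_trans[OF le i])
  qed
  show "proj_dim ?S ?M \<le> enat ?N"
    by (rule proj_dim_le[OF cellular_resolution projective_free_module])
      (auto simp: rank0 free_module_carrier)
  have "?N \<in> (\<lambda>f. card {j \<in> J. f j \<noteq> w j}) ` \<F>" using finite_\<F> assms by (intro Max_in) simp_all
  then obtain f where f: "?N = card {j \<in> J. f j \<noteq> w j}" "f \<in> \<F>" by (rule imageE)
  have pos: "0 < rank ?N"
    unfolding rank_eq by (rule sum_pos2[OF finite_\<F> f(2)]) (simp_all only: f(1)[symmetric] binomial_n_n le0 zero_less_one)
  show "enat ?N \<le> proj_dim ?S ?M"
  proof (rule proj_dim_ge)
    fix n and P :: "nat \<Rightarrow> (('v, 'k) mpoly, nat \<Rightarrow> ('v, 'k) mpoly) module" and d \<epsilon>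
    assume P: "resolution ?S ?M P d \<epsilon>" "\<And>i. projective_module ?S (P i)"
      "\<And>i. n < i \<Longrightarrow> carrier (P i) = {\<zero>\<^bsub>P i\<^esub>}"
    have "\<not> n < ?N"
    proof
      assume "n < ?N"
      then have zero: "carrier (P ?N) = {\<zero>\<^bsub>P ?N\<^esub>}" by (rule P(3))
      have "rank ?N = 0"
        by (rule minimal_resolution_length[OF ideal_aug_chains cellular_resolution _ P(1,2) zero])
          (rule irrelevant_coef_0[OF differential_irrelevant])
      then show False using pos by simp
    qed
    then show "enat ?N \<le> enat n" by simp
  qed
qed

end

section \<open>Cover ideals of well-covered chordal graphs\<close>

context well_covered_chordal
begin

definition transversals :: "(nat \<Rightarrow> 'v) set" where
  "transversals = {f \<in> Pi\<^sub>E {1..m} F. indep E (f ` {1..m})}"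

lemma transversal_in: "f \<in> transversals \<Longrightarrow> j \<in> {1..m} \<Longrightarrow> f j \<in> F j"
  unfolding transversals_def by (blast intro: PiE_mem)

text \<open>Each point lies in only one of the cliques, so the image of a transversal determines its
  values.\<close>

lemma transversal_eq: "f \<in> transversals \<Longrightarrow> g \<in> transversals \<Longrightarrow> f ` {1..m} = g ` {1..m} \<Longrightarrow> f = g"
proof -
  assume fg: "f \<in> transversals" "g \<in> transversals" "f ` {1..m} = g ` {1..m}"
  have "f j = g j" if j: "j \<in> {1..m}" for j
  proof -
    have "f j \<in> g ` {1..m}" using j fg(3) by blast
    then obtain i where i: "f j = g i" "i \<in> {1..m}" by (rule imageE)
    have "f j \<in> F i" unfolding i(1) by (rule transversal_in[OF fg(2) i(2)])
    then have "i = j" using F_disjoint[OF i(2) j] transversal_in[OF fg(1) j] by blast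
    then show ?thesis using i(1) by simp
  qed
  moreover have "f \<in> Pi\<^sub>E {1..m} F" "g \<in> Pi\<^sub>E {1..m} F" using fg by (simp_all add: transversals_def)
  ultimately show "f = g" by (intro PiE_ext)
qed

lemma transversal_update:
  assumes "f \<in> transversals" "j \<in> {1..m}"
  shows "f(j := w j) \<in> transversals"
proof -
  let ?g = "f(j := w j)"
  have fP: "f \<in> Pi\<^sub>E {1..m} F" and ind: "indep E (f ` {1..m})" using assms(1) by (simp_all add: transversals_def)
  have "?g \<in> Pi\<^sub>E {1..m} F" using fP assms(2) w_in_F by (auto simp: PiE_iff extensional_def)
  moreover have "{?g a, ?g b} \<notin> E" if ab: "a \<in> {1..m}" "b \<in> {1..m}" for a b
  proof
    have no: False if c: "c \<in> {1..m}" "c \<noteq> j" "{w j, f c} \<in> E" for c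
      using F_disjoint[OF c(1) assms(2) transversal_in[OF assms(1) c(1)] w_nbr[OF assms(2) c(3)]] c(2) by simp
    assume e: "{?g a, ?g b} \<in> E"
    consider "a = j" "b = j" | "a = j" "b \<noteq> j" | "a \<noteq> j" "b = j" | "a \<noteq> j" "b \<noteq> j" by blast
    then show False
    proof cases
      case 1
      then show False using edge_neq[OF e] by simp
    next
      case 2
      then show False using no[OF ab(2)] e by simp
    next
      case 3
      then show False using no[OF ab(1)] edge_sym[OF e] by simp
    next
      case 4
      then show False using ind ab e by (simp add: indep_def)
    qed
  qed
  ultimately show ?thesis by (simp add: transversals_def indep_def)
qed

lemma transversal_range: "f \<in> transversals \<Longrightarrow> f ` {1..m} \<subseteq> V"
  using transversal_in F_subset by blast

lemma star_complex: "star_complex V {1..m} F w transversals"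
proof
  show "finite V" by (rule finite_V)
  show "finite {1..m}" by simp
  show "F j \<subseteq> V" if "j \<in> {1..m}" for j using that by (rule F_subset)
  show "i = j" if "i \<in> {1..m}" "j \<in> {1..m}" "v \<in> F i" "v \<in> F j" for i j v using that by (rule F_disjoint)
  show "w j \<in> F j" if "j \<in> {1..m}" for j using that by (rule w_in_F)
  show "transversals \<subseteq> Pi\<^sub>E {1..m} F" by (auto simp: transversals_def)
  show "f(j := w j) \<in> transversals" if "f \<in> transversals" "j \<in> {1..m}" for f j using that by (rule transversal_update)
qed

sublocale star_complex V "{1..m}" F w transversals
  by (rule star_complex)

lemma bij_min_vertex_covers: "bij_betw (\<lambda>f. V - f ` {1..m}) transversals (min_vertex_covers V E)"
proof (rule bij_betw_imageI)
  show "inj_on (\<lambda>f. V - f ` {1..m}) transversals"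
  proof (rule inj_onI)
    fix f g assume fg: "f \<in> transversals" "g \<in> transversals" "V - f ` {1..m} = V - g ` {1..m}"
    then have "f ` {1..m} = g ` {1..m}" using transversal_range[OF fg(1)] transversal_range[OF fg(2)] by blast
    then show "f = g" by (rule transversal_eq[OF fg(1,2)])
  qed
  show "(\<lambda>f. V - f ` {1..m}) ` transversals = min_vertex_covers V E"
  proof (intro equalityI subsetI)
    fix C assume "C \<in> (\<lambda>f. V - f ` {1..m}) ` transversals"
    then obtain f where f: "C = V - f ` {1..m}" "f \<in> transversals" by (rule imageE)
    have "f \<in> {1..m} \<rightarrow>\<^sub>E V" using f(2) transversal_range[OF f(2)] unfolding transversals_def PiE_iff by blast
    then show "C \<in> min_vertex_covers V E"
      unfolding f(1)
    proof (rule indep_transversal)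
      show "f j \<in> F j" if "j \<in> {1..m}" for j by (rule transversal_in[OF f(2) that])
      show "indep E (f ` {1..m})" using f(2) by (simp add: transversals_def)
    qed
  next
    fix C assume "C \<in> min_vertex_covers V E"
    then show "C \<in> (\<lambda>f. V - f ` {1..m}) ` transversals"
    proof (rule transversal_exists)
      fix f assume f: "f \<in> {1..m} \<rightarrow>\<^sub>E V" "\<And>j. j \<in> {1..m} \<Longrightarrow> f j \<in> F j" "indep E (f ` {1..m})"
        "C = V - f ` {1..m}"
      have "f \<in> Pi\<^sub>E {1..m} F" using f(1) by (intro PiE_I f(2)) (auto simp: PiE_iff extensional_def)
      then have "f \<in> transversals" using f(3) by (simp add: transversals_def)
      with f(4) show ?thesis by (rule image_eqI)
    qed
  qed
qed

text \<open>Translates the dimension of the largest cube at \<open>f\<close> into the number of the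
  theorem: a transversal meets the chosen free vertices precisely where
  \<open>f j = w j\<close>.\<close>

lemma card_moved:
  assumes "f \<in> transversals"
  shows "card {j \<in> {1..m}. f j \<noteq> w j} = card (V - (w ` {1..m} \<union> (V - f ` {1..m})))"
proof -
  have "f j \<in> w ` {1..m} \<longleftrightarrow> f j = w j" if j: "j \<in> {1..m}" for j
  proof
    assume "f j \<in> w ` {1..m}"
    then obtain i where i: "f j = w i" "i \<in> {1..m}" by (rule imageE)
    have "w i \<in> F j" using transversal_in[OF assms j] i(1) by simp
    then show "f j = w j" using w_unique[OF i(2) j] i(1) by simp
  qed (use j in simp)
  then have "f ` {1..m} - w ` {1..m} = f ` {j \<in> {1..m}. f j \<noteq> w j}" by fast
  moreover have "V - (w ` {1..m} \<union> (V - f ` {1..m})) = f ` {1..m} - w ` {1..m}"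
    using transversal_range[OF assms] by blast
  ultimately have eq: "V - (w ` {1..m} \<union> (V - f ` {1..m})) = f ` {j \<in> {1..m}. f j \<noteq> w j}" by simp
  have "inj_on f {j \<in> {1..m}. f j \<noteq> w j}"
  proof (rule inj_onI)
    fix a b assume ab: "a \<in> {j \<in> {1..m}. f j \<noteq> w j}" "b \<in> {j \<in> {1..m}. f j \<noteq> w j}" "f a = f b"
    then have J: "a \<in> {1..m}" "b \<in> {1..m}" by blast+
    have "f b \<in> F a" unfolding ab(3)[symmetric] by (rule transversal_in[OF assms J(1)])
    then show "a = b" by (rule F_disjoint[OF J]) (rule transversal_in[OF assms J(2)])
  qed
  then show ?thesis unfolding eq by (simp add: card_image)
qed

lemma min_cover_exists:
  assumes "C \<in> vertex_covers V E"
  obtains D where "D \<in> min_vertex_covers V E" "D \<subseteq> C"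
proof -
  have C: "C \<subseteq> V" "\<And>e. e \<in> E \<Longrightarrow> C \<inter> e \<noteq> {}" using assms by (auto simp: vertex_covers_def)
  have "indep E (V - C)" unfolding indep_def using C(2) by fastforce
  then obtain X where X: "max_indep V E X" "V - C \<subseteq> X" using indep_extend[of "V - C"] by auto
  have "V - X \<in> min_vertex_covers V E" using X(1) by (simp add: min_vertex_cover_iff max_indep_def Diff_Diff_Int Int_absorb1)
  moreover have "V - X \<subseteq> C" using X(2) by blast
  ultimately show thesis by (rule that)
qed

text \<open>Every cover contains a minimal one, so its monomial is a multiple of some
  \<open>cov f\<close>.\<close>

lemma cover_ideal_eq: "(cover_ideal V E :: ('v, 'k::field) mpoly set) = aug ` chains 0"
proof (rule equalityI)
  let ?G = "(\<lambda>C. \<Prod>v\<in>C. var v) ` vertex_covers V E :: ('v, 'k) mpoly set"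
  have G: "?G \<subseteq> polys V" by (auto simp: vertex_covers_def intro!: polys_prod polys_var)
  show "cover_ideal V E \<subseteq> (aug ` chains 0 :: ('v, 'k) mpoly set)"
    unfolding cover_ideal_def
  proof (rule genideal_least[OF ideal_aug_chains], rule image_subsetI)
    fix C assume C: "C \<in> vertex_covers V E"
    obtain D where D: "D \<in> min_vertex_covers V E" "D \<subseteq> C" by (rule min_cover_exists[OF C])
    have "D \<in> (\<lambda>f. V - f ` {1..m}) ` transversals" using D(1) bij_min_vertex_covers by (simp add: bij_betw_def)
    then obtain f where f: "D = V - f ` {1..m}" "f \<in> transversals" by (rule imageE)
    have CV: "C \<subseteq> V" using C by (simp add: vertex_covers_def)
    then have "(\<Prod>v\<in>C. var v :: ('v, 'k) mpoly) = (\<Prod>v\<in>C - D. var v) * (\<Prod>v\<in>D. var v)"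
      using D(2) finite_V finite_subset by (intro prod.subset_diff) auto
    also have "\<dots> = (\<Prod>v\<in>C - D. var v) * cov f" unfolding cov_def f(1) ..
    also have "\<dots> \<in> aug ` chains 0"
      using CV by (intro ideal_mult[OF ideal_aug_chains] cov_in_aug_chains f(2) polys_prod polys_var) blast
    finally show "(\<Prod>v\<in>C. var v) \<in> (aug ` chains 0 :: ('v, 'k) mpoly set)" .
  qed
  show "aug ` chains 0 \<subseteq> (cover_ideal V E :: ('v, 'k) mpoly set)"
  proof (rule aug_chains_subset)
    show "ideal (cover_ideal V E) (mpoly_ring V :: ('v, 'k) mpoly ring)"
      unfolding cover_ideal_def by (rule ideal_genideal[OF G])
    fix f assume "f \<in> transversals"
    then have "V - f ` {1..m} \<in> min_vertex_covers V E" by (rule bij_betwE[OF bij_min_vertex_covers, THEN bspec])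
    then have "V - f ` {1..m} \<in> vertex_covers V E" by (simp add: min_vertex_covers_def)
    then have "(cov f :: ('v, 'k) mpoly) \<in> ?G" unfolding cov_def by (rule imageI)
    then show "(cov f :: ('v, 'k) mpoly) \<in> cover_ideal V E"
      unfolding cover_ideal_def by (rule set_mp[OF genideal_incl[OF G]])
  qed
qed

lemma ideal_cover_ideal: "ideal (cover_ideal V E) (mpoly_ring V)"
  unfolding cover_ideal_eq by (rule ideal_aug_chains)

lemma cover_ideal_resolution:
  "min_graded_free_resolution V (cover_ideal V E) rank (\<lambda>i l. int (card V - card {1..m} + i))
     differential augmentation"
  unfolding cover_ideal_eq by (rule minimal_cellular_resolution)

lemma betti_cover_ideal:
  "betti V (cover_ideal V E :: ('v, 'k::field) mpoly set) i =
    (\<Sum>C\<in>min_vertex_covers V E. card (V - (w ` {1..m} \<union> C)) choose i)"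
proof -
  have "betti V (cover_ideal V E :: ('v, 'k) mpoly set) i = rank i"
    by (rule betti_eq[OF ideal_cover_ideal cover_ideal_resolution])
  also have "\<dots> = (\<Sum>f\<in>transversals. card (V - (w ` {1..m} \<union> (V - f ` {1..m}))) choose i)"
    unfolding rank_eq by (rule sum.cong[OF refl]) (simp only: card_moved)
  also have "\<dots> = (\<Sum>C\<in>min_vertex_covers V E. card (V - (w ` {1..m} \<union> C)) choose i)"
    by (rule sum.reindex_bij_betw[OF bij_min_vertex_covers])
  finally show ?thesis .
qed

lemma proj_dim_cover_ideal:
  "proj_dim (mpoly_ring V) (ideal_module (mpoly_ring V) (cover_ideal V E :: ('v, 'k::field) mpoly set)) =
    enat (Max {card (V - (w ` {1..m} \<union> C)) |C. C \<in> min_vertex_covers V E})"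
proof -
  have covers: "min_vertex_covers V E = (\<lambda>f. V - f ` {1..m}) ` transversals"
    using bij_min_vertex_covers by (simp add: bij_betw_def)
  have "V \<inter> e \<noteq> {}" if e: "e \<in> E" for e
  proof -
    have "e \<subseteq> V" "card e = 2" using simple e by (auto simp: simple_graph_def)
    then show ?thesis by (auto simp: Int_absorb1)
  qed
  then have "V \<in> vertex_covers V E" by (simp add: vertex_covers_def)
  then obtain D where "D \<in> min_vertex_covers V E" by (rule min_cover_exists)
  then have ne: "transversals \<noteq> {}" unfolding covers by blast
  have "{card (V - (w ` {1..m} \<union> C)) |C. C \<in> min_vertex_covers V E} =
      (\<lambda>f. card (V - (w ` {1..m} \<union> (V - f ` {1..m})))) ` transversals"
    unfolding covers Setcompr_eq_image image_image ..
  also have "\<dots> = (\<lambda>f. card {j \<in> {1..m}. f j \<noteq> w j}) ` transversals"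
    by (rule image_cong[OF refl]) (simp only: card_moved)
  finally show ?thesis unfolding cover_ideal_eq by (simp only: proj_dim_cellular[OF ne])
qed

lemma graded_betti_cover_ideal:
  "graded_betti V (cover_ideal V E :: ('v, 'k::field) mpoly set) i j =
    card {l. l < rank i \<and> int (card V - card {1..m} + i) = j}"
  by (rule graded_betti_eq[OF ideal_cover_ideal cover_ideal_resolution])

end

theorem corollary4p4:
  fixes V :: "'v set" and E :: "'v set set"
    and m :: nat and F :: "nat \<Rightarrow> 'v set" and w :: "nat \<Rightarrow> 'v"
  assumes "simple_graph V E"
    and "chordal E"
    and "cohen_macaulay_quotient V (edge_ideal V E :: ('v, 'k::field) mpoly set)"
    and "bij_betw F {1..m} {F' \<in> max_cliques V E. \<exists>v\<in>F'. free_vertex V E v}"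
    and "\<forall>i\<in>{1..m}. w i \<in> F i \<and> free_vertex V E (w i)"
  shows "(\<forall>i. betti V (cover_ideal V E :: ('v, 'k) mpoly set) i =
            (\<Sum>C\<in>min_vertex_covers V E. card (V - (w ` {1..m} \<union> C)) choose i))
       \<and> proj_dim (mpoly_ring V)
            (ideal_module (mpoly_ring V) (cover_ideal V E :: ('v, 'k) mpoly set)) =
          enat (Max {card (V - (w ` {1..m} \<union> C)) |C. C \<in> min_vertex_covers V E})
       \<and> (\<forall>i j. graded_betti V (cover_ideal V E :: ('v, 'k) mpoly set) i j =
                graded_betti V (cover_ideal V E :: ('v, 'l::field) mpoly set) i j)"
proof -
  have simple: "simple_graph_loc V E" by (rule simple_graph_loc.intro[OF assms(1)])
  have loc: "well_covered_chordal V E m F w"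
  proof (intro well_covered_chordal.intro chordal_graph.intro simple chordal_graph_axioms.intro
      well_covered_chordal_axioms.intro assms(2,4))
    show "card C = card C'" if "C \<in> min_vertex_covers V E" "C' \<in> min_vertex_covers V E" for C C'
      using that by (rule simple_graph_loc.cohen_macaulay_unmixed[OF simple assms(3)])
    show "w i \<in> F i \<and> free_vertex V E (w i)" if "i \<in> {1..m}" for i using assms(5) that by (rule bspec)
  qed
  \<comment> \<open>The locale is purely combinatorial once the covers are known to be equicardinal.
    The same count of cubes therefore gives the graded Betti numbers over both fields.\<close>
  show ?thesis
    by (intro conjI allI well_covered_chordal.betti_cover_ideal[OF loc]
        well_covered_chordal.proj_dim_cover_ideal[OF loc])
      (simp only: well_covered_chordal.graded_betti_cover_ideal[OF loc])
qed

end
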